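(* Let $n$ be a positive integer and let $\lambda$ be a partition of $n$ such that $f_\lambda=\dim S^\lambda$ is even. Write the Gram determinant as $\det(\lambda)=m\cdot 2^{a^{(2)}_\lambda}$ with $m$ an odd integer and $a^{(2)}_\lambda\in\mathbb{Z}$. Then $a^{(2)}_\lambda$ is even.
   Context: For a partition $\lambda$ of $n$, $S^\lambda$ denotes the Specht module of the symmetric group $\mathfrak{S}_n$, $f_\lambda=\dim S^\lambda$ (equal to $n!/\prod_{c\in[\lambda]}h_\lambda(c)$, where $h_\lambda(c)$ is the hook length of the cell $c$ of the Young diagram $[\lambda]$), and $\det(\lambda)\in\mathbb{Z}$ is the determinant of the Gram matrix of the canonical $\mathfrak{S}_n$-invariant bilinear form on $S^\lambda$ (coming from its embedding in the permutation module) with respect to the standard basis of $S^\lambda$ (standard polytabloids). *)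

theory Defs
  imports "Jordan_Normal_Form.Determinant" "HOL-Library.FuncSet" "HOL-Library.Function_Algebras"
begin

text \<open>Partitions are weakly decreasing lists of positive parts; rows, columns and cells are
  indexed from 0, and the symmetric group consists of the permutations of \<open>{1..n}\<close>.\<close>

definition partition_of :: "nat \<Rightarrow> nat list \<Rightarrow> bool" where
  "partition_of n \<mu> \<longleftrightarrow> sorted_wrt (\<ge>) \<mu> \<and> 0 \<notin> set \<mu> \<and> sum_list \<mu> = n"

definition diagram :: "nat list \<Rightarrow> (nat \<times> nat) set" where
  "diagram \<mu> = {(i, j). i < length \<mu> \<and> j < \<mu> ! i}"

definition row :: "nat list \<Rightarrow> nat \<Rightarrow> (nat \<times> nat) set" where
  "row \<mu> i = {c \<in> diagram \<mu>. fst c = i}"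

definition column :: "nat list \<Rightarrow> nat \<Rightarrow> (nat \<times> nat) set" where
  "column \<mu> j = {c \<in> diagram \<mu>. snd c = j}"

type_synonym tableau = "nat \<times> nat \<Rightarrow> nat"

text \<open>Extensionality (value \<open>undefined\<close> off the diagram) makes equality of tableaux
  mean equality of their entries.\<close>

definition tableaux :: "nat list \<Rightarrow> tableau set" where
  "tableaux \<mu> = {t \<in> extensional (diagram \<mu>). bij_betw t (diagram \<mu>) {1..sum_list \<mu>}}"

definition standard_tableaux :: "nat list \<Rightarrow> tableau set" where
  "standard_tableaux \<mu> = {t \<in> tableaux \<mu>.
     (\<forall>i j j'. (i, j) \<in> diagram \<mu> \<and> (i, j') \<in> diagram \<mu> \<and> j < j' \<longrightarrow> t (i, j) < t (i, j')) \<and>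
     (\<forall>i i' j. (i, j) \<in> diagram \<mu> \<and> (i', j) \<in> diagram \<mu> \<and> i < i' \<longrightarrow> t (i, j) < t (i', j))}"

definition act :: "nat list \<Rightarrow> (nat \<Rightarrow> nat) \<Rightarrow> tableau \<Rightarrow> tableau" where
  "act \<mu> \<pi> t = restrict (\<pi> \<circ> t) (diagram \<mu>)"

definition row_stabilizer :: "nat list \<Rightarrow> tableau \<Rightarrow> (nat \<Rightarrow> nat) set" where
  "row_stabilizer \<mu> t =
     {\<pi>. \<pi> permutes {1..sum_list \<mu>} \<and> (\<forall>i. \<pi> ` t ` row \<mu> i = t ` row \<mu> i)}"

definition column_stabilizer :: "nat list \<Rightarrow> tableau \<Rightarrow> (nat \<Rightarrow> nat) set" where
  "column_stabilizer \<mu> t =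
     {\<pi>. \<pi> permutes {1..sum_list \<mu>} \<and> (\<forall>j. \<pi> ` t ` column \<mu> j = t ` column \<mu> j)}"

text \<open>A tabloid is a row-equivalence class of tableaux.\<close>

type_synonym tabloid = "tableau set"

definition tabloid :: "nat list \<Rightarrow> tableau \<Rightarrow> tabloid" where
  "tabloid \<mu> t = (\<lambda>\<pi>. act \<mu> \<pi> t) ` row_stabilizer \<mu> t"

definition tabloids :: "nat list \<Rightarrow> tabloid set" where
  "tabloids \<mu> = tabloid \<mu> ` tableaux \<mu>"

text \<open>Elements of the permutation module are given by their coefficients on tabloids. The
  coefficient ring is left open: the Specht module is taken over \<open>rat\<close>, the Gram matrix over
  \<open>int\<close>. The polytabloid is the signed sum, over the column stabilizer of \<open>t\<close>, of the tabloids
  of \<open>\<pi> t\<close>.\<close>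

definition polytabloid :: "nat list \<Rightarrow> tableau \<Rightarrow> (tabloid \<Rightarrow> 'a::comm_ring_1)" where
  "polytabloid \<mu> t = (\<lambda>T. \<Sum>\<pi>\<in>column_stabilizer \<mu> t.
     of_int (sign \<pi>) * (if T = tabloid \<mu> (act \<mu> \<pi> t) then 1 else 0))"

text \<open>The invariant form for which the tabloids are orthonormal.\<close>

definition tabloid_form ::
    "nat list \<Rightarrow> (tabloid \<Rightarrow> 'a) \<Rightarrow> (tabloid \<Rightarrow> 'a) \<Rightarrow> 'a::comm_ring_1" where
  "tabloid_form \<mu> u v = (\<Sum>T\<in>tabloids \<mu>. u T * v T)"

global_interpretation tabloid_space: vector_space "\<lambda>(c::rat) (v::tabloid \<Rightarrow> rat) T. c * v T"
  by unfold_locales (auto simp: fun_eq_iff algebra_simps)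

definition specht_module :: "nat list \<Rightarrow> (tabloid \<Rightarrow> rat) set" where
  "specht_module \<mu> = tabloid_space.span (polytabloid \<mu> ` tableaux \<mu>)"

definition specht_dim :: "nat list \<Rightarrow> nat" where
  "specht_dim \<mu> = tabloid_space.dim (specht_module \<mu>)"

definition gram_matrix :: "nat list \<Rightarrow> tableau list \<Rightarrow> int mat" where
  "gram_matrix \<mu> ts = mat (length ts) (length ts)
     (\<lambda>(i, j). tabloid_form \<mu> (polytabloid \<mu> (ts ! i)) (polytabloid \<mu> (ts ! j)))"

text \<open>The choice of an ordering of the standard tableaux is immaterial, see
  \<open>gram_det_eq\<close> below.\<close>

definition gram_det :: "nat list \<Rightarrow> int" where
  "gram_det \<mu> =
     det (gram_matrix \<mu> (SOME ts. distinct ts \<and> set ts = standard_tableaux \<mu>))"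

lemma finite_tableaux: "finite (tableaux \<mu>)"
proof -
  have "diagram \<mu> = (SIGMA i:{..<length \<mu>}. {..<\<mu> ! i})"
    by (auto simp: diagram_def)
  then have "finite (diagram \<mu>)"
    by auto
  moreover have "tableaux \<mu> \<subseteq> diagram \<mu> \<rightarrow>\<^sub>E {1..sum_list \<mu>}"
    by (force simp: tableaux_def PiE_def bij_betw_def)
  ultimately show ?thesis
    by (meson finite_PiE finite_atLeastAtMost finite_subset)
qed

lemma ex_standard_enumeration: "\<exists>ts. distinct ts \<and> set ts = standard_tableaux \<mu>"
  using finite_distinct_list[of "standard_tableaux \<mu>"] finite_tableaux[of \<mu>]
  by (auto simp: standard_tableaux_def)

lemma det_gram_matrix_reorder:
  assumes "distinct ts" "distinct us" "set ts = set us"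
  shows "det (gram_matrix \<mu> ts) = det (gram_matrix \<mu> us)"
proof -
  define n where "n = length us"
  have "mset ts = mset us"
    using assms set_eq_iff_mset_eq_distinct by blast
  then obtain p where p: "p permutes {..<n}" "permute_list p us = ts"
    unfolding n_def by (rule mset_eq_permutation)
  then have p': "p permutes {0..<n}"
    by (simp add: atLeast0LessThan)
  have len: "length ts = n"
    using p(2) n_def by auto
  have nth: "ts ! i = us ! p i" if "i < n" for i
    using p that permute_list_nth[of p us i] by (auto simp: n_def)
  have less: "p i < n" if "i < n" for i
    using p(1) that permutes_in_image by fastforce
  let ?A = "gram_matrix \<mu> us"
  let ?B = "mat n n (\<lambda>(i, j). ?A $$ (p i, j))"
  have A: "?A \<in> carrier_mat n n"
    by (simp add: gram_matrix_def n_def)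
  have "gram_matrix \<mu> ts = transpose_mat (mat n n (\<lambda>(i, j). transpose_mat ?B $$ (p i, j)))"
    by (rule eq_matI) (auto simp: gram_matrix_def len nth less n_def[symmetric])
  also have "det \<dots> = det (mat n n (\<lambda>(i, j). transpose_mat ?B $$ (p i, j)))"
    by (rule det_transpose[of _ n]) auto
  also have "\<dots> = signof p * det (transpose_mat ?B)"
    by (rule det_permute_rows[OF _ p']) auto
  also have "det (transpose_mat ?B) = det ?B"
    by (rule det_transpose[of _ n]) auto
  also have "det ?B = signof p * det ?A"
    by (rule det_permute_rows[OF A p'])
  finally show ?thesis
    by (simp add: sign_def split: if_splits)
qed

lemma gram_det_eq:
  assumes "distinct ts" "set ts = standard_tableaux \<mu>"
  shows "gram_det \<mu> = det (gram_matrix \<mu> ts)"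
  unfolding gram_det_def
  using someI_ex[OF ex_standard_enumeration[of \<mu>]] assms
  by (intro det_gram_matrix_reorder) auto

end

theory Submission
  imports Defs "HOL-Library.Z2" "HOL-Computational_Algebra.Primes"
begin

text \<open>The simultaneous eigenvectors of the Jucys-Murphy elements form an orthogonal basis
  \<open>v t\<close> of the Specht module, indexed by the standard tableaux, and an admissible swap of two
  consecutive entries whose contents differ by \<open>d\<close> multiplies the norm of \<open>v t\<close> by
  \<open>d\<^sup>2 - 1\<close> up to a square. Hence, when the dimension is even, the Gram determinant is,
  up to a rational square, the product over all \<open>t\<close> of the numbers \<open>d\<^sup>2 - 1\<close> over the inversions
  of \<open>t\<close>.

  To compute the parity of its 2-adic valuation, pass to beta numbers \<open>b\<close>. Modulo 2 the number
  \<open>\<phi> n b\<close> of standard tableaux satisfies \<open>\<phi> (n + q) b = (\<Sum>a. \<phi> n (b - q e\<^sub>a))\<close> for every power \<open>q\<close>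
  of 2, where \<open>e\<^sub>a\<close> is the \<open>a\<close>-th unit vector. By a telescoping argument in the spirit of the
  James-Murphy formula, the parity in question is the sum over the powers \<open>d > 1\<close> of 2 of
  \<open>Q\<^sub>d n b = (\<Sum>i j h. \<phi> n (b - h e\<^sub>i + h e\<^sub>j))\<close>, where \<open>0 < h < b i - b j\<close> and \<open>d\<close> divides \<open>h\<close>. If \<open>\<phi> n b = 0\<close>,
  choose the largest power \<open>q \<le> n\<close> of 2. At most one term of the recursion for \<open>\<phi>\<close> is nonzero, so all
  vanish, and if \<open>d\<close> divides \<open>q\<close> then \<open>Q\<^sub>d\<close> obeys the same recursion up to such terms. By
  induction \<open>Q\<^sub>d n b = 0\<close>, since for \<open>n < d\<close> the sum is zero term by term.\<close>

text \<open>The evenness of the dimension enters twice. The norms of the \<open>v t\<close> are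
  known only up to one common rational factor; it occurs in the determinant as often as there are
  standard tableaux, hence to an even power, and disappears into the square. And the vanishing of
  the dimension modulo 2, that is of \<open>\<phi> n b\<close>, drives the parity computation. The
  recursion for a power q of 2 is the Frobenius map: \<open>\<phi>\<close> iterates a sum of
  commuting lowering operators, and in characteristic 2 the q-th power of the sum is the sum of the
  q-th powers. In terms of diagrams it removes rim hooks of length q. The obstacle lies at the
  boundary. Lowering an entry can make it negative or equal to another one; then
  \<open>\<phi>\<close> is 0, but single terms of \<open>Q\<^sub>d\<close> need not be, because a
  transfer can repair the defect. Adding empty rows controls this: with enough rows all small values
  have to be occupied, so only very few transfers can repair a negative entry, and repeated entries
  cancel in pairs.\<close>

section \<open>Beta numbers modulo 2\<close>

declare add_bit_eq_xor [simp del] mult_bit_eq_and [simp del]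

section \<open>Cancellation modulo 2 and minimal sums of distinct integers\<close>

lemma bit_add_self [simp]: "(x::bit) + x = 0"
  by (cases x) auto

text \<open>In characteristic 2 the two members of an orbit of size two cancel, and the fixed points
  carry the value 0 by assumption.\<close>

lemma sum_bit_involution:
  fixes g :: "'a \<Rightarrow> bit"
  assumes "finite A" "\<And>x. x \<in> A \<Longrightarrow> f x \<in> A" "\<And>x. x \<in> A \<Longrightarrow> f (f x) = x"
    "\<And>x. x \<in> A \<Longrightarrow> g (f x) = g x" "\<And>x. x \<in> A \<Longrightarrow> f x = x \<Longrightarrow> g x = 0"
  shows "sum g A = 0"
  using assms
proof (induction "card A" arbitrary: A rule: less_induct)
  case less
  show ?case
  proof (cases "A = {}")
    case False
    then obtain x where x: "x \<in> A"
      by blast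
    let ?B = "A - {x, f x}"
    have "sum g ?B = 0"
    proof (rule less.hyps)
      show "card ?B < card A"
        using x less.prems(1) by (intro psubset_card_mono) auto
      show "f y \<in> ?B" if "y \<in> ?B" for y
      proof -
        have "f y \<in> A" "f (f y) = y" "f (f x) = x" "y \<noteq> x" "y \<noteq> f x"
          using that less.prems(2,3) x by auto
        then show ?thesis
          by (metis Diff_iff empty_iff insert_iff)
      qed
    qed (use less.prems in auto)
    moreover have "sum g A = sum g ?B + sum g {x, f x}"
      using x less.prems(1,2) by (intro sum.subset_diff) auto
    moreover have "sum g {x, f x} = 0"
      using x less.prems(4,5) by (cases "f x = x") auto
    ultimately show ?thesis
      by simp
  qed simp
qed

lemma sum_upto_card_le:
  fixes A :: "int set"
  assumes "finite A" "\<And>x. x \<in> A \<Longrightarrow> 0 \<le> x"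
  shows "(\<Sum>i<card A. int i) \<le> \<Sum>A"
  using assms
proof (induction A rule: finite_linorder_max_induct)
  case (insert b A)
  have "A \<subseteq> {0..<b}"
    using insert by auto
  then have "int (card A) \<le> b"
    using card_mono[of "{0..<b}" A] insert.prems[of b] by auto
  with insert show ?case
    by (subst card_insert_disjoint) (auto simp: sum.insert_if)
qed simp

text \<open>This bound yields the contradictions on size below: distinct nonnegative entries cannot
  be lowered so far that their sum falls under \<open>0 + ... + (r - 1)\<close>.\<close>

lemma sum_index_le_sum_inj:
  fixes b :: "nat \<Rightarrow> int"
  assumes "inj_on b {..<r}" "\<And>i. i < r \<Longrightarrow> 0 \<le> b i"
  shows "(\<Sum>i<r. int i) \<le> (\<Sum>i<r. b i)"
  using sum_upto_card_le[of "b ` {..<r}"] assms by (auto simp: card_image sum.reindex)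

text \<open>For the beta numbers \<open>b\<close> of a partition of \<open>n\<close> this is the number of standard tableaux modulo 2.
  The recursion also passes through \<open>b\<close> with negative or coinciding entries, where the value
  turns out to be 0.\<close>

fun beta_count :: "nat \<Rightarrow> nat \<Rightarrow> (nat \<Rightarrow> int) \<Rightarrow> bit" where
  "beta_count r 0 b = of_bool (b ` {..<r} = {0..<int r})"
| "beta_count r (Suc n) b = (\<Sum>a<r. beta_count r n (b(a := b a - 1)))"

section \<open>Symmetry, support and the power of 2 recursion of the count\<close>

lemma beta_count_permute:
  assumes "p permutes {..<r}"
  shows "beta_count r n (b \<circ> p) = beta_count r n b"
proof (induction n arbitrary: b)
  case 0
  have "(b \<circ> p) ` {..<r} = b ` {..<r}"
    using permutes_image[OF assms] by (metis image_comp)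
  then show ?case
    by simp
next
  case (Suc n)
  have "beta_count r (Suc n) (b \<circ> p) = (\<Sum>a<r. beta_count r n (b(p a := b (p a) - 1) \<circ> p))"
    using permutes_inj[OF assms]
    by (auto intro!: sum.cong arg_cong[where f = "beta_count r n"] simp: fun_eq_iff inj_eq)
  also have "\<dots> = (\<Sum>a<r. beta_count r n (b(p a := b (p a) - 1)))"
    by (simp only: Suc.IH)
  also have "\<dots> = (\<Sum>a<r. beta_count r n (b(a := b a - 1)))"
    using sum.permute[OF assms, of "\<lambda>a. beta_count r n (b(a := b a - 1))"] by (simp add: comp_def)
  finally show ?case
    by (simp only: beta_count.simps)
qed

lemma beta_count_swap:
  assumes "i < r" "j < r" "i \<noteq> j"
  shows "beta_count r n (b(i := x, j := y)) = beta_count r n (b(i := y, j := x))"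
proof -
  have "transpose i j permutes {..<r}"
    using assms by (intro permutes_swap_id) auto
  from beta_count_permute[OF this, of n "b(i := y, j := x)"]
  have "beta_count r n (b(i := y, j := x) \<circ> transpose i j) = beta_count r n (b(i := y, j := x))" .
  moreover have "b(i := y, j := x) \<circ> transpose i j = b(i := x, j := y)"
    using assms(3) by (auto simp: fun_eq_iff transpose_def)
  ultimately show ?thesis
    by simp
qed

text \<open>Lowering either of the two equal entries gives the same sequence up to order, so these
  two terms cancel modulo 2; lowering a third entry keeps the collision.\<close>

lemma beta_count_not_inj:
  assumes "i < r" "j < r" "i \<noteq> j" "b i = b j"
  shows "beta_count r n b = 0"
  using assms(4)
proof (induction n arbitrary: b)
  case 0
  have "\<not> inj_on b {..<r}"
    using assms 0 by (auto simp: inj_on_def)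
  then have "card (b ` {..<r}) \<noteq> r"
    using eq_card_imp_inj_on[of "{..<r}" b] by auto
  then show ?case
    by auto
next
  case (Suc n)
  have "beta_count r n (b(i := b i - 1)) = beta_count r n (b(j := b j - 1))"
    using beta_count_swap[OF assms(1-3), of n b "b i - 1" "b j"] Suc.prems assms(3)
    by (simp add: fun_upd_idem fun_upd_twist)
  moreover have "(\<Sum>a\<in>{..<r} - {i, j}. beta_count r n (b(a := b a - 1))) = 0"
    using Suc by (intro sum.neutral) auto
  moreover have "beta_count r (Suc n) b = (\<Sum>a\<in>{..<r} - {i, j}. beta_count r n (b(a := b a - 1)))
      + (\<Sum>a\<in>{i, j}. beta_count r n (b(a := b a - 1)))"
    using assms by (simp add: sum.subset_diff[of "{i, j}" "{..<r}"])
  ultimately show ?case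
    using assms(3) by simp
qed

lemma beta_count_neg:
  assumes "i < r" "b i < 0"
  shows "beta_count r n b = 0"
  using assms(2)
proof (induction n arbitrary: b)
  case 0
  then have "b i \<notin> {0..<int r}" "b i \<in> b ` {..<r}"
    using assms(1) by auto
  then show ?case
    by auto
next
  case (Suc n)
  have "beta_count r n (b(a := b a - 1)) = 0" for a
    using Suc.prems by (intro Suc.IH) auto
  then show ?case
    by simp
qed

lemma beta_count_inj:
  assumes "beta_count r n b \<noteq> 0"
  shows "inj_on b {..<r}"
proof (rule inj_onI, rule ccontr)
  fix i j assume "i \<in> {..<r}" "j \<in> {..<r}" "b i = b j" "i \<noteq> j"
  then have "beta_count r n b = 0"
    by (intro beta_count_not_inj[of i r j]) auto
  with assms show False ..
qed

lemma beta_count_nonneg: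
  assumes "beta_count r n b \<noteq> 0" "i < r"
  shows "0 \<le> b i"
  using beta_count_neg[OF assms(2)] assms(1) by (meson not_le)

text \<open>Each step of the recursion lowers the sum by one, and it ends at
  \<open>0 + ... + (r - 1)\<close>. A nonzero count therefore determines the sum of the
  entries.\<close>

lemma beta_count_sum:
  assumes "beta_count r n b \<noteq> 0"
  shows "(\<Sum>i<r. b i) = (\<Sum>i<r. int i) + int n"
  using assms
proof (induction n arbitrary: b)
  case 0
  then have "b ` {..<r} = {0..<int r}"
    by (auto split: if_splits)
  moreover have "inj_on b {..<r}"
    using 0 by (rule beta_count_inj)
  ultimately have "(\<Sum>i<r. b i) = \<Sum>{0..<int r}"
    using sum.reindex[of b "{..<r}" "\<lambda>x. x"] by simp
  also have "{0..<int r} = int ` {..<r}"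
    by (simp add: image_int_atLeastLessThan lessThan_atLeast0)
  also have "\<Sum>\<dots> = (\<Sum>i<r. int i)"
    by (simp add: sum.reindex)
  finally show ?case
    by simp
next
  case (Suc n)
  then obtain a where a: "a < r" "beta_count r n (b(a := b a - 1)) \<noteq> 0"
    by (metis (no_types, lifting) beta_count.simps(2) lessThan_iff sum.neutral)
  have "(\<Sum>i<r. (b(a := b a - 1)) i) = (\<Sum>i<r. b i) - 1"
    using a(1) by (simp add: sum.remove[of _ a])
  with Suc.IH[OF a(2)] show ?case
    by simp
qed

text \<open>A partition of n with r rows has at least r - n empty rows, and these carry the beta
  numbers 0, ..., r - n - 1. In the induction the only danger is that \<open>p\<close> is occupied
  just by the entry that was lowered onto it. But then \<open>p + 1\<close> is occupied by another
  entry, which collided with it before the lowering.\<close>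

lemma beta_count_low_values:
  assumes "beta_count r n b \<noteq> 0" "0 \<le> p" "p + int n < int r"
  shows "p \<in> b ` {..<r}"
  using assms
proof (induction n arbitrary: b p)
  case (Suc n)
  then obtain a where a: "a < r" "beta_count r n (b(a := b a - 1)) \<noteq> 0"
    by (metis (no_types, lifting) beta_count.simps(2) lessThan_iff sum.neutral)
  have "p \<in> b(a := b a - 1) ` {..<r}" "p + 1 \<in> b(a := b a - 1) ` {..<r}"
    using Suc.IH[OF a(2)] Suc.prems by auto
  then obtain k l where k: "k < r" "p = (b(a := b a - 1)) k" and
      l: "l < r" "p + 1 = (b(a := b a - 1)) l"
    by blast
  show ?case
  proof (cases "k = a")
    case True
    then have "b a = b l" "l \<noteq> a"
      using k l by (auto split: if_splits)
    then show ?thesis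
      using beta_count_not_inj[of a r l b "Suc n"] a(1) l(1) Suc.prems(1) by simp
  qed (use k in auto)
qed (auto split: if_splits)

text \<open>This is the Frobenius identity for the commuting lowering operators. Applying the
  recursion for \<open>2 ^ k\<close> twice, the ordered pairs \<open>(x, y)\<close> and
  \<open>(y, x)\<close> cancel, and the diagonal lowers one entry by
  \<open>2 ^ Suc k\<close>.\<close>

lemma beta_count_add_power2:
  "beta_count r (n + 2 ^ k) b = (\<Sum>a<r. beta_count r n (b(a := b a - 2 ^ k)))"
proof (induction k arbitrary: n b)
  case (Suc k)
  let ?c = "\<lambda>a. b(a := b a - 2 ^ k)"
  let ?F = "\<lambda>(x, y). beta_count r n ((?c x)(y := ?c x y - 2 ^ k))"
  have "beta_count r (n + 2 ^ Suc k) b = beta_count r ((n + 2 ^ k) + 2 ^ k) b"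
    by (rule arg_cong[where f = "\<lambda>m. beta_count r m b"]) simp
  also have "\<dots> = (\<Sum>x<r. beta_count r (n + 2 ^ k) (?c x))"
    by (rule Suc.IH)
  also have "\<dots> = (\<Sum>x<r. \<Sum>y<r. ?F (x, y))"
    unfolding case_prod_conv by (intro sum.cong refl Suc.IH)
  also have "\<dots> = sum ?F ({..<r} \<times> {..<r})"
    by (simp only: sum.cartesian_product case_prod_eta)
  also have "\<dots> = sum ?F ({..<r} \<times> {..<r} - (\<lambda>x. (x, x)) ` {..<r}) + sum ?F ((\<lambda>x. (x, x)) ` {..<r})"
    by (intro sum.subset_diff) auto
  also have "sum ?F ({..<r} \<times> {..<r} - (\<lambda>x. (x, x)) ` {..<r}) = 0"
  proof (rule sum_bit_involution[where f = "\<lambda>(x, y). (y, x)"])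
    fix p assume "p \<in> {..<r} \<times> {..<r} - (\<lambda>x. (x, x)) ` {..<r}"
    then obtain x y where p: "p = (x, y)" "x \<noteq> y"
      by auto
    have "(?c y)(x := ?c y x - 2 ^ k) = (?c x)(y := ?c x y - 2 ^ k)"
      using p(2) by auto
    then show "?F (case p of (x, y) \<Rightarrow> (y, x)) = ?F p"
      using p(1) by (simp only: case_prod_conv)
  qed auto
  also have "sum ?F ((\<lambda>x. (x, x)) ` {..<r}) = (\<Sum>a<r. beta_count r n (b(a := b a - 2 ^ Suc k)))"
    by (subst sum.reindex) (auto simp: inj_on_def algebra_simps)
  finally show ?case
    by (simp only: add_0)
qed simp

section \<open>Transfer sums and their recursions\<close>

text \<open>The range covers both signs of \<open>b i - b j\<close>, so for an even weight
  \<open>v\<close> the value is symmetric in \<open>i\<close> and \<open>j\<close> and no order of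
  the entries has to be fixed. The weight is kept general because it is taken both as divisibility
  by a power of 2 and as the 2-adic valuation.\<close>

definition beta_transfer :: "(int \<Rightarrow> bit) \<Rightarrow> nat \<Rightarrow> nat \<Rightarrow> (nat \<Rightarrow> int) \<Rightarrow> nat \<Rightarrow> nat \<Rightarrow> bit" where
  "beta_transfer v r n b i j = (\<Sum>h\<in>{min 0 (b i - b j)<..<max 0 (b i - b j)}.
     v h * beta_count r n (b(i := b i - h, j := b j + h)))"

text \<open>Transfers strictly inside the interval between the two entries; unlike in the James-Murphy
  formula the entries move towards each other.\<close>

definition transfer_sum :: "(int \<Rightarrow> bit) \<Rightarrow> nat \<Rightarrow> nat \<Rightarrow> (nat \<Rightarrow> int) \<Rightarrow> bit" where
  "transfer_sum v r n b = (\<Sum>i<r. \<Sum>j<i. beta_transfer v r n b i j)"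

text \<open>\<open>transfer_sum\<close> runs over pairs ordered by index, which is stable when
  entries change, while boundary terms are naturally indexed by pairs ordered by value. For distinct
  entries each unordered pair occurs exactly once in both.\<close>

lemma sum_pairs_orient:
  fixes F :: "nat \<Rightarrow> nat \<Rightarrow> 'a::comm_monoid_add" and b :: "nat \<Rightarrow> int"
  assumes "inj_on b {..<r}" "\<And>i j. F i j = F j i"
  shows "(\<Sum>i<r. \<Sum>j<i. F i j) = (\<Sum>i<r. \<Sum>j | j < r \<and> b j < b i. F i j)"
proof -
  have "(\<Sum>i<r. \<Sum>j<i. F i j) = (\<Sum>(i, j)\<in>Sigma {..<r} (\<lambda>i. {..<i}). F i j)"
    by (simp add: sum.Sigma)
  also have "\<dots> = (\<Sum>(i, j)\<in>Sigma {..<r} (\<lambda>i. {j. j < r \<and> b j < b i}). F i j)"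
  proof (rule sum.reindex_bij_witness[where
        j = "\<lambda>(i, j). if b j < b i then (i, j) else (j, i)" and
        i = "\<lambda>(i, j). if j < i then (i, j) else (j, i)"])
    fix p assume p: "p \<in> Sigma {..<r} (\<lambda>i. {..<i})"
    obtain i j where ij: "p = (i, j)" "i < r" "j < i"
      using p by auto
    then have ne: "b i \<noteq> b j"
      using inj_onD[OF assms(1), of i j] by auto
    show "(case case p of (i, j) \<Rightarrow> if b j < b i then (i, j) else (j, i) of
          (i, j) \<Rightarrow> if j < i then (i, j) else (j, i)) = p"
      using ij by auto
    show "(case p of (i, j) \<Rightarrow> if b j < b i then (i, j) else (j, i))
        \<in> Sigma {..<r} (\<lambda>i. {j. j < r \<and> b j < b i})"
      using ij ne by auto
    show "(case case p of (i, j) \<Rightarrow> if b j < b i then (i, j) else (j, i) of (i, j) \<Rightarrow> F i j) =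
        (case p of (i, j) \<Rightarrow> F i j)"
      using ij assms(2) by auto
  next
    fix p assume p: "p \<in> Sigma {..<r} (\<lambda>i. {j. j < r \<and> b j < b i})"
    obtain i j where ij: "p = (i, j)" "i < r" "j < r" "b j < b i"
      using p by auto
    then have "i \<noteq> j"
      by auto
    with ij show "(case p of (i, j) \<Rightarrow> if j < i then (i, j) else (j, i)) \<in> Sigma {..<r} (\<lambda>i. {..<i})"
      and "(case case p of (i, j) \<Rightarrow> if j < i then (i, j) else (j, i) of
          (i, j) \<Rightarrow> if b j < b i then (i, j) else (j, i)) = p"
      by auto
  qed
  also have "\<dots> = (\<Sum>i<r. \<Sum>j | j < r \<and> b j < b i. F i j)"
    by (subst sum.Sigma) auto
  finally show ?thesis .
qed

lemma beta_transfer_commute: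
  assumes "\<And>h. v (- h) = v h"
  shows "beta_transfer v r n b i j = beta_transfer v r n b j i"
proof (cases "i = j")
  case False
  show ?thesis
    unfolding beta_transfer_def
    by (rule sum.reindex_bij_witness[where i = uminus and j = uminus])
      (use False assms in \<open>auto simp: fun_upd_twist\<close>)
qed simp

lemma beta_transfer_permute:
  assumes "p permutes {..<r}"
  shows "beta_transfer v r n (b \<circ> p) i j = beta_transfer v r n b (p i) (p j)"
proof -
  have "(b \<circ> p)(i := x, j := y) = b(p i := x, p j := y) \<circ> p" for x y
    using permutes_inj[OF assms] by (auto simp: fun_eq_iff inj_eq)
  then show ?thesis
    using beta_count_permute[OF assms, of n] by (simp add: beta_transfer_def)
qed

text \<open>Exchanging \<open>k\<close> and \<open>l\<close> fixes \<open>b\<close> and permutes the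
  unordered pairs, so moved pairs cancel. The fixed pairs vanish one by one: for
  \<open>{k, l}\<close> the range is empty, and a pair disjoint from it leaves the collision in
  place.\<close>

lemma transfer_sum_not_inj:
  assumes "\<And>h. v (- h) = v h" "k < r" "l < r" "k \<noteq> l" "b k = b l"
  shows "transfer_sum v r n b = 0"
proof -
  let ?t = "transpose k l"
  have perm: "?t permutes {..<r}"
    using assms by (intro permutes_swap_id) auto
  have b: "b \<circ> ?t = b"
    using assms(5) by (auto simp: fun_eq_iff transpose_def)
  have less: "?t i < r" if "i < r" for i
    using that assms(2,3) by (auto simp: transpose_def)
  have "transfer_sum v r n b = (\<Sum>(i, j)\<in>Sigma {..<r} (\<lambda>i. {..<i}). beta_transfer v r n b i j)"
    by (simp add: transfer_sum_def sum.Sigma)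
  also have "\<dots> = 0"
  \<comment> \<open>The exchange can reverse the index order of a pair; \<open>max\<close> and
    \<open>min\<close> restore it.\<close>
  proof (rule sum_bit_involution[where f = "\<lambda>(i, j). (max (?t i) (?t j), min (?t i) (?t j))"])
    fix p assume "p \<in> Sigma {..<r} (\<lambda>i. {..<i})"
    then obtain i j where p: "p = (i, j)" "i < r" "j < i"
      by auto
    have ne: "?t i \<noteq> ?t j"
      using p(3) by (metis less_irrefl transpose_involutory)
    show "(case p of (i, j) \<Rightarrow> (max (?t i) (?t j), min (?t i) (?t j))) \<in> Sigma {..<r} (\<lambda>i. {..<i})"
      using p ne less[of i] less[of j] by (auto simp: max_def min_def)
    show "(case case p of (i, j) \<Rightarrow> (max (?t i) (?t j), min (?t i) (?t j)) of
        (i, j) \<Rightarrow> (max (?t i) (?t j), min (?t i) (?t j))) = p"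
      using p ne by (auto simp: max_def min_def)
    have "beta_transfer v r n b (?t i) (?t j) = beta_transfer v r n b i j"
      using beta_transfer_permute[OF perm, of v n b i j] b by simp
    then show "(case case p of (i, j) \<Rightarrow> (max (?t i) (?t j), min (?t i) (?t j)) of
        (i, j) \<Rightarrow> beta_transfer v r n b i j) = (case p of (i, j) \<Rightarrow> beta_transfer v r n b i j)"
      using p beta_transfer_commute[where v = v, OF assms(1), of r n b "?t i" "?t j"]
      by (auto simp: max_def min_def)
    assume "(case p of (i, j) \<Rightarrow> (max (?t i) (?t j), min (?t i) (?t j))) = p"
    then consider "{i, j} = {k, l}" | "k \<notin> {i, j}" "l \<notin> {i, j}"
      using p ne assms(4) by (auto simp: max_def min_def transpose_def split: if_splits)
    then have "beta_transfer v r n b i j = 0"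
    proof cases
      case 1
      then have "b i = b j"
        using assms(5) by (auto simp: doubleton_eq_iff)
      then show ?thesis
        by (simp add: beta_transfer_def)
    next
      case 2
      then have "beta_count r n (b(i := x, j := y)) = 0" for x y
        using assms by (intro beta_count_not_inj[of k r l]) auto
      then show ?thesis
        by (simp add: beta_transfer_def)
    qed
    then show "(case p of (i, j) \<Rightarrow> beta_transfer v r n b i j) = 0"
      using p by simp
  qed auto
  finally show ?thesis .
qed

text \<open>Lowering the entry \<open>i\<close> or \<open>j\<close> instead of a third one gives values of the same function \<open>g\<close> on
  intervals that differ only at their ends, which is why \<open>transfer_sum\<close> telescopes.\<close>

lemma beta_transfer_lower:
  assumes "\<And>c. beta_count r n c = (\<Sum>a<r. beta_count r m (c(a := c a - q)))"
    and ij: "i < r" "j < r" "i \<noteq> j" and less: "b j < b i"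
  defines "D \<equiv> b i - b j"
  defines "g \<equiv> \<lambda>h. beta_count r m (b(i := b i - h - q, j := b j + h))"
  shows "beta_transfer v r n b i j
      = (\<Sum>a\<in>{..<r} - {i, j}. beta_transfer v r m (b(a := b a - q)) i j)
        + (\<Sum>h\<in>{0<..<D}. v h * (g h + g (h - q)))"
    and "beta_transfer v r m (b(i := b i - q)) i j
      = (\<Sum>h\<in>{min 0 (D - q)<..<max 0 (D - q)}. v h * g h)"
    and "beta_transfer v r m (b(j := b j - q)) i j
      = (\<Sum>h\<in>{min 0 (D + q)<..<max 0 (D + q)}. v h * g (h - q))"
proof -
  have split: "(\<Sum>a<r. f a) = (\<Sum>a\<in>{..<r} - {i, j}. f a) + (f i + f j)" for f :: "nat \<Rightarrow> bit"
    using ij by (simp add: sum.subset_diff[of "{i, j}" "{..<r}"])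
  have eq: "beta_count r n (b(i := b i - h, j := b j + h))
      = (\<Sum>a\<in>{..<r} - {i, j}. beta_count r m ((b(a := b a - q))(i := b i - h, j := b j + h)))
        + (g h + g (h - q))" for h
  proof -
    have "(\<Sum>a\<in>{..<r} - {i, j}. beta_count r m ((b(i := b i - h, j := b j + h))
          (a := (b(i := b i - h, j := b j + h)) a - q)))
        = (\<Sum>a\<in>{..<r} - {i, j}. beta_count r m ((b(a := b a - q))(i := b i - h, j := b j + h)))"
      by (intro sum.cong refl arg_cong[where f = "beta_count r m"]) auto
    moreover have "beta_count r m ((b(i := b i - h, j := b j + h))
          (i := (b(i := b i - h, j := b j + h)) i - q)) = g h"
      unfolding g_def using ij by (intro arg_cong[where f = "beta_count r m"]) auto
    \<comment> \<open>Since \<open>b i - h = b i - (h - q) - q\<close>, lowering \<open>j\<close>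
      after a transfer by \<open>h\<close> is lowering \<open>i\<close> after a transfer by
      \<open>h - q\<close>.\<close>
    moreover have "beta_count r m ((b(i := b i - h, j := b j + h))
          (j := (b(i := b i - h, j := b j + h)) j - q)) = g (h - q)"
      unfolding g_def using ij by (intro arg_cong[where f = "beta_count r m"]) auto
    ultimately show ?thesis
      by (simp only: assms(1) split)
  qed
  have 1: "min 0 (b i - b j) = 0" "max 0 (b i - b j) = D"
    using less by (auto simp: D_def)
  have "(\<Sum>a\<in>{..<r} - {i, j}. beta_transfer v r m (b(a := b a - q)) i j)
      = (\<Sum>h\<in>{0<..<D}. \<Sum>a\<in>{..<r} - {i, j}.
          v h * beta_count r m ((b(a := b a - q))(i := b i - h, j := b j + h)))"
  proof -
    have "beta_transfer v r m (b(a := b a - q)) i j = (\<Sum>h\<in>{0<..<D}.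
          v h * beta_count r m ((b(a := b a - q))(i := b i - h, j := b j + h)))"
      if "a \<in> {..<r} - {i, j}" for a
      using that less by (simp add: beta_transfer_def D_def)
    then show ?thesis
      by (subst sum.swap) simp
  qed
  then show "beta_transfer v r n b i j
      = (\<Sum>a\<in>{..<r} - {i, j}. beta_transfer v r m (b(a := b a - q)) i j)
        + (\<Sum>h\<in>{0<..<D}. v h * (g h + g (h - q)))"
    by (simp only: beta_transfer_def[of v r n] 1 eq distrib_left sum.distrib sum_distrib_left)
  show "beta_transfer v r m (b(i := b i - q)) i j
      = (\<Sum>h\<in>{min 0 (D - q)<..<max 0 (D - q)}. v h * g h)"
    using ij(3) by (simp add: beta_transfer_def g_def D_def algebra_simps)
  show "beta_transfer v r m (b(j := b j - q)) i j
      = (\<Sum>h\<in>{min 0 (D + q)<..<max 0 (D + q)}. v h * g (h - q))"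
    using ij(3) by (simp add: beta_transfer_def g_def D_def algebra_simps)
qed

lemma transfer_sum_eqI:
  assumes "\<And>i j. i < r \<Longrightarrow> j < i \<Longrightarrow>
      beta_transfer v r n b i j = (\<Sum>a<r. beta_transfer v r m (c a) i j) + F i j"
  shows "transfer_sum v r n b = (\<Sum>a<r. transfer_sum v r m (c a)) + (\<Sum>i<r. \<Sum>j<i. F i j)"
proof -
  have "transfer_sum v r n b
      = (\<Sum>i<r. \<Sum>j<i. \<Sum>a<r. beta_transfer v r m (c a) i j) + (\<Sum>i<r. \<Sum>j<i. F i j)"
    unfolding transfer_sum_def sum.distrib[symmetric] using assms by (intro sum.cong refl) auto
  also have "(\<Sum>i<r. \<Sum>j<i. \<Sum>a<r. beta_transfer v r m (c a) i j)
      = (\<Sum>a<r. \<Sum>i<r. \<Sum>j<i. beta_transfer v r m (c a) i j)"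
  proof -
    have "(\<Sum>i<r. \<Sum>j<i. \<Sum>a<r. beta_transfer v r m (c a) i j)
        = (\<Sum>i<r. \<Sum>a<r. \<Sum>j<i. beta_transfer v r m (c a) i j)"
      by (intro sum.cong refl sum.swap)
    also have "\<dots> = (\<Sum>a<r. \<Sum>i<r. \<Sum>j<i. beta_transfer v r m (c a) i j)"
      by (rule sum.swap)
    finally show ?thesis .
  qed
  finally show ?thesis
    by (simp add: transfer_sum_def)
qed

text \<open>For a pair at distance \<open>D\<close> the ranges on the two sides differ only at
  \<open>h = D - 1\<close> for the lowered \<open>i\<close> and at \<open>h = D\<close> for the
  lowered \<open>j\<close>. Both ends carry the same count, that of \<open>b\<close> with the larger
  entry lowered by one, its two entries exchanged. These boundary terms will match the inversions
  created by adding a cell.\<close>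

lemma transfer_sum_Suc:
  assumes even: "\<And>h. v (- h) = v h" and inj: "inj_on b {..<r}"
  shows "transfer_sum v r (Suc n) b = (\<Sum>a<r. transfer_sum v r n (b(a := b a - 1)))
      + (\<Sum>i<r. \<Sum>j | j < r \<and> b j < b i.
          (v (b i - b j - 1) + v (b i - b j)) * beta_count r n (b(i := b i - 1)))"
proof -
  define G where "G i j = (v (b i - b j - 1) + v (b i - b j)) * beta_count r n (b(i := b i - 1))" for i j
  define F where "F i j = (if b j < b i then G i j else if b i < b j then G j i else 0)" for i j
  have step: "beta_transfer v r (Suc n) b i j
      = (\<Sum>a<r. beta_transfer v r n (b(a := b a - 1)) i j) + G i j"
    if ij: "i < r" "j < r" "b j < b i" for i j
  proof -
    define D where "D = b i - b j"
    define g where "g h = beta_count r n (b(i := b i - h - 1, j := b j + h))" for h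
    have ne: "i \<noteq> j" and D: "1 \<le> D"
      using ij(3) by (auto simp: D_def)
    note low = beta_transfer_lower[OF beta_count.simps(2) ij(1,2) ne ij(3), where v = v and m = n,
        folded D_def g_def]
    have gD: "g (D - 1) = beta_count r n (b(i := b i - 1))"
      using beta_count_swap[OF ij(1,2) ne, of n b "b j" "b i - 1"] ne
      by (simp add: g_def D_def fun_upd_idem)
    have "(\<Sum>h\<in>{0<..<D}. v h * (g h + g (h - 1)))
        = (\<Sum>h\<in>{min 0 (D - 1)<..<max 0 (D - 1)}. v h * g h)
          + (\<Sum>h\<in>{min 0 (D + 1)<..<max 0 (D + 1)}. v h * g (h - 1)) + G i j"
    proof (cases "D = 1")
      case True
      \<comment> \<open>At distance 1 the lowered larger entry meets \<open>b j\<close>. The case is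
        separate because \<open>D - 1 = 0\<close> lies outside the range and cannot be split off
        from it.\<close>
      have "g 0 = 0"
        using True ij ne by (auto simp: g_def D_def intro!: beta_count_not_inj[of i r j])
      moreover have "{0::int<..<1} = {}" "{0::int<..<2} = {1}"
        by auto
      ultimately show ?thesis
        using True gD by (simp add: G_def)
    next
      case False
      have 1: "{0<..<D} = insert (D - 1) {0<..<D - 1}" "{0<..<D + 1} = insert D {0<..<D}"
        using D False by auto
      have "(\<Sum>h\<in>{0<..<D}. v h * g h) = v (D - 1) * g (D - 1) + (\<Sum>h\<in>{0<..<D - 1}. v h * g h)"
        by (subst 1(1)) simp
      moreover have "(\<Sum>h\<in>{0<..<D + 1}. v h * g (h - 1)) = v D * g (D - 1) + (\<Sum>h\<in>{0<..<D}. v h * g (h - 1))"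
        by (subst 1(2)) simp
      moreover have "v D * g (D - 1) + (v D * g (D - 1) + x) = x" for x
        by (simp flip: add.assoc)
      moreover have "G i j = v (D - 1) * g (D - 1) + v D * g (D - 1)"
        unfolding G_def gD by (simp add: D_def distrib_right)
      ultimately show ?thesis
        using D by (simp add: distrib_left sum.distrib algebra_simps)
    qed
    moreover have "(\<Sum>a<r. f a) = (\<Sum>a\<in>{..<r} - {i, j}. f a) + (f i + f j)" for f :: "nat \<Rightarrow> bit"
      using ij ne by (simp add: sum.subset_diff[of "{i, j}" "{..<r}"])
    ultimately show ?thesis
      using low by (simp add: add.assoc)
  qed
  have "transfer_sum v r (Suc n) b
      = (\<Sum>a<r. transfer_sum v r n (b(a := b a - 1))) + (\<Sum>i<r. \<Sum>j<i. F i j)"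
  proof (rule transfer_sum_eqI)
    fix i j assume "i < r" "j < i"
    moreover from this have "b i \<noteq> b j"
      using inj_onD[OF inj, of i j] by auto
    ultimately show "beta_transfer v r (Suc n) b i j
        = (\<Sum>a<r. beta_transfer v r n (b(a := b a - 1)) i j) + F i j"
      using step[of i j] step[of j i] beta_transfer_commute[where v = v, OF even, of r _ _ i j]
      by (cases "b j < b i") (auto simp: F_def)
  qed
  also have "(\<Sum>i<r. \<Sum>j<i. F i j) = (\<Sum>i<r. \<Sum>j | j < r \<and> b j < b i. F i j)"
    by (intro sum_pairs_orient inj) (auto simp: F_def)
  also have "\<dots> = (\<Sum>i<r. \<Sum>j | j < r \<and> b j < b i. G i j)"
    by (simp add: F_def)
  finally show ?thesis
    unfolding G_def .
qed

text \<open>Only transfers that raise the negative entry \<open>z\<close> can count. The value 0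
  must be occupied, so either \<open>h = 1\<close>, where \<open>v\<close> vanishes, or entry
  \<open>i\<close> drops to 0 at \<open>h = b i\<close>; the latter is \<open>b\<close> with
  \<open>i\<close> lowered by one, up to exchanging \<open>i\<close> and \<open>z\<close>. This term
  accounts for the part \<open>v (b i)\<close> of the weight of a removed cell.\<close>

lemma transfer_sum_lower_zero:
  assumes even: "\<And>h. v (- h) = v h" and v1: "v 1 = 0"
    and inj: "inj_on b {..<r}" and nonneg: "\<And>i. i < r \<Longrightarrow> 0 \<le> b i"
    and z: "z < r" "b z = 0" and "n < r"
  shows "transfer_sum v r n (b(z := - 1))
      = (\<Sum>i\<in>{..<r} - {z}. v (b i) * beta_count r n (b(i := b i - 1)))"
proof -
  define c where "c = b(z := - 1)"
  have pos: "0 < b i" if "i < r" "i \<noteq> z" for i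
    using nonneg[OF that(1)] inj_onD[OF inj, of i z] that z by force
  have "inj_on c {..<r}"
    using pos by (intro inj_onI) (auto simp: c_def inj_onD[OF inj] split: if_splits dest: nonneg)
  then have "transfer_sum v r n c = (\<Sum>i<r. \<Sum>j | j < r \<and> c j < c i. beta_transfer v r n c i j)"
    unfolding transfer_sum_def by (intro sum_pairs_orient beta_transfer_commute[where v = v, OF even])
  also have "\<dots> = (\<Sum>i\<in>{..<r} - {z}. \<Sum>j | j < r \<and> c j < c i. beta_transfer v r n c i j)"
  proof (rule sum.mono_neutral_right)
    have "{j. j < r \<and> c j < c z} = {}"
      using pos by (force simp: c_def)
    then have "(\<Sum>j | j < r \<and> c j < c z. beta_transfer v r n c z j) = 0"
      by (simp only: sum.empty)
    then show "\<forall>i\<in>{..<r} - ({..<r} - {z}). (\<Sum>j | j < r \<and> c j < c i. beta_transfer v r n c i j) = 0"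
      by auto
  qed auto
  also have "\<dots> = (\<Sum>i\<in>{..<r} - {z}. v (b i) * beta_count r n (b(i := b i - 1)))"
  proof (intro sum.cong refl)
    fix i assume "i \<in> {..<r} - {z}"
    then have i: "i < r" "i \<noteq> z"
      by auto
    have "(\<Sum>j | j < r \<and> c j < c i. beta_transfer v r n c i j)
        = (\<Sum>j\<in>{z}. beta_transfer v r n c i j)"
    proof (rule sum.mono_neutral_right)
      show "{z} \<subseteq> {j. j < r \<and> c j < c i}"
        using z i pos[OF i] by (auto simp: c_def)
      have "beta_count r n (c(i := x, j := y)) = 0" if "j \<noteq> z" for j x y
        using z(1) i that by (intro beta_count_neg[of z]) (auto simp: c_def)
      then show "\<forall>j\<in>{j. j < r \<and> c j < c i} - {z}. beta_transfer v r n c i j = 0"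
        by (auto simp: beta_transfer_def)
    qed auto
    also have "\<dots> = beta_transfer v r n c i z"
      by simp
    also have "\<dots> = (\<Sum>h\<in>{0<..<b i + 1}. v h * beta_count r n (b(i := b i - h, z := h - 1)))"
      using i pos[OF i] by (simp add: beta_transfer_def c_def fun_upd_twist)
    also have "\<dots> = (\<Sum>h\<in>{b i}. v h * beta_count r n (b(i := b i - h, z := h - 1)))"
    proof (rule sum.mono_neutral_right)
      show "{b i} \<subseteq> {0<..<b i + 1}"
        using pos[OF i] by auto
      show "\<forall>h\<in>{0<..<b i + 1} - {b i}. v h * beta_count r n (b(i := b i - h, z := h - 1)) = 0"
      proof
        fix h assume h: "h \<in> {0<..<b i + 1} - {b i}"
        show "v h * beta_count r n (b(i := b i - h, z := h - 1)) = 0"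
        proof (rule ccontr)
          assume "v h * beta_count r n (b(i := b i - h, z := h - 1)) \<noteq> 0"
          then have nz: "v h \<noteq> 0" "beta_count r n (b(i := b i - h, z := h - 1)) \<noteq> 0"
            by auto
          \<comment> \<open>With fewer cells than rows the value 0 belongs to every sequence of
            nonzero count, and all entries other than \<open>i\<close> and \<open>z\<close> are
            positive.\<close>
          have "0 \<in> b(i := b i - h, z := h - 1) ` {..<r}"
            using \<open>n < r\<close> by (intro beta_count_low_values[OF nz(2)]) auto
          then obtain k where "k < r" "0 = (b(i := b i - h, z := h - 1)) k"
            by auto
          moreover have "h \<noteq> 1"
            using nz(1) v1 by auto
          ultimately show False
            using h pos[of k] by (auto split: if_splits)
        qed
      qed
    qed auto
    also have "\<dots> = v (b i) * beta_count r n (b(i := b i - 1))"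
      using beta_count_swap[OF i(1) z(1) i(2), of n b 0 "b i - 1"] z i(2) by (simp add: fun_upd_idem)
    finally show "(\<Sum>j | j < r \<and> c j < c i. beta_transfer v r n c i j)
        = v (b i) * beta_count r n (b(i := b i - 1))" .
  qed
  finally show ?thesis
    by (simp add: c_def)
qed

text \<open>Divisibility by \<open>d\<close> is periodic modulo \<open>q = 2 ^ k\<close>, so after a
  shift all four sums involve the same function of \<open>h\<close>, on the intervals (0, D) and
  (-q, D - q) on one side and (-q, D) and the interval between 0 and D - q on the other. Modulo 2
  they differ only at \<open>h = 0\<close> and \<open>h = D - q\<close>. There the count is that of
  \<open>b\<close> with \<open>i\<close> lowered by \<open>q\<close>, up to order, hence 0 by
  \<open>zero\<close>.\<close>

lemma transfer_sum_add_power2: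
  fixes d :: int
  defines "v \<equiv> \<lambda>h. of_bool (d dvd h)"
  assumes d: "d dvd 2 ^ k" and inj: "inj_on b {..<r}"
    and zero: "\<And>a. a < r \<Longrightarrow> beta_count r n (b(a := b a - 2 ^ k)) = 0"
  shows "transfer_sum v r (n + 2 ^ k) b = (\<Sum>a<r. transfer_sum v r n (b(a := b a - 2 ^ k)))"
proof -
  define q :: int where "q = 2 ^ k"
  have even: "v (- h) = v h" for h
    by (simp add: v_def)
  have vq: "v (h - q) = v h" for h
    using d dvd_diff_left_iff[of d q h] by (simp add: v_def q_def)
  have q: "0 < q"
    by (simp add: q_def)
  have step: "beta_transfer v r (n + 2 ^ k) b i j
      = (\<Sum>a<r. beta_transfer v r n (b(a := b a - q)) i j)"
    if ij: "i < r" "j < r" "b j < b i" for i j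
  proof -
    define D where "D = b i - b j"
    define g where "g h = beta_count r n (b(i := b i - h - q, j := b j + h))" for h
    have ne: "i \<noteq> j" and D: "1 \<le> D"
      using ij(3) by (auto simp: D_def)
    note low = beta_transfer_lower[OF beta_count_add_power2[where k = k] ij(1,2) ne ij(3), where v = v and m = n,
        folded q_def, folded D_def g_def]
    have g0: "g 0 = 0"
      using zero[OF ij(1)] ne by (simp add: g_def q_def fun_upd_idem)
    have gD: "g (D - q) = 0"
      using zero[OF ij(1)] beta_count_swap[OF ij(1,2) ne, of n b "b j" "b i - q"] ne
      by (simp add: g_def q_def D_def fun_upd_idem)
    \<comment> \<open>A common range containing all four intervals, so that the sums can be compared
      term by term.\<close>
    let ?R = "{- (D + q)..D + q}"
    have conv: "(\<Sum>h\<in>{l<..<u}. v h * g h) = (\<Sum>h\<in>?R. of_bool (l < h \<and> h < u \<and> d dvd h) * g h)"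
      if "- (D + q) \<le> l" "u \<le> D + q" for l u
      using that by (intro sum.mono_neutral_cong_left) (auto simp: v_def)
    have shift: "(\<Sum>h\<in>{l<..<u}. v h * g (h - q)) = (\<Sum>h\<in>{l - q<..<u - q}. v h * g h)" for l u
      by (rule sum.reindex_bij_witness[where i = "\<lambda>h. h + q" and j = "\<lambda>h. h - q"])
        (auto simp: vq)
    have "(\<Sum>h\<in>{0<..<D}. v h * (g h + g (h - q)))
        = (\<Sum>h\<in>{0<..<D}. v h * g h) + (\<Sum>h\<in>{0 - q<..<D - q}. v h * g h)"
      by (simp add: distrib_left sum.distrib shift)
    also have "\<dots> = (\<Sum>h\<in>{min 0 (D - q)<..<max 0 (D - q)}. v h * g h)
          + (\<Sum>h\<in>{min 0 (D + q) - q<..<max 0 (D + q) - q}. v h * g h)"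
    proof -
      have minmax: "min 0 (D + q) - q = - q" "max 0 (D + q) - q = D"
        using q D by auto
      have key: "of_bool (0 < h \<and> h < D \<and> d dvd h) * g h + of_bool (0 - q < h \<and> h < D - q \<and> d dvd h) * g h
          = of_bool (min 0 (D - q) < h \<and> h < max 0 (D - q) \<and> d dvd h) * g h
            + of_bool (- q < h \<and> h < D \<and> d dvd h) * g h" for h
      proof (cases "h = 0 \<or> h = D - q \<or> \<not> d dvd h")
        case True
        then show ?thesis
          using g0 gD by auto
      next
        case False
        \<comment> \<open>A sum of two indicators in \<open>bit\<close> indicates their exclusive
          disjunction. Away from the two exceptional points the claim is thus linear arithmetic
          about membership in the intervals.\<close>
        have bits: "of_bool P1 + of_bool P2 = (of_bool P3 + of_bool P4 :: bit)"
          if "(P1 \<noteq> P2) = (P3 \<noteq> P4)" for P1 P2 P3 P4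
          using that by (cases P1; cases P2; cases P3; cases P4) auto
        have "((0 < h \<and> h < D) \<noteq> (0 - q < h \<and> h < D - q))
            = ((min 0 (D - q) < h \<and> h < max 0 (D - q)) \<noteq> (- q < h \<and> h < D))"
          using False q D by linarith
        from bits[OF this] False show ?thesis
          by (simp flip: distrib_right)
      qed
      have "- (D + q) \<le> 0" "D \<le> D + q" "- (D + q) \<le> 0 - q" "D - q \<le> D + q"
        "- (D + q) \<le> min 0 (D - q)" "max 0 (D - q) \<le> D + q" "- (D + q) \<le> - q"
        using q D by auto
      note c = conv[OF this(1,2)] conv[OF this(3,4)] conv[OF this(5,6)] conv[OF this(7,2)]
      show ?thesis
        unfolding minmax c sum.distrib[symmetric] by (intro sum.cong refl key)
    qed
    also have "\<dots> = (\<Sum>h\<in>{min 0 (D - q)<..<max 0 (D - q)}. v h * g h)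
          + (\<Sum>h\<in>{min 0 (D + q)<..<max 0 (D + q)}. v h * g (h - q))"
      by (simp only: shift)
    finally have "(\<Sum>h\<in>{0<..<D}. v h * (g h + g (h - q))) = \<dots>" .
    moreover have "(\<Sum>a<r. f a) = (\<Sum>a\<in>{..<r} - {i, j}. f a) + (f i + f j)" for f :: "nat \<Rightarrow> bit"
      using ij ne by (simp add: sum.subset_diff[of "{i, j}" "{..<r}"])
    ultimately show ?thesis
      using low by simp
  qed
  have "transfer_sum v r (n + 2 ^ k) b
      = (\<Sum>a<r. transfer_sum v r n (b(a := b a - q))) + (\<Sum>i<r. \<Sum>j<i. 0)"
  proof (rule transfer_sum_eqI)
    fix i j assume "i < r" "j < i"
    moreover from this have "b i \<noteq> b j"
      using inj_onD[OF inj, of i j] by auto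
    ultimately show "beta_transfer v r (n + 2 ^ k) b i j
        = (\<Sum>a<r. beta_transfer v r n (b(a := b a - q)) i j) + 0"
      using step[of i j] step[of j i] beta_transfer_commute[where v = v, OF even, of r _ _ i j]
      by (cases "b j < b i") auto
  qed
  then show ?thesis
    by (simp add: q_def)
qed

section \<open>Vanishing of the transfer sum when the count vanishes\<close>

text \<open>A transfer by \<open>h\<close> of nonzero count satisfies \<open>h \<le> n\<close>:
  lowering \<open>i\<close> by \<open>h\<close> without raising \<open>j\<close> keeps the entries
  distinct and nonnegative, while their sum exceeds the minimum only by \<open>n - h\<close>. A
  positive multiple of \<open>d\<close> is larger than \<open>n\<close>.\<close>

lemma beta_transfer_dvd_small:
  assumes "int n < d" and inj: "inj_on b {..<r}" and nonneg: "\<And>i. i < r \<Longrightarrow> 0 \<le> b i"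
    and ij: "i < r" "j < r" "b j < b i"
  shows "beta_transfer (\<lambda>h. of_bool (d dvd h)) r n b i j = 0"
proof -
  have ne: "i \<noteq> j"
    using ij by auto
  have "of_bool (d dvd h) * beta_count r n (b(i := b i - h, j := b j + h)) = 0"
    if h: "h \<in> {0<..<b i - b j}" for h
  proof (rule ccontr)
    let ?c = "b(i := b i - h, j := b j + h)"
    assume "of_bool (d dvd h) * beta_count r n ?c \<noteq> 0"
    then have dvd: "d dvd h" and nz: "beta_count r n ?c \<noteq> 0"
      by auto
    have "int n < h"
      using dvd h assms(1) zdvd_imp_le[of d h] by auto
    have inj': "inj_on (b(i := b i - h)) {..<r}"
    proof (rule inj_onI)
      fix k l assume kl: "k \<in> {..<r}" "l \<in> {..<r}" "(b(i := b i - h)) k = (b(i := b i - h)) l"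
      have "b i - h \<noteq> b k" if "k < r" "k \<noteq> i" for k
        using inj_onD[OF beta_count_inj[OF nz], of i k] that ij(1) ne h by (cases "k = j") auto
      from this[of k] this[of l] kl show "k = l"
        using inj_onD[OF inj, of k l] by (auto split: if_splits)
    qed
    have "0 \<le> (b(i := b i - h)) k" if "k < r" for k
      using nonneg[OF that] nonneg[OF ij(2)] h by auto
    from sum_index_le_sum_inj[OF inj' this] have "(\<Sum>k<r. int k) \<le> (\<Sum>k<r. b k) - h"
      using ij(1) by (simp add: sum.remove[of _ i])
    moreover have "(\<Sum>k<r. ?c k) = (\<Sum>k<r. b k)"
      using ij ne by (simp add: sum.subset_diff[of "{i, j}" "{..<r}"])
    ultimately show False
      using beta_count_sum[OF nz] \<open>int n < h\<close> by linarith
  qed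
  then show ?thesis
    using ij(3) by (auto simp: beta_transfer_def intro!: sum.neutral)
qed

text \<open>The value \<open>b a\<close> is small enough that every sequence of nonzero count
  contains it. Lowering \<open>a\<close> has lost it, so the transfer must restore it, either at
  \<open>a\<close> with \<open>h = q\<close> or at \<open>i\<close> with
  \<open>h = b i - b a\<close>. In both cases the result is, up to order, \<open>b\<close> with
  \<open>i\<close> lowered by \<open>q\<close>, whose count is 0 by \<open>zero\<close>.\<close>

lemma transfer_sum_negative_zero:
  assumes even: "\<And>h. v (- h) = v h"
    and inj: "inj_on b {..<r}" and nonneg: "\<And>i. i < r \<Longrightarrow> 0 \<le> b i"
    and a: "a < r" "b a < q" and "int n + q \<le> int r"
    and zero: "\<And>i. i < r \<Longrightarrow> beta_count r n (b(i := b i - q)) = 0"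
  shows "transfer_sum v r n (b(a := b a - q)) = 0"
proof -
  define c where "c = b(a := b a - q)"
  have ca: "c a < 0"
    using a by (simp add: c_def)
  have zero': "beta_count r n (c(i := c i - h, a := c a + h)) = 0"
    if i: "i < r" "i \<noteq> a" for i h
  proof (rule ccontr)
    assume nz: "beta_count r n (c(i := c i - h, a := c a + h)) \<noteq> 0"
    have "b a \<in> c(i := c i - h, a := c a + h) ` {..<r}"
      using assms nonneg[OF a(1)] by (intro beta_count_low_values[OF nz]) auto
    then obtain k where k: "k < r" "b a = (c(i := c i - h, a := c a + h)) k"
      by auto
    have "k = a \<or> k = i"
    proof (rule ccontr)
      assume "\<not> (k = a \<or> k = i)"
      then have "b a = b k" "k \<noteq> a"
        using k(2) by (auto simp: c_def)
      then show False
        using inj_onD[OF inj, of a k] a(1) k(1) by simp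
    qed
    then have "h = q \<or> h = b i - b a"
    proof
      assume "k = a"
      with k(2) have "b a = c a + h"
        by simp
      then show ?thesis
        unfolding c_def fun_upd_same by linarith
    next
      assume "k = i"
      with k(2) i(2) have "b a = c i - h"
        by simp
      also have "c i = b i"
        using i(2) by (simp add: c_def)
      finally show ?thesis
        by linarith
    qed
    then consider "h = q" | "h = b i - b a"
      by blast
    then have "beta_count r n (c(i := c i - h, a := c a + h)) = beta_count r n (b(i := b i - q))"
    proof cases
      case 1
      then have "c(i := c i - h, a := c a + h) = b(i := b i - q)"
        using i by (auto simp: c_def)
      then show ?thesis
        by simp
    next
      case 2
      then have "c(i := c i - h, a := c a + h) = b(i := b a, a := b i - q)"
        using i by (auto simp: c_def)
      then show ?thesis
        using beta_count_swap[OF i(1) a(1) i(2), of n b "b a" "b i - q"] i(2)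
        by (simp add: fun_upd_idem)
    qed
    with zero[OF i(1)] nz show False
      by simp
  qed
  have "beta_transfer v r n c i j = 0" if ij: "i < r" "j < r" "i \<noteq> j" for i j
  proof -
    consider "j = a" | "i = a" | "i \<noteq> a" "j \<noteq> a"
      by blast
    then show ?thesis
    proof cases
      case 1
      then show ?thesis
        using zero'[OF ij(1)] ij by (simp add: beta_transfer_def)
    next
      case 2
      then show ?thesis
        using zero'[OF ij(2)] ij beta_transfer_commute[where v = v, OF even, of r n c i j]
        by (simp add: beta_transfer_def)
    next
      case 3
      then have "beta_count r n (c(i := x, j := y)) = 0" for x y
        using a(1) ca by (intro beta_count_neg[of a]) auto
      then show ?thesis
        by (simp add: beta_transfer_def)
    qed
  qed
  then show ?thesis
    unfolding c_def[symmetric] transfer_sum_def by (intro sum.neutral ballI) auto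
qed

lemma transfer_sum_dvd_eq_0:
  fixes d :: int
  assumes "d = 2 ^ l" "inj_on b {..<r}" "\<And>i. i < r \<Longrightarrow> 0 \<le> b i" "n \<le> r" "beta_count r n b = 0"
  shows "transfer_sum (\<lambda>h. of_bool (d dvd h)) r n b = 0"
  using assms(2-)
proof (induction n arbitrary: b rule: less_induct)
  case (less n)
  let ?v = "\<lambda>h. of_bool (d dvd h) :: bit"
  have even: "?v (- h) = ?v h" for h
    by simp
  show ?case
  proof (cases "int n < d")
    case True
    have "beta_transfer ?v r n b i j = 0" if "i < r" "j < i" for i j
    proof (cases "b j < b i")
      case False
      then have "b i < b j"
        using inj_onD[OF less.prems(1), of i j] that by force
      then show ?thesis
        using beta_transfer_dvd_small[OF True less.prems(1,2), of j i] that
          beta_transfer_commute[where v = ?v, OF even, of r n b i j] by simp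
    qed (use that beta_transfer_dvd_small[OF True less.prems(1,2), of i j] in simp)
    then show ?thesis
      by (simp add: transfer_sum_def)
  next
    case False
    then have "1 \<le> int n"
      using assms(1) one_le_power[of "2 :: int" l] by linarith
    then obtain k where k: "2 ^ k \<le> n" "n < 2 ^ (k + 1)"
      using ex_power_ivl1[of 2 n] by auto
    \<comment> \<open>From \<open>d \<le> n < 2 ^ (k + 1)\<close> it follows that \<open>d\<close>
      divides the largest power of 2 below or equal to \<open>n\<close>.\<close>
    have "(2::int) ^ l < 2 ^ (k + 1)"
    proof -
      have "int n < int (2 ^ (k + 1))"
        using k(2) by (simp only: of_nat_less_iff)
      then have "int n < 2 ^ (k + 1)"
        by simp
      then show ?thesis
        using False assms(1) by linarith
    qed
    then have "l \<le> k"
      by (simp add: power_strict_increasing_iff del: power_Suc)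
    then have dvd: "d dvd 2 ^ k"
      using assms(1) by (simp add: le_imp_power_dvd)
    define m where "m = n - 2 ^ k"
    have n: "n = m + 2 ^ k"
      using k(1) by (simp add: m_def)
    have zero: "beta_count r m (b(a := b a - 2 ^ k)) = 0" if a: "a < r" for a
    proof (rule ccontr)
      assume nz: "beta_count r m (b(a := b a - 2 ^ k)) \<noteq> 0"
      have "(\<Sum>i<r. beta_count r m (b(i := b i - 2 ^ k))) = 0"
        using less.prems(4) by (simp add: n beta_count_add_power2)
      then have "(\<Sum>i\<in>{..<r} - {a}. beta_count r m (b(i := b i - 2 ^ k))) \<noteq> 0"
        using nz a by (metis (no_types, lifting) add.right_neutral finite_lessThan lessThan_iff sum.remove)
      then obtain i where "i \<in> {..<r} - {a}" "beta_count r m (b(i := b i - 2 ^ k)) \<noteq> 0"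
        by (rule sum.not_neutral_contains_not_neutral)
      then have i: "i < r" "i \<noteq> a" "beta_count r m (b(i := b i - 2 ^ k)) \<noteq> 0"
        by blast+
      \<comment> \<open>If two terms of the recursion were nonzero, both entries could be lowered at
        once. The sum of the result would be the minimal sum plus \<open>m - 2 ^ k\<close>, which is
        below the minimum because \<open>m < 2 ^ k\<close>.\<close>
      let ?c = "b(a := b a - 2 ^ k, i := b i - 2 ^ k)"
      have "inj_on ?c {..<r}"
      proof (rule inj_onI)
        fix x y assume xy: "x \<in> {..<r}" "y \<in> {..<r}" "?c x = ?c y"
        \<comment> \<open>Any two indices other than the pair \<open>a\<close>, \<open>i\<close>
          avoid \<open>i\<close> or avoid \<open>a\<close>, so they can be compared in one of the
          two singly lowered sequences, which are injective.\<close>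
        have "x \<in> {a, i} \<and> y \<in> {a, i} \<or> x \<noteq> i \<and> y \<noteq> i \<or> x \<noteq> a \<and> y \<noteq> a"
          using i(2) by blast
        then show "x = y"
        proof (elim disjE conjE)
          assume "x \<in> {a, i}" "y \<in> {a, i}"
          then show ?thesis
            using xy(3) inj_onD[OF less.prems(1), of a i] a i(1,2) by auto
        next
          assume "x \<noteq> i" "y \<noteq> i"
          then show ?thesis
            using inj_onD[OF beta_count_inj[OF nz] _ xy(1,2)] xy(3) by simp
        next
          assume "x \<noteq> a" "y \<noteq> a"
          moreover have "?c z = (b(i := b i - 2 ^ k)) z" if "z \<noteq> a" for z
            using that by simp
          ultimately have "(b(i := b i - 2 ^ k)) x = (b(i := b i - 2 ^ k)) y"
            using xy(3) by metis
          then show ?thesis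
            using inj_onD[OF beta_count_inj[OF i(3)] _ xy(1,2)] by blast
        qed
      qed
      moreover have "0 \<le> ?c x" if "x < r" for x
        using less.prems(2)[OF that] beta_count_nonneg[OF nz that] beta_count_nonneg[OF i(3) that]
        by (auto split: if_splits)
      ultimately have "(\<Sum>x<r. int x) \<le> (\<Sum>x<r. ?c x)"
        by (rule sum_index_le_sum_inj)
      moreover have "(\<Sum>x<r. ?c x) = (\<Sum>x<r. (b(a := b a - 2 ^ k)) x) - 2 ^ k"
        using i by (simp add: sum.remove[of _ i])
      moreover have "int m < 2 ^ k"
      proof -
        have "m < 2 ^ k"
          using k(2) n by simp
        then have "int m < int (2 ^ k)"
          by (simp only: of_nat_less_iff)
        then show ?thesis
          by simp
      qed
      ultimately show False
        using beta_count_sum[OF nz] by linarith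
    qed
    have "transfer_sum ?v r n b = (\<Sum>a<r. transfer_sum ?v r m (b(a := b a - 2 ^ k)))"
      unfolding n by (rule transfer_sum_add_power2[OF dvd less.prems(1) zero])
    also have "\<dots> = 0"
    proof (intro sum.neutral ballI)
      fix a assume "a \<in> {..<r}"
      then have a: "a < r"
        by simp
      \<comment> \<open>The induction hypothesis needs distinct nonnegative entries and so covers
        the last case only. A negative entry and a collision are settled by the two special
        lemmas.\<close>
      consider "b a < 2 ^ k" | "\<not> inj_on (b(a := b a - 2 ^ k)) {..<r}" |
        "2 ^ k \<le> b a" "inj_on (b(a := b a - 2 ^ k)) {..<r}"
        by linarith
      then show "transfer_sum ?v r m (b(a := b a - 2 ^ k)) = 0"
      proof cases
        case 1
        have "int m + 2 ^ k \<le> int r"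
          using less.prems(3) unfolding n of_nat_le_iff[where 'a = int, symmetric] by simp
        then show ?thesis
          by (intro transfer_sum_negative_zero[where v = ?v] even less.prems(1,2) a 1 zero)
      next
        case 2
        then obtain x y where "x < r" "y < r" "x \<noteq> y" "(b(a := b a - 2 ^ k)) x = (b(a := b a - 2 ^ k)) y"
          by (auto simp: inj_on_def simp del: fun_upd_apply)
        then show ?thesis
          by (intro transfer_sum_not_inj[of ?v x r y]) auto
      next
        case 3
        then show ?thesis
        proof -
          have "0 \<le> (b(a := b a - 2 ^ k)) i" if "i < r" for i
            using less.prems(2)[OF that] 3(1) by simp
          moreover have "m < n" "m \<le> r"
            using less.prems(3) n by auto
          ultimately show ?thesis
            using less.IH 3(2) zero[OF a] by blast
        qed
      qed
    qed
    finally show ?thesis .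
  qed
qed

lemma transfer_sum_multiplicity_eq_0:
  assumes "inj_on b {..<r}" "\<And>i. i < r \<Longrightarrow> 0 \<le> b i" "n \<le> r" "beta_count r n b = 0"
  shows "transfer_sum (\<lambda>h. of_nat (multiplicity 2 h)) r n b = 0"
proof -
  \<comment> \<open>The valuation of \<open>h\<close> counts the \<open>k \<ge> 1\<close> with
    \<open>2 ^ k dvd h\<close>. \<open>K\<close> bounds it for all transfers at once, since
    \<open>\<bar>h\<bar>\<close> is at most the sum of the entries.\<close>
  define K where "K = nat (\<Sum>i<r. b i)"
  have mult: "of_nat (multiplicity 2 h) = (\<Sum>k=1..K. of_bool (2 ^ k dvd h) :: bit)"
    if "h \<noteq> 0" "\<bar>h\<bar> \<le> (\<Sum>i<r. b i)" for h :: int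
  proof -
    have "2 ^ multiplicity 2 h \<le> \<bar>h\<bar>"
      using that(1) by (intro zdvd_imp_le) (auto simp: multiplicity_dvd)
    then have "int (multiplicity 2 h) < \<bar>h\<bar>"
      using of_nat_less_two_power[of "multiplicity 2 h", where 'a = int] by linarith
    then have "multiplicity 2 h \<le> K"
      using that(2) unfolding K_def by linarith
    moreover have "2 ^ k dvd h \<longleftrightarrow> k \<le> multiplicity 2 h" for k
      using that(1) by (intro power_dvd_iff_le_multiplicity) auto
    ultimately have "{1..K} \<inter> {k. 2 ^ k dvd h} = {1..multiplicity 2 h}"
      unfolding set_eq_iff Int_iff atLeastAtMost_iff mem_Collect_eq by (meson le_trans)
    moreover have "(\<Sum>k=1..K. of_bool (2 ^ k dvd h) :: bit) = of_nat (card ({1..K} \<inter> {k. 2 ^ k dvd h}))"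
      by simp
    ultimately show ?thesis
      by simp
  qed
  have "beta_transfer (\<lambda>h. of_nat (multiplicity 2 h)) r n b i j
      = (\<Sum>k=1..K. beta_transfer (\<lambda>h. of_bool (2 ^ k dvd h)) r n b i j)"
    if ij: "i < r" "j < i" for i j
  proof -
    have "b i \<le> (\<Sum>i<r. b i)" "b j \<le> (\<Sum>i<r. b i)"
      using ij assms(2) by (auto intro!: member_le_sum)
    moreover have "0 \<le> b i" "0 \<le> b j"
      using ij assms(2) by auto
    moreover have "b i \<noteq> b j"
      using inj_onD[OF assms(1), of i j] ij by auto
    ultimately have "h \<noteq> 0 \<and> \<bar>h\<bar> \<le> (\<Sum>i<r. b i)"
      if "h \<in> {min 0 (b i - b j)<..<max 0 (b i - b j)}" for h
      using that unfolding greaterThanLessThan_iff by linarith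
    then have "of_nat (multiplicity 2 h) = (\<Sum>k=1..K. of_bool (2 ^ k dvd h) :: bit)"
      if "h \<in> {min 0 (b i - b j)<..<max 0 (b i - b j)}" for h
      using that mult by blast
    then have "beta_transfer (\<lambda>h. of_nat (multiplicity 2 h)) r n b i j
        = (\<Sum>h\<in>{min 0 (b i - b j)<..<max 0 (b i - b j)}. \<Sum>k=1..K.
            of_bool (2 ^ k dvd h) * beta_count r n (b(i := b i - h, j := b j + h)))"
      unfolding beta_transfer_def sum_distrib_right[symmetric] by (intro sum.cong refl) simp
    also have "\<dots> = (\<Sum>k=1..K. beta_transfer (\<lambda>h. of_bool (2 ^ k dvd h)) r n b i j)"
      unfolding beta_transfer_def by (rule sum.swap)
    finally show ?thesis .
  qed
  then have "transfer_sum (\<lambda>h. of_nat (multiplicity 2 h)) r n b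
      = (\<Sum>i<r. \<Sum>j<i. \<Sum>k=1..K. beta_transfer (\<lambda>h. of_bool (2 ^ k dvd h)) r n b i j)"
    by (simp add: transfer_sum_def)
  also have "\<dots> = (\<Sum>i<r. \<Sum>k=1..K. \<Sum>j<i. beta_transfer (\<lambda>h. of_bool (2 ^ k dvd h)) r n b i j)"
    by (intro sum.cong refl sum.swap)
  also have "\<dots> = (\<Sum>k=1..K. transfer_sum (\<lambda>h. of_bool (2 ^ k dvd h)) r n b)"
    unfolding transfer_sum_def by (rule sum.swap)
  also have "\<dots> = 0"
    using assms by (intro sum.neutral ballI transfer_sum_dvd_eq_0) auto
  finally show ?thesis .
qed

section \<open>Standard tableaux and their inversions\<close>

lemma mem_diagram_iff: "(i, j) \<in> diagram \<mu> \<longleftrightarrow> i < length \<mu> \<and> j < \<mu> ! i"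
  by (simp add: diagram_def)

lemma finite_diagram: "finite (diagram \<mu>)"
proof -
  have "diagram \<mu> = (SIGMA i:{..<length \<mu>}. {..<\<mu> ! i})"
    by (auto simp: diagram_def)
  then show ?thesis
    by simp
qed

lemma tableau_bij: "t \<in> tableaux \<mu> \<Longrightarrow> bij_betw t (diagram \<mu>) {1..sum_list \<mu>}"
  by (simp add: tableaux_def)

lemma tableau_inj: "t \<in> tableaux \<mu> \<Longrightarrow> inj_on t (diagram \<mu>)"
  using tableau_bij bij_betw_imp_inj_on by blast

lemma tableau_range: "t \<in> tableaux \<mu> \<Longrightarrow> x \<in> diagram \<mu> \<Longrightarrow> t x \<in> {1..sum_list \<mu>}"
  using tableau_bij bij_betwE by blast

lemma tableau_undefined: "t \<in> tableaux \<mu> \<Longrightarrow> x \<notin> diagram \<mu> \<Longrightarrow> t x = undefined"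
  by (cases x) (auto simp: tableaux_def extensional_def)

lemma standard_tableauD:
  assumes "t \<in> standard_tableaux \<mu>"
  shows "t \<in> tableaux \<mu>"
    and "\<And>i j j'. (i, j) \<in> diagram \<mu> \<Longrightarrow> (i, j') \<in> diagram \<mu> \<Longrightarrow> j < j' \<Longrightarrow> t (i, j) < t (i, j')"
    and "\<And>i i' j. (i, j) \<in> diagram \<mu> \<Longrightarrow> (i', j) \<in> diagram \<mu> \<Longrightarrow> i < i' \<Longrightarrow> t (i, j) < t (i', j)"
  using assms by (auto simp: standard_tableaux_def)

definition removable :: "nat list \<Rightarrow> nat set" where
  "removable \<mu> = {a. a < length \<mu> \<and> 0 < \<mu> ! a \<and> (Suc a < length \<mu> \<longrightarrow> \<mu> ! Suc a < \<mu> ! a)}"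

text \<open>A row that becomes empty stays in the list, so the number of rows and the shift in the
  beta numbers do not change. For this reason the lemmas assume only weakly decreasing lists and
  admit zero parts.\<close>

definition remove_cell :: "nat list \<Rightarrow> nat \<Rightarrow> nat list" where
  "remove_cell \<mu> a = \<mu>[a := \<mu> ! a - 1]"

abbreviation row_end :: "nat list \<Rightarrow> nat \<Rightarrow> nat \<times> nat" where
  "row_end \<mu> a \<equiv> (a, \<mu> ! a - 1)"

lemma finite_removable: "finite (removable \<mu>)"
  by (rule finite_subset[of _ "{..<length \<mu>}"]) (auto simp: removable_def)

lemma sorted_nth_mono: "sorted_wrt (\<ge>) \<mu> \<Longrightarrow> i \<le> j \<Longrightarrow> j < length \<mu> \<Longrightarrow> \<mu> ! j \<le> \<mu> ! i"
  for \<mu> :: "nat list"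
  by (cases "i = j") (auto simp: sorted_wrt_iff_nth_less)

lemma removable_below:
  assumes "sorted_wrt (\<ge>) \<mu>" "a \<in> removable \<mu>" "a < i" "i < length \<mu>"
  shows "\<mu> ! i < \<mu> ! a"
proof -
  have "\<mu> ! i \<le> \<mu> ! Suc a"
    using assms by (intro sorted_nth_mono) auto
  then show ?thesis
    using assms by (auto simp: removable_def)
qed

lemma sorted_remove_cell:
  assumes "sorted_wrt (\<ge>) \<mu>" "a \<in> removable \<mu>"
  shows "sorted_wrt (\<ge>) (remove_cell \<mu> a)"
  unfolding sorted_wrt_iff_nth_less
proof (intro allI impI)
  fix i j assume "i < j" "j < length (remove_cell \<mu> a)"
  then have ij: "i < j" "j < length \<mu>" "i < length \<mu>"
    by (auto simp: remove_cell_def)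
  then have "\<mu> ! j \<le> \<mu> ! i"
    using assms(1) by (simp add: sorted_wrt_iff_nth_less)
  then show "remove_cell \<mu> a ! j \<le> remove_cell \<mu> a ! i"
    using ij assms(2) removable_below[OF assms, of j]
    by (auto simp: remove_cell_def removable_def nth_list_update)
qed

lemma length_remove_cell [simp]: "length (remove_cell \<mu> a) = length \<mu>"
  by (simp add: remove_cell_def)

lemma sum_list_remove_cell: "a \<in> removable \<mu> \<Longrightarrow> sum_list \<mu> = Suc (sum_list (remove_cell \<mu> a))"
  using elem_le_sum_list[of a \<mu>] by (auto simp: remove_cell_def removable_def sum_list_update)

lemma diagram_remove_cell:
  assumes "a \<in> removable \<mu>"
  shows "diagram \<mu> = insert (row_end \<mu> a) (diagram (remove_cell \<mu> a))"
    and "row_end \<mu> a \<notin> diagram (remove_cell \<mu> a)"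
  using assms by (auto simp: diagram_def remove_cell_def removable_def nth_list_update split: if_splits)

lemma tableaux_remove_cell:
  assumes a: "a \<in> removable \<mu>" and n: "t (row_end \<mu> a) = sum_list \<mu>"
  shows "t \<in> tableaux \<mu> \<longleftrightarrow> t(row_end \<mu> a := undefined) \<in> tableaux (remove_cell \<mu> a)"
proof -
  let ?D = "diagram (remove_cell \<mu> a)" and ?c = "row_end \<mu> a"
  let ?s = "t(?c := undefined)"
  note D = diagram_remove_cell[OF a] and s = sum_list_remove_cell[OF a]
  have "t \<in> extensional (diagram \<mu>) \<longleftrightarrow> ?s \<in> extensional ?D"
    unfolding D(1) extensional_def by auto
  moreover have "bij_betw t (diagram \<mu>) {1..sum_list \<mu>} \<longleftrightarrow> bij_betw t ?D {1..sum_list (remove_cell \<mu> a)}"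
  proof
    assume "bij_betw t (diagram \<mu>) {1..sum_list \<mu>}"
    then have "bij_betw t (diagram \<mu> - {?c}) ({1..sum_list \<mu>} - {t ?c})"
      by (intro bij_betw_DiffI) (auto simp: D(1) bij_betw_def)
    moreover have "diagram \<mu> - {?c} = ?D" "{1..sum_list \<mu>} - {t ?c} = {1..sum_list (remove_cell \<mu> a)}"
      using D n s by auto
    ultimately show "bij_betw t ?D {1..sum_list (remove_cell \<mu> a)}"
      by simp
  next
    assume "bij_betw t ?D {1..sum_list (remove_cell \<mu> a)}"
    then have "bij_betw t (?D \<union> {?c}) ({1..sum_list (remove_cell \<mu> a)} \<union> {t ?c})"
      using D n s by (intro notIn_Un_bij_betw) auto
    moreover have "?D \<union> {?c} = diagram \<mu>" "{1..sum_list (remove_cell \<mu> a)} \<union> {t ?c} = {1..sum_list \<mu>}"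
      using D n s by auto
    ultimately show "bij_betw t (diagram \<mu>) {1..sum_list \<mu>}"
      by simp
  qed
  moreover have "bij_betw t ?D A \<longleftrightarrow> bij_betw ?s ?D A" for A
    using D(2) by (intro bij_betw_cong) auto
  ultimately show ?thesis
    by (simp add: tableaux_def)
qed

lemma standard_tableaux_remove_cell:
  assumes sorted: "sorted_wrt (\<ge>) \<mu>" and a: "a \<in> removable \<mu>" and n: "t (row_end \<mu> a) = sum_list \<mu>"
  shows "t \<in> standard_tableaux \<mu> \<longleftrightarrow> t(row_end \<mu> a := undefined) \<in> standard_tableaux (remove_cell \<mu> a)"
proof -
  let ?c = "row_end \<mu> a"
  let ?s = "t(?c := undefined)"
  note D = diagram_remove_cell[OF a]
  have sub: "x \<in> diagram (remove_cell \<mu> a) \<Longrightarrow> x \<in> diagram \<mu> \<and> ?s x = t x" for x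
    using D by auto
  show ?thesis
  proof
    assume t: "t \<in> standard_tableaux \<mu>"
    then have "?s \<in> tableaux (remove_cell \<mu> a)"
      using standard_tableauD(1) tableaux_remove_cell[where t = t, OF a n] by blast
    then show "?s \<in> standard_tableaux (remove_cell \<mu> a)"
      unfolding standard_tableaux_def using standard_tableauD(2,3)[OF t] sub by (auto simp del: fun_upd_apply)
  next
    assume s: "?s \<in> standard_tableaux (remove_cell \<mu> a)"
    have st: "?s \<in> tableaux (remove_cell \<mu> a)"
      using s by (rule standard_tableauD(1))
    have less: "t x < sum_list \<mu>" if "x \<in> diagram (remove_cell \<mu> a)" for x
      using tableau_range[OF st that] sub[OF that] sum_list_remove_cell[OF a] by auto
    have "t \<in> tableaux \<mu>"
      using st tableaux_remove_cell[where t = t, OF a n] by blast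
    moreover have "t (i, j) < t (i, j')"
      if h: "(i, j) \<in> diagram \<mu>" "(i, j') \<in> diagram \<mu>" "j < j'" for i j j'
    proof -
      have "(i, j) \<noteq> ?c"
        using h by (auto simp: mem_diagram_iff)
      then have 1: "(i, j) \<in> diagram (remove_cell \<mu> a)"
        using h D by auto
      show ?thesis
      proof (cases "(i, j') = ?c")
        case True
        then show ?thesis
          using less[OF 1] n by simp
      next
        case False
        then have 2: "(i, j') \<in> diagram (remove_cell \<mu> a)"
          using h D by auto
        show ?thesis
          using standard_tableauD(2)[OF s 1 2 h(3)] sub[OF 1] sub[OF 2] by simp
      qed
    qed
    moreover have "t (i, j) < t (i', j)"
      if h: "(i, j) \<in> diagram \<mu>" "(i', j) \<in> diagram \<mu>" "i < i'" for i i' j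
    proof -
      have "(i, j) \<noteq> ?c"
        using h removable_below[OF sorted a, of i'] by (auto simp: mem_diagram_iff)
      then have 1: "(i, j) \<in> diagram (remove_cell \<mu> a)"
        using h D by auto
      show ?thesis
      proof (cases "(i', j) = ?c")
        case True
        then show ?thesis
          using less[OF 1] n by simp
      next
        case False
        then have 2: "(i', j) \<in> diagram (remove_cell \<mu> a)"
          using h D by auto
        show ?thesis
          using standard_tableauD(3)[OF s 1 2 h(3)] sub[OF 1] sub[OF 2] by simp
      qed
    qed
    ultimately show "t \<in> standard_tableaux \<mu>"
      unfolding standard_tableaux_def by blast
  qed
qed

lemma finite_standard_tableaux: "finite (standard_tableaux \<mu>)"
  using finite_tableaux[of \<mu>] by (auto simp: standard_tableaux_def)

lemma largest_entry_removable:
  assumes sorted: "sorted_wrt (\<ge>) \<mu>" and t: "t \<in> standard_tableaux \<mu>" and pos: "0 < sum_list \<mu>"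
  shows "\<exists>a\<in>removable \<mu>. t (row_end \<mu> a) = sum_list \<mu>"
proof -
  have "sum_list \<mu> \<in> t ` diagram \<mu>"
    using tableau_bij[OF standard_tableauD(1)[OF t]] pos by (auto simp: bij_betw_def)
  then obtain a j where c: "(a, j) \<in> diagram \<mu>" "t (a, j) = sum_list \<mu>"
    by auto
  have max: "t x \<le> sum_list \<mu>" if "x \<in> diagram \<mu>" for x
    using tableau_range[OF standard_tableauD(1)[OF t] that] by simp
  have "(a, Suc j) \<notin> diagram \<mu>"
    using standard_tableauD(2)[OF t c(1), of "Suc j"] max[of "(a, Suc j)"] c(2) by auto
  then have j: "j = \<mu> ! a - 1"
    using c(1) by (auto simp: mem_diagram_iff)
  have "(Suc a, j) \<notin> diagram \<mu>"
    using standard_tableauD(3)[OF t c(1), of "Suc a"] max[of "(Suc a, j)"] c(2) by auto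
  then have "a \<in> removable \<mu>"
    using c(1) j by (auto simp: mem_diagram_iff removable_def)
  with c(2) j show ?thesis
    by auto
qed

text \<open>The largest entry sits at a removable cell, and deleting it is a bijection onto the
  standard tableaux of the smaller shape. The function \<open>F\<close> is arbitrary because the
  recursion serves both the number of tableaux and their inversion weights.\<close>

lemma sum_standard_tableaux:
  fixes F :: "tableau \<Rightarrow> 'a::comm_monoid_add"
  assumes sorted: "sorted_wrt (\<ge>) \<mu>" and pos: "0 < sum_list \<mu>"
  shows "(\<Sum>t\<in>standard_tableaux \<mu>. F t)
    = (\<Sum>a\<in>removable \<mu>. \<Sum>s\<in>standard_tableaux (remove_cell \<mu> a). F (s(row_end \<mu> a := sum_list \<mu>)))"
proof -
  let ?S = "\<lambda>a. {t \<in> standard_tableaux \<mu>. t (row_end \<mu> a) = sum_list \<mu>}"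
  have "standard_tableaux \<mu> = (\<Union>a\<in>removable \<mu>. ?S a)"
    using largest_entry_removable[OF sorted _ pos] by blast
  then have "(\<Sum>t\<in>standard_tableaux \<mu>. F t) = (\<Sum>t\<in>(\<Union>a\<in>removable \<mu>. ?S a). F t)"
    by simp
  also have "\<dots> = (\<Sum>a\<in>removable \<mu>. \<Sum>t\<in>?S a. F t)"
  proof (intro sum.UNION_disjoint finite_removable ballI impI)
    fix a b assume ab: "a \<in> removable \<mu>" "b \<in> removable \<mu>" "a \<noteq> b"
    have "row_end \<mu> a \<in> diagram \<mu>" "row_end \<mu> b \<in> diagram \<mu>"
      using diagram_remove_cell(1) ab by blast+
    then have "t (row_end \<mu> a) \<noteq> t (row_end \<mu> b)" if "t \<in> standard_tableaux \<mu>" for t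
      using ab(3) inj_onD[OF tableau_inj[OF standard_tableauD(1)[OF that]], of "row_end \<mu> a" "row_end \<mu> b"]
      by blast
    then show "?S a \<inter> ?S b = {}"
      by (intro equals0I) (metis (mono_tags, lifting) IntE mem_Collect_eq)
  qed (use finite_standard_tableaux in auto)
  also have "\<dots> = (\<Sum>a\<in>removable \<mu>. \<Sum>s\<in>standard_tableaux (remove_cell \<mu> a). F (s(row_end \<mu> a := sum_list \<mu>)))"
  proof (rule sum.cong[OF refl])
    fix a assume a: "a \<in> removable \<mu>"
    have undef: "s (row_end \<mu> a) = undefined" if "s \<in> standard_tableaux (remove_cell \<mu> a)" for s
      using tableau_undefined[OF standard_tableauD(1)[OF that]] diagram_remove_cell(2)[OF a] by blast
    show "(\<Sum>t\<in>?S a. F t) = (\<Sum>s\<in>standard_tableaux (remove_cell \<mu> a). F (s(row_end \<mu> a := sum_list \<mu>)))"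
    proof (rule sum.reindex_bij_witness[where j = "\<lambda>t. t(row_end \<mu> a := undefined)"
          and i = "\<lambda>s. s(row_end \<mu> a := sum_list \<mu>)"])
      fix t assume t: "t \<in> ?S a"
      then show "t(row_end \<mu> a := undefined, row_end \<mu> a := sum_list \<mu>) = t"
        by auto
      then show "F (t(row_end \<mu> a := undefined, row_end \<mu> a := sum_list \<mu>)) = F t"
        by simp
      show "t(row_end \<mu> a := undefined) \<in> standard_tableaux (remove_cell \<mu> a)"
        using standard_tableaux_remove_cell[OF sorted a, of t] t by blast
    next
      fix s assume s: "s \<in> standard_tableaux (remove_cell \<mu> a)"
      then show eq: "s(row_end \<mu> a := sum_list \<mu>, row_end \<mu> a := undefined) = s"
        using undef[OF s] by auto
      show "s(row_end \<mu> a := sum_list \<mu>) \<in> ?S a"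
        using standard_tableaux_remove_cell[OF sorted a, of "s(row_end \<mu> a := sum_list \<mu>)"] s eq
        by simp
    qed
  qed
  finally show ?thesis .
qed

section \<open>Contents and inversions\<close>

definition cell_content :: "nat \<times> nat \<Rightarrow> int" where
  "cell_content x = int (snd x) - int (fst x)"

text \<open>Inversions relative to the row reading: the strictly higher cell holds the larger entry.
  An admissible swap changes this set by exactly one pair, which is why it records the
  norms.\<close>

definition inversions :: "nat list \<Rightarrow> tableau \<Rightarrow> ((nat \<times> nat) \<times> (nat \<times> nat)) set" where
  "inversions \<mu> t = {(x, y). x \<in> diagram \<mu> \<and> y \<in> diagram \<mu> \<and> fst x < fst y \<and> t y < t x}"

text \<open>Additive counterpart of the product of \<open>(d - 1) * (d + 1)\<close> over the
  inversions, where \<open>d\<close> is the difference of the contents; \<open>v\<close> stands for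
  the valuation.\<close>

definition inversion_weight :: "(int \<Rightarrow> 'a) \<Rightarrow> nat list \<Rightarrow> tableau \<Rightarrow> 'a::comm_monoid_add" where
  "inversion_weight v \<mu> t = (\<Sum>(x, y)\<in>inversions \<mu> t.
     v (cell_content x - cell_content y - 1) + v (cell_content x - cell_content y + 1))"

lemma finite_inversions: "finite (inversions \<mu> t)"
  by (rule finite_subset[of _ "diagram \<mu> \<times> diagram \<mu>"]) (auto simp: inversions_def finite_diagram)

text \<open>The lower cell \<open>y\<close> lies strictly to the left of \<open>x\<close>: otherwise
  the entry at the row of \<open>x\<close> and the column of \<open>y\<close> would lie between the
  two and force \<open>t x < t y\<close>. Hence the column and the row each contribute at least 1 to
  the difference.\<close>

lemma inversion_content:
  assumes "t \<in> standard_tableaux \<mu>" "sorted_wrt (\<ge>) \<mu>" "(x, y) \<in> inversions \<mu> t"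
  shows "2 \<le> cell_content x - cell_content y"
proof -
  obtain i j i' j' where xy: "x = (i, j)" "y = (i', j')"
    by (cases x; cases y)
  have h: "(i, j) \<in> diagram \<mu>" "(i', j') \<in> diagram \<mu>" "i < i'" "t (i', j') < t (i, j)"
    using assms(3) by (auto simp: inversions_def xy)
  have "j' < j"
  proof (rule ccontr)
    assume "\<not> j' < j"
    moreover have "(i, j') \<in> diagram \<mu>"
      using h(2,3) sorted_nth_mono[OF assms(2), of i i'] by (auto simp: mem_diagram_iff)
    ultimately have "t (i, j) \<le> t (i, j')" "t (i, j') < t (i', j')"
      using standard_tableauD(2)[OF assms(1) h(1), of j'] standard_tableauD(3)[OF assms(1) _ h(2,3)]
      by (cases "j = j'"; auto)+
    with h(4) show False
      by simp
  qed
  with h(3) show ?thesis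
    by (simp add: cell_content_def xy)
qed

lemma inversions_remove_cell:
  assumes "a \<in> removable \<mu>" "s \<in> standard_tableaux (remove_cell \<mu> a)"
  shows "inversions \<mu> (s(row_end \<mu> a := sum_list \<mu>)) = inversions (remove_cell \<mu> a) s
    \<union> Pair (row_end \<mu> a) ` {y \<in> diagram (remove_cell \<mu> a). a < fst y}"
proof -
  have less: "s x < sum_list \<mu>" if "x \<in> diagram (remove_cell \<mu> a)" for x
    using tableau_range[OF standard_tableauD(1)[OF assms(2)] that] sum_list_remove_cell[OF assms(1)]
    by auto
  show ?thesis
    unfolding inversions_def diagram_remove_cell(1)[OF assms(1)]
    using less diagram_remove_cell(2)[OF assms(1)] by (fastforce split: if_splits)
qed

section \<open>Beta numbers of a shape and the weight of its largest entry\<close>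

text \<open>The value 0 outside the rows turns the removal of a cell into an exact function update
  at one index. If all rows are nonempty, these are the hook lengths of the first column.\<close>

definition beta_number :: "nat list \<Rightarrow> nat \<Rightarrow> int" where
  "beta_number \<mu> i = (if i < length \<mu> then int (\<mu> ! i) + int (length \<mu>) - 1 - int i else 0)"

lemma beta_number_remove_cell:
  assumes "a \<in> removable \<mu>"
  shows "beta_number (remove_cell \<mu> a) = (beta_number \<mu>)(a := beta_number \<mu> a - 1)"
  using assms by (auto simp: beta_number_def remove_cell_def removable_def nth_list_update fun_eq_iff)

lemma beta_number_strict:
  assumes "sorted_wrt (\<ge>) \<mu>" "i < j" "j < length \<mu>"
  shows "beta_number \<mu> j < beta_number \<mu> i"
  using assms sorted_nth_mono[OF assms(1), of i j] by (simp add: beta_number_def)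

lemma beta_number_inj:
  assumes "sorted_wrt (\<ge>) \<mu>"
  shows "inj_on (beta_number \<mu>) {..<length \<mu>}"
proof (rule inj_onI)
  fix i j assume "i \<in> {..<length \<mu>}" "j \<in> {..<length \<mu>}" "beta_number \<mu> i = beta_number \<mu> j"
  then show "i = j"
    using beta_number_strict[OF assms, of i j] beta_number_strict[OF assms, of j i]
    by (cases i j rule: linorder_cases) auto
qed

lemma beta_number_nonneg: "0 \<le> beta_number \<mu> i"
  by (simp add: beta_number_def)

text \<open>The two shifted copies of \<open>v\<close> overlap up to a displacement by 2; modulo 2
  only two terms at each end survive. This is the contribution of a row of \<open>m\<close>
  cells.\<close>

lemma sum_telescope_bit:
  fixes v :: "int \<Rightarrow> bit"
  shows "(\<Sum>k<m. v (x - int k - 1) + v (x - int k + 1))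
    = v (x + 1) + v x + (v (x + 1 - int m) + v (x - int m))"
proof (induction m)
  case 0
  have "p + q + (p + q) = 0" for p q :: bit
    by simp
  then show ?case
    by simp
next
  case (Suc m)
  have "p + q + (r + s) + (t + r) = p + q + (s + t)" for p q r s t :: bit
    by (cases p; cases q; cases r; cases s; cases t) auto
  with Suc show ?case
    by (simp add: algebra_simps)
qed

text \<open>The largest entry is inverted with every cell in a lower row. Along each such row the
  weights telescope modulo 2: the right end yields differences of beta numbers, and the left ends,
  in the first column, telescope once more down the rows to
  \<open>v (beta_number \<mu> a) + v (int (\<mu> ! a))\<close>.\<close>

lemma inversion_weight_remove_cell:
  fixes v :: "int \<Rightarrow> bit"
  assumes sorted: "sorted_wrt (\<ge>) \<mu>" and a: "a \<in> removable \<mu>"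
    and s: "s \<in> standard_tableaux (remove_cell \<mu> a)"
  shows "inversion_weight v \<mu> (s(row_end \<mu> a := sum_list \<mu>)) = inversion_weight v (remove_cell \<mu> a) s
    + ((\<Sum>j\<in>{a<..<length \<mu>}. v (beta_number \<mu> a - beta_number \<mu> j - 1) + v (beta_number \<mu> a - beta_number \<mu> j))
       + (v (beta_number \<mu> a) + v (int (\<mu> ! a))))"
proof -
  let ?c = "row_end \<mu> a" and ?D = "diagram (remove_cell \<mu> a)"
  let ?w = "\<lambda>y. v (cell_content ?c - cell_content y - 1) + v (cell_content ?c - cell_content y + 1)"
  have a': "a < length \<mu>" "0 < \<mu> ! a"
    using a by (auto simp: removable_def)
  have "inversion_weight v \<mu> (s(?c := sum_list \<mu>))
      = inversion_weight v (remove_cell \<mu> a) s + (\<Sum>(x, y)\<in>Pair ?c ` {y \<in> ?D. a < fst y}.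
          v (cell_content x - cell_content y - 1) + v (cell_content x - cell_content y + 1))"
    unfolding inversion_weight_def inversions_remove_cell[OF a s]
  proof (rule sum.union_disjoint)
    show "inversions (remove_cell \<mu> a) s \<inter> Pair ?c ` {y \<in> ?D. a < fst y} = {}"
      using diagram_remove_cell(2)[OF a] by (auto simp: inversions_def)
  qed (auto simp: finite_inversions finite_diagram)
  also have "(\<Sum>(x, y)\<in>Pair ?c ` {y \<in> ?D. a < fst y}.
      v (cell_content x - cell_content y - 1) + v (cell_content x - cell_content y + 1)) = (\<Sum>y | y \<in> ?D \<and> a < fst y. ?w y)"
    by (subst sum.reindex) (auto simp: inj_on_def)
  also have "{y. y \<in> ?D \<and> a < fst y} = (SIGMA j:{a<..<length \<mu>}. {..<\<mu> ! j})"
    by (auto simp: diagram_def remove_cell_def nth_list_update split: if_splits)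
  also have "sum ?w (SIGMA j:{a<..<length \<mu>}. {..<\<mu> ! j}) = (\<Sum>j\<in>{a<..<length \<mu>}. \<Sum>k<\<mu> ! j. ?w (j, k))"
    by (subst sum.Sigma) (auto simp: case_prod_beta)
  also have "\<dots> = (\<Sum>j\<in>{a<..<length \<mu>}.
      (v (beta_number \<mu> a - beta_number \<mu> j - 1) + v (beta_number \<mu> a - beta_number \<mu> j))
      + (v (int (\<mu> ! a) + int (j - a)) + v (int (\<mu> ! a) + int (j - a - 1))))"
  proof (rule sum.cong[OF refl])
    fix j assume j: "j \<in> {a<..<length \<mu>}"
    \<comment> \<open>The content of the removed cell minus that of the first cell of row
      \<open>j\<close>.\<close>
    define x where "x = int (\<mu> ! a) - 1 - int a + int j"
    have "?w (j, k) = v (x - int k - 1) + v (x - int k + 1)" for k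
      using a' by (simp add: cell_content_def x_def of_nat_diff algebra_simps)
    then have "(\<Sum>k<\<mu> ! j. ?w (j, k)) = v (x + 1) + v x + (v (x + 1 - int (\<mu> ! j)) + v (x - int (\<mu> ! j)))"
      by (simp only: sum_telescope_bit)
    moreover have "x + 1 = int (\<mu> ! a) + int (j - a)" "x = int (\<mu> ! a) + int (j - a - 1)"
      using j by (auto simp: x_def of_nat_diff)
    moreover have "x + 1 - int (\<mu> ! j) = beta_number \<mu> a - beta_number \<mu> j"
      "x - int (\<mu> ! j) = beta_number \<mu> a - beta_number \<mu> j - 1"
      using j a' by (auto simp: x_def beta_number_def)
    ultimately show "(\<Sum>k<\<mu> ! j. ?w (j, k))
      = (v (beta_number \<mu> a - beta_number \<mu> j - 1) + v (beta_number \<mu> a - beta_number \<mu> j))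
      + (v (int (\<mu> ! a) + int (j - a)) + v (int (\<mu> ! a) + int (j - a - 1)))"
      by (simp only: ac_simps)
  qed
  also have "\<dots> = (\<Sum>j\<in>{a<..<length \<mu>}. v (beta_number \<mu> a - beta_number \<mu> j - 1) + v (beta_number \<mu> a - beta_number \<mu> j))
      + (\<Sum>j\<in>{a<..<length \<mu>}. v (int (\<mu> ! a) + int (j - a)) + v (int (\<mu> ! a) + int (j - a - 1)))"
    by (rule sum.distrib)
  also have "(\<Sum>j\<in>{a<..<length \<mu>}. v (int (\<mu> ! a) + int (j - a)) + v (int (\<mu> ! a) + int (j - a - 1)))
      = (\<Sum>l<length \<mu> - 1 - a. v (int (\<mu> ! a) + int (Suc l)) + v (int (\<mu> ! a) + int l))"
    by (rule sum.reindex_bij_witness[where i = "\<lambda>l. Suc (a + l)" and j = "\<lambda>j. j - a - 1"]) auto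
  also have "\<dots> = v (int (\<mu> ! a) + int (length \<mu> - 1 - a)) + v (int (\<mu> ! a))"
  proof (induction "length \<mu> - 1 - a")
    case (Suc m)
    have "(\<Sum>l<m. v (int (\<mu> ! a) + int (Suc l)) + v (int (\<mu> ! a) + int l)) = v (int (\<mu> ! a) + int m) + v (int (\<mu> ! a))" for m
    proof (induction m)
      case (Suc m)
      have "p + q + (r + p) = r + q" for p q r :: bit
        by (cases p; cases q; cases r) auto
      with Suc show ?case
        by (simp only: sum.lessThan_Suc)
    qed simp
    then show ?case .
  qed simp
  also have "int (\<mu> ! a) + int (length \<mu> - 1 - a) = beta_number \<mu> a"
    using a' by (simp add: beta_number_def of_nat_diff)
  finally show ?thesis .
qed

text \<open>A row equal to the next one collides with it after lowering; the only other obstruction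
  is an empty last row, whose entry 0 becomes negative. The alternatives are kept apart because
  transfer sums vanish in the first case but not in general in the second.\<close>

lemma beta_count_not_removable:
  assumes "sorted_wrt (\<ge>) \<mu>" "a < length \<mu>" "a \<notin> removable \<mu>"
  shows "(\<exists>k<length \<mu>. \<exists>l<length \<mu>. k \<noteq> l \<and>
      ((beta_number \<mu>)(a := beta_number \<mu> a - 1)) k = ((beta_number \<mu>)(a := beta_number \<mu> a - 1)) l)
    \<or> Suc a = length \<mu> \<and> \<mu> ! a = 0"
proof (cases "Suc a < length \<mu>")
  case True
  then have "\<mu> ! Suc a = \<mu> ! a"
    using assms sorted_nth_mono[OF assms(1), of a "Suc a"] by (auto simp: removable_def)
  then have "((beta_number \<mu>)(a := beta_number \<mu> a - 1)) a = ((beta_number \<mu>)(a := beta_number \<mu> a - 1)) (Suc a)"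
    using True by (simp add: beta_number_def)
  with True assms(2) show ?thesis
    by (metis n_not_Suc_n)
qed (use assms in \<open>auto simp: removable_def\<close>)

lemma beta_count_sum_removable:
  assumes sorted: "sorted_wrt (\<ge>) \<mu>"
  shows "(\<Sum>a<length \<mu>. w a * beta_count (length \<mu>) n ((beta_number \<mu>)(a := beta_number \<mu> a - 1)))
    = (\<Sum>a\<in>removable \<mu>. w a * beta_count (length \<mu>) n (beta_number (remove_cell \<mu> a)))"
proof -
  have zero: "beta_count (length \<mu>) n ((beta_number \<mu>)(a := beta_number \<mu> a - 1)) = 0"
    if a: "a < length \<mu>" "a \<notin> removable \<mu>" for a
    using beta_count_not_removable[OF sorted a]
  proof (elim disjE exE conjE)
    fix k l assume "k < length \<mu>" "l < length \<mu>" "k \<noteq> l"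
      "((beta_number \<mu>)(a := beta_number \<mu> a - 1)) k = ((beta_number \<mu>)(a := beta_number \<mu> a - 1)) l"
    then show ?thesis
      by (rule beta_count_not_inj)
  next
    assume "Suc a = length \<mu>" "\<mu> ! a = 0"
    then show ?thesis
      using a by (intro beta_count_neg[of a]) (auto simp: beta_number_def)
  qed
  have "(\<Sum>a<length \<mu>. w a * beta_count (length \<mu>) n ((beta_number \<mu>)(a := beta_number \<mu> a - 1)))
      = (\<Sum>a\<in>removable \<mu>. w a * beta_count (length \<mu>) n ((beta_number \<mu>)(a := beta_number \<mu> a - 1)))"
    using zero by (intro sum.mono_neutral_right) (auto simp: removable_def)
  then show ?thesis
    by (simp add: beta_number_remove_cell cong: sum.cong)
qed

lemma standard_tableaux_empty:
  assumes "sum_list \<mu> = 0"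
  shows "standard_tableaux \<mu> = {\<lambda>_. undefined}"
proof -
  have "\<mu> ! i = 0" if "i < length \<mu>" for i
    using assms that elem_le_sum_list[OF that] by simp
  then have "diagram \<mu> = {}"
    by (auto simp: diagram_def)
  then show ?thesis
    using assms by (auto simp: standard_tableaux_def tableaux_def bij_betw_def)
qed

lemma beta_number_image_empty:
  assumes "sum_list \<mu> = 0"
  shows "beta_number \<mu> ` {..<length \<mu>} = {0..<int (length \<mu>)}"
proof -
  have "\<mu> ! i = 0" if "i < length \<mu>" for i
    using assms that elem_le_sum_list[OF that] by simp
  then have *: "beta_number \<mu> i = int (length \<mu>) - 1 - int i" if "i < length \<mu>" for i
    using that by (simp add: beta_number_def)
  show ?thesis
  proof (intro equalityI subsetI)
    fix x assume "x \<in> {0..<int (length \<mu>)}"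
    then have "x = beta_number \<mu> (nat (int (length \<mu>) - 1 - x))" "nat (int (length \<mu>) - 1 - x) < length \<mu>"
      by (auto simp: *)
    then show "x \<in> beta_number \<mu> ` {..<length \<mu>}"
      by blast
  qed (auto simp: *)
qed

lemma card_standard_tableaux_bit:
  assumes "sorted_wrt (\<ge>) \<mu>"
  shows "of_nat (card (standard_tableaux \<mu>)) = beta_count (length \<mu>) (sum_list \<mu>) (beta_number \<mu>)"
  using assms
proof (induction "sum_list \<mu>" arbitrary: \<mu>)
  case 0
  then have empty: "sum_list \<mu> = 0"
    by simp
  show ?case
    unfolding standard_tableaux_empty[OF empty] empty beta_count.simps beta_number_image_empty[OF empty]
    by simp
next
  case (Suc n)
  have IH: "of_nat (card (standard_tableaux (remove_cell \<mu> a))) = beta_count (length \<mu>) n (beta_number (remove_cell \<mu> a))"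
    if "a \<in> removable \<mu>" for a
    using Suc.hyps(1)[of "remove_cell \<mu> a"] Suc.hyps(2) sum_list_remove_cell[OF that]
      sorted_remove_cell[OF Suc.prems that] by simp
  have "card (standard_tableaux \<mu>) = (\<Sum>a\<in>removable \<mu>. card (standard_tableaux (remove_cell \<mu> a)))"
    using sum_standard_tableaux[OF Suc.prems, of "\<lambda>_. 1::nat"] Suc.hyps(2) by simp
  then have "of_nat (card (standard_tableaux \<mu>)) = (\<Sum>a\<in>removable \<mu>. 1 * beta_count (length \<mu>) n (beta_number (remove_cell \<mu> a)))"
    using IH by simp
  also have "\<dots> = (\<Sum>a<length \<mu>. 1 * beta_count (length \<mu>) n ((beta_number \<mu>)(a := beta_number \<mu> a - 1)))"
    by (rule beta_count_sum_removable[OF Suc.prems, symmetric])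
  also have "\<dots> = beta_count (length \<mu>) (sum_list \<mu>) (beta_number \<mu>)"
    unfolding Suc.hyps(2)[symmetric] beta_count.simps mult_1 ..
  finally show ?case .
qed

section \<open>Inversion weights as transfer sums\<close>

text \<open>A transfer strictly inside the interval loses the value \<open>b i\<close>, whereas a
  nonzero count for \<open>n = 0\<close> requires all values from 0 to r - 1.\<close>

lemma transfer_sum_0:
  assumes "b ` {..<r} = {0..<int r}" and inj: "inj_on b {..<r}"
  shows "transfer_sum v r 0 b = 0"
proof -
  have "beta_count r 0 (b(i := b i - h, j := b j + h)) = 0"
    if ij: "i < r" "j < r" "i \<noteq> j" and h: "h \<in> {min 0 (b i - b j)<..<max 0 (b i - b j)}" for i j h
  proof -
    let ?c = "b(i := b i - h, j := b j + h)"
    have "b i \<notin> ?c ` {..<r}"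
    proof
      assume "b i \<in> ?c ` {..<r}"
      then obtain k where k: "k < r" "b i = ?c k"
        by blast
      consider "k = i" | "k = j" | "k \<noteq> i" "k \<noteq> j"
        by blast
      then show False
      proof cases
        case 1
        with k(2) ij(3) have "h = 0"
          by simp
        with h show False
          by auto
      next
        case 2
        with k(2) have "h = b i - b j"
          by simp
        with h show False
          by auto
      next
        case 3
        with k(2) have "b i = b k"
          by simp
        with 3 show False
          using inj_onD[OF inj, of i k] ij(1) k(1) by simp
      qed
    qed
    moreover have "b i \<in> {0..<int r}"
      using assms(1) ij(1) by blast
    ultimately show ?thesis
      by auto
  qed
  then show ?thesis
    unfolding transfer_sum_def beta_transfer_def by (intro sum.neutral ballI) auto
qed

text \<open>Both sides obey the same recursion when the largest entry is removed. Its weight has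
  three parts: the differences of beta numbers are the boundary terms of
  \<open>transfer_sum_Suc\<close>, \<open>v\<close> at the beta number itself comes from lowering
  the zero entry, and \<open>v\<close> at the row length is absorbed by the correction term. For the
  2-adic valuation that correction is the valuation of the product of the factorials of the row
  lengths. The bound on \<open>sum_list \<mu>\<close> makes the last row empty, so that 0 is a beta
  number.\<close>

lemma sum_inversion_weight:
  fixes v :: "int \<Rightarrow> bit"
  assumes even: "\<And>h. v (- h) = v h" and v1: "v 1 = 0"
    and sorted: "sorted_wrt (\<ge>) \<mu>" and large: "sum_list \<mu> < length \<mu>"
  shows "(\<Sum>t\<in>standard_tableaux \<mu>. inversion_weight v \<mu> t)
    = transfer_sum v (length \<mu>) (sum_list \<mu>) (beta_number \<mu>)
      + (\<Sum>i<length \<mu>. \<Sum>x<\<mu> ! i. v (int (Suc x))) * beta_count (length \<mu>) (sum_list \<mu>) (beta_number \<mu>)"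
  using sorted large
proof (induction "sum_list \<mu>" arbitrary: \<mu>)
  case 0
  then have empty: "sum_list \<mu> = 0"
    by simp
  have "\<mu> ! i = 0" if "i < length \<mu>" for i
    using empty that elem_le_sum_list[OF that] by simp
  then have "(\<Sum>i<length \<mu>. \<Sum>x<\<mu> ! i. v (int (Suc x))) = 0" and "diagram \<mu> = {}"
    by (auto simp: diagram_def)
  moreover have "transfer_sum v (length \<mu>) 0 (beta_number \<mu>) = 0"
    using beta_number_image_empty[OF empty] beta_number_inj[OF "0.prems"(1)] by (rule transfer_sum_0)
  ultimately show ?case
    unfolding standard_tableaux_empty[OF empty] empty
    by (simp add: inversion_weight_def inversions_def)
next
  case (Suc n)
  let ?r = "length \<mu>" and ?b = "beta_number \<mu>"
  let ?\<kappa> = "\<lambda>\<mu>. \<Sum>i<length \<mu>. \<Sum>x<\<mu> ! i. v (int (Suc x))"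
  let ?N = "\<lambda>a. beta_count ?r n (beta_number (remove_cell \<mu> a))"
  let ?Q = "\<lambda>a. transfer_sum v ?r n (beta_number (remove_cell \<mu> a))"
  define \<delta> where "\<delta> a = (\<Sum>j\<in>{a<..<?r}. v (?b a - ?b j - 1) + v (?b a - ?b j))" for a
  define z where "z = ?r - 1"
  have z: "z < ?r"
    using Suc.prems(2) by (simp add: z_def)
  have bz: "?b z = 0" and \<mu>z: "\<mu> ! z = 0"
  proof -
    have "\<mu> ! z = 0"
    proof (rule ccontr)
      assume "\<mu> ! z \<noteq> 0"
      moreover have "i \<le> z" if "i < ?r" for i
        using that by (simp add: z_def)
      ultimately have "1 \<le> \<mu> ! i" if "i < ?r" for i
        using sorted_nth_mono[OF Suc.prems(1) _ z, of i] that by fastforce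
      then have "(\<Sum>i<?r. 1) \<le> (\<Sum>i<?r. \<mu> ! i)"
        by (intro sum_mono) auto
      then show False
        using Suc.prems(2) by (simp add: sum_list_sum_nth atLeast0LessThan)
    qed
    then show "?b z = 0" "\<mu> ! z = 0"
      using z by (auto simp: beta_number_def z_def)
  qed
  have IH: "(\<Sum>s\<in>standard_tableaux (remove_cell \<mu> a). inversion_weight v (remove_cell \<mu> a) s)
      = ?Q a + ?\<kappa> (remove_cell \<mu> a) * ?N a" and
    card: "of_nat (card (standard_tableaux (remove_cell \<mu> a))) = ?N a"
    if "a \<in> removable \<mu>" for a
  proof -
    have "n = sum_list (remove_cell \<mu> a)"
      using Suc.hyps(2) sum_list_remove_cell[OF that] by simp
    then show "(\<Sum>s\<in>standard_tableaux (remove_cell \<mu> a). inversion_weight v (remove_cell \<mu> a) s)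
        = ?Q a + ?\<kappa> (remove_cell \<mu> a) * ?N a"
      using Suc.hyps(1)[of "remove_cell \<mu> a"] sorted_remove_cell[OF Suc.prems(1) that] Suc.prems(2) Suc.hyps(2)
      by simp
    show "of_nat (card (standard_tableaux (remove_cell \<mu> a))) = ?N a"
      using card_standard_tableaux_bit[OF sorted_remove_cell[OF Suc.prems(1) that]]
        \<open>n = sum_list (remove_cell \<mu> a)\<close> by simp
  qed
  have \<kappa>: "?\<kappa> \<mu> = ?\<kappa> (remove_cell \<mu> a) + v (int (\<mu> ! a))" if a: "a \<in> removable \<mu>" for a
  proof -
    have "a < ?r" "0 < \<mu> ! a"
      using a by (auto simp: removable_def)
    moreover from this obtain m where m: "\<mu> ! a = Suc m"
      using not0_implies_Suc by blast
    moreover have "(\<Sum>i\<in>{..<?r} - {a}. \<Sum>x<remove_cell \<mu> a ! i. v (int (Suc x)))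
        = (\<Sum>i\<in>{..<?r} - {a}. \<Sum>x<\<mu> ! i. v (int (Suc x)))"
      by (rule sum.cong) (auto simp: remove_cell_def)
    ultimately show ?thesis
      by (simp add: sum.remove[of "{..<?r}" a] remove_cell_def ac_simps)
  qed
  have below: "{j. j < ?r \<and> ?b j < ?b a} = {a<..<?r}" if "a < ?r" for a
    using beta_number_strict[OF Suc.prems(1)] that
    by (auto simp: not_less intro: leI) (metis less_imp_not_less linorder_neqE_nat)
  have "(\<Sum>t\<in>standard_tableaux \<mu>. inversion_weight v \<mu> t)
      = (\<Sum>a\<in>removable \<mu>. \<Sum>s\<in>standard_tableaux (remove_cell \<mu> a).
          inversion_weight v \<mu> (s(row_end \<mu> a := sum_list \<mu>)))"
    using Suc.hyps(2) by (intro sum_standard_tableaux Suc.prems) simp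
  also have "\<dots> = (\<Sum>a\<in>removable \<mu>. \<Sum>s\<in>standard_tableaux (remove_cell \<mu> a).
      inversion_weight v (remove_cell \<mu> a) s + (\<delta> a + (v (?b a) + v (int (\<mu> ! a)))))"
    unfolding \<delta>_def by (intro sum.cong refl inversion_weight_remove_cell Suc.prems)
  also have "\<dots> = (\<Sum>a\<in>removable \<mu>. ?Q a + ?\<kappa> (remove_cell \<mu> a) * ?N a + ?N a * (\<delta> a + (v (?b a) + v (int (\<mu> ! a)))))"
    by (intro sum.cong refl) (simp only: sum.distrib sum_constant IH card distrib_left)
  \<comment> \<open>The term \<open>v (int (\<mu> ! a))\<close> completes the correction for the
    smaller shape to the one for \<open>\<mu>\<close>, which no longer depends on
    \<open>a\<close>.\<close>
  also have "\<dots> = (\<Sum>a\<in>removable \<mu>. (?Q a + (v (?b a) * ?N a + \<delta> a * ?N a)) + ?\<kappa> \<mu> * ?N a)"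
    by (intro sum.cong refl) (simp only: \<kappa> algebra_simps)
  also have "\<dots> = ((\<Sum>a\<in>removable \<mu>. ?Q a) + ((\<Sum>a\<in>removable \<mu>. v (?b a) * ?N a) + (\<Sum>a\<in>removable \<mu>. \<delta> a * ?N a)))
      + ?\<kappa> \<mu> * (\<Sum>a\<in>removable \<mu>. 1 * ?N a)"
    by (simp only: sum.distrib sum_distrib_left mult_1)
  also have "(\<Sum>a\<in>removable \<mu>. 1 * ?N a) = beta_count ?r (Suc n) ?b"
    unfolding beta_count_sum_removable[OF Suc.prems(1), symmetric] by simp
  also have "(\<Sum>a\<in>removable \<mu>. ?Q a) + ((\<Sum>a\<in>removable \<mu>. v (?b a) * ?N a) + (\<Sum>a\<in>removable \<mu>. \<delta> a * ?N a))
      = transfer_sum v ?r (Suc n) ?b"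
  proof -
    \<comment> \<open>The empty row \<open>z\<close> must be kept beside the removable ones: its
      lowered entry is negative, which kills the count but not the transfers.\<close>
    have "(\<Sum>a<?r. transfer_sum v ?r n (?b(a := ?b a - 1)))
        = (\<Sum>a\<in>insert z (removable \<mu>). transfer_sum v ?r n (?b(a := ?b a - 1)))"
    proof (rule sum.mono_neutral_right)
      show "insert z (removable \<mu>) \<subseteq> {..<?r}"
        using z by (auto simp: removable_def)
      show "\<forall>a\<in>{..<?r} - insert z (removable \<mu>). transfer_sum v ?r n (?b(a := ?b a - 1)) = 0"
      proof
        fix a assume a: "a \<in> {..<?r} - insert z (removable \<mu>)"
        then have "a < ?r" "a \<notin> removable \<mu>" "Suc a \<noteq> ?r"
          by (auto simp: z_def)
        then obtain k l where "k < ?r" "l < ?r" "k \<noteq> l" "(?b(a := ?b a - 1)) k = (?b(a := ?b a - 1)) l"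
          using beta_count_not_removable[OF Suc.prems(1), of a] by blast
        then show "transfer_sum v ?r n (?b(a := ?b a - 1)) = 0"
          by (rule transfer_sum_not_inj[where v = v, OF even])
      qed
    qed simp
    also have "\<dots> = transfer_sum v ?r n (?b(z := ?b z - 1)) + (\<Sum>a\<in>removable \<mu>. transfer_sum v ?r n (?b(a := ?b a - 1)))"
      using \<mu>z by (intro sum.insert finite_removable) (auto simp: removable_def)
    also have "(\<Sum>a\<in>removable \<mu>. transfer_sum v ?r n (?b(a := ?b a - 1))) = (\<Sum>a\<in>removable \<mu>. ?Q a)"
      by (simp only: beta_number_remove_cell cong: sum.cong)
    also have "transfer_sum v ?r n (?b(z := ?b z - 1)) = (\<Sum>a\<in>{..<?r} - {z}. v (?b a) * beta_count ?r n (?b(a := ?b a - 1)))"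
      using transfer_sum_lower_zero[where v = v, OF even v1 beta_number_inj[OF Suc.prems(1)] beta_number_nonneg z bz, of n]
        Suc.prems(2) Suc.hyps(2) bz by simp
    also have "\<dots> = (\<Sum>a<?r. v (?b a) * beta_count ?r n (?b(a := ?b a - 1)))"
    proof (rule sum.mono_neutral_left)
      have "beta_count ?r n (?b(z := ?b z - 1)) = 0"
        using z bz by (intro beta_count_neg[of z]) auto
      then show "\<forall>a\<in>{..<?r} - ({..<?r} - {z}). v (?b a) * beta_count ?r n (?b(a := ?b a - 1)) = 0"
        by auto
    qed auto
    also have "\<dots> = (\<Sum>a\<in>removable \<mu>. v (?b a) * ?N a)"
      by (rule beta_count_sum_removable[OF Suc.prems(1)])
    finally have 1: "(\<Sum>a<?r. transfer_sum v ?r n (?b(a := ?b a - 1)))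
        = (\<Sum>a\<in>removable \<mu>. v (?b a) * ?N a) + (\<Sum>a\<in>removable \<mu>. ?Q a)" .
    have "(\<Sum>i<?r. \<Sum>j | j < ?r \<and> ?b j < ?b i. (v (?b i - ?b j - 1) + v (?b i - ?b j)) * beta_count ?r n (?b(i := ?b i - 1)))
        = (\<Sum>i<?r. \<delta> i * beta_count ?r n (?b(i := ?b i - 1)))"
      by (intro sum.cong refl) (simp only: below lessThan_iff sum_distrib_right \<delta>_def)
    also have "\<dots> = (\<Sum>i\<in>removable \<mu>. \<delta> i * ?N i)"
      by (rule beta_count_sum_removable[OF Suc.prems(1)])
    finally show ?thesis
      unfolding transfer_sum_Suc[where v = v, OF even beta_number_inj[OF Suc.prems(1)]] 1 by (simp only: ac_simps)
  qed
  finally show ?case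
    unfolding Suc.hyps(2)[symmetric] .
qed

section \<open>The 2-adic valuation of the product over the inversions\<close>

definition inversion_product :: "nat list \<Rightarrow> tableau \<Rightarrow> int" where
  "inversion_product \<mu> t = (\<Prod>(x, y)\<in>inversions \<mu> t. (cell_content x - cell_content y)\<^sup>2 - 1)"

lemma inversion_product_pos:
  assumes "t \<in> standard_tableaux \<mu>" "sorted_wrt (\<ge>) \<mu>"
  shows "0 < inversion_product \<mu> t"
  unfolding inversion_product_def
proof (intro prod_pos ballI, clarify)
  fix a b a' b' assume "((a, b), (a', b')) \<in> inversions \<mu> t"
  from inversion_content[OF assms this] have "2\<^sup>2 \<le> (cell_content (a, b) - cell_content (a', b'))\<^sup>2"
    by (intro power_mono) auto
  then show "0 < (cell_content (a, b) - cell_content (a', b'))\<^sup>2 - 1"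
    by simp
qed

lemma multiplicity_inversion_product:
  assumes "t \<in> standard_tableaux \<mu>" "sorted_wrt (\<ge>) \<mu>"
  shows "of_nat (multiplicity 2 (inversion_product \<mu> t)) = inversion_weight (\<lambda>h. of_nat (multiplicity 2 h) :: bit) \<mu> t"
proof -
  have two: "prime_elem (2::int)"
    by (metis of_nat_numeral prime_imp_prime_elem prime_nat_int_transfer two_is_prime_nat)
  have nz: "(case p of (x, y) \<Rightarrow> (cell_content x - cell_content y)\<^sup>2 - 1) \<noteq> 0 \<and>
      multiplicity 2 (case p of (x, y) \<Rightarrow> (cell_content x - cell_content y)\<^sup>2 - 1) =
      (case p of (x, y) \<Rightarrow> multiplicity 2 (cell_content x - cell_content y - 1) + multiplicity 2 (cell_content x - cell_content y + 1))"
    if "p \<in> inversions \<mu> t" for p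
  proof -
    obtain x y where p: "p = (x, y)"
      by (cases p)
    have d: "2 \<le> cell_content x - cell_content y"
      using inversion_content[OF assms] that by (simp add: p)
    have "(cell_content x - cell_content y)\<^sup>2 - 1 = (cell_content x - cell_content y - 1) * (cell_content x - cell_content y + 1)"
      by (simp add: power2_eq_square algebra_simps)
    moreover have "cell_content x - cell_content y - 1 \<noteq> 0" "cell_content x - cell_content y + 1 \<noteq> 0"
      using d by auto
    moreover from this have "multiplicity 2 ((cell_content x - cell_content y - 1) * (cell_content x - cell_content y + 1))
        = multiplicity 2 (cell_content x - cell_content y - 1) + multiplicity 2 (cell_content x - cell_content y + 1)"
      by (rule prime_elem_multiplicity_mult_distrib[OF two])
    ultimately show ?thesis
      by (simp only: p case_prod_conv) auto
  qed
  have "multiplicity 2 (inversion_product \<mu> t)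
      = (\<Sum>p\<in>inversions \<mu> t. multiplicity 2 (case p of (x, y) \<Rightarrow> (cell_content x - cell_content y)\<^sup>2 - 1))"
    unfolding inversion_product_def using nz finite_inversions
    by (intro prime_elem_multiplicity_prod_distrib) auto
  also have "\<dots> = (\<Sum>(x, y)\<in>inversions \<mu> t. multiplicity 2 (cell_content x - cell_content y - 1) + multiplicity 2 (cell_content x - cell_content y + 1))"
    using nz by (intro sum.cong) auto
  finally show ?thesis
    by (simp add: inversion_weight_def case_prod_beta)
qed

lemma diagram_append_zeros: "diagram (\<mu> @ replicate k 0) = diagram \<mu>"
  by (auto simp: diagram_def nth_append split: if_splits)

text \<open>The parity is the sum of all inversion weights, that is a transfer sum plus a multiple
  of the count. The count is even by assumption, and then the transfer sum vanishes as well.\<close>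

lemma even_multiplicity_prod_inversion_product:
  assumes sorted: "sorted_wrt (\<ge>) \<mu>" and "even (card (standard_tableaux \<mu>))"
  shows "even (multiplicity 2 (\<Prod>t\<in>standard_tableaux \<mu>. inversion_product \<mu> t))"
proof -
  \<comment> \<open>The beta number count is stable under adding empty rows, and with more than \<open>sum_list \<mu>\<close>
    rows the low beta numbers are all occupied.\<close>
  define \<nu> where "\<nu> = \<mu> @ replicate (Suc (sum_list \<mu>)) 0"
  let ?v = "\<lambda>h :: int. of_nat (multiplicity 2 h) :: bit"
  have D: "diagram \<nu> = diagram \<mu>" and sum: "sum_list \<nu> = sum_list \<mu>"
    unfolding \<nu>_def diagram_append_zeros by (simp_all add: sum_list_replicate)
  have ST: "standard_tableaux \<nu> = standard_tableaux \<mu>"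
    by (simp add: standard_tableaux_def tableaux_def D sum)
  have inv: "inversions \<nu> = inversions \<mu>"
    by (simp add: inversions_def D fun_eq_iff)
  have \<nu>: "sorted_wrt (\<ge>) \<nu>" "sum_list \<nu> < length \<nu>"
  proof -
    have "sorted_wrt (\<ge>) (replicate k (0::nat))" for k
      by (induction k) auto
    then show "sorted_wrt (\<ge>) \<nu>" "sum_list \<nu> < length \<nu>"
      unfolding \<nu>_def sorted_wrt_append using sorted by (auto simp: sum_list_replicate)
  qed
  have "beta_count (length \<nu>) (sum_list \<nu>) (beta_number \<nu>) = 0"
    using assms(2) card_standard_tableaux_bit[OF \<nu>(1)] by (auto simp: ST elim!: evenE)
  moreover from this have "transfer_sum ?v (length \<nu>) (sum_list \<nu>) (beta_number \<nu>) = 0"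
    using \<nu> by (intro transfer_sum_multiplicity_eq_0 beta_number_inj beta_number_nonneg) auto
  moreover have "?v (- h) = ?v h" "?v 1 = 0" for h
    using multiplicity_times_unit_right[of "- 1" "2::int" h] by simp_all
  ultimately have "(\<Sum>t\<in>standard_tableaux \<mu>. inversion_weight ?v \<mu> t) = 0"
    using sum_inversion_weight[where v = ?v, OF _ _ \<nu>] by (simp add: ST inv inversion_weight_def)
  moreover have "multiplicity 2 (\<Prod>t\<in>standard_tableaux \<mu>. inversion_product \<mu> t)
      = (\<Sum>t\<in>standard_tableaux \<mu>. multiplicity 2 (inversion_product \<mu> t))"
  proof (intro prime_elem_multiplicity_prod_distrib finite_standard_tableaux)
    show "prime_elem (2::int)"
      by (metis of_nat_numeral prime_imp_prime_elem prime_nat_int_transfer two_is_prime_nat)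
  qed (use inversion_product_pos[OF _ sorted] in force)
  ultimately have "of_nat (multiplicity 2 (\<Prod>t\<in>standard_tableaux \<mu>. inversion_product \<mu> t)) = (0 :: bit)"
    using multiplicity_inversion_product[OF _ sorted] by simp
  then show ?thesis
    by (metis even_of_nat even_zero)
qed

section \<open>Tabloids and polytabloids\<close>

abbreviation entry_perm :: "nat list \<Rightarrow> (nat \<Rightarrow> nat) \<Rightarrow> bool" where
  "entry_perm \<mu> \<pi> \<equiv> \<pi> permutes {1..sum_list \<mu>}"

abbreviation perm_inv :: "(nat \<Rightarrow> nat) \<Rightarrow> nat \<Rightarrow> nat" where
  "perm_inv \<equiv> inv_into UNIV"

lemma act_apply: "x \<in> diagram \<mu> \<Longrightarrow> act \<mu> \<pi> t x = \<pi> (t x)"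
  by (simp add: act_def)

lemma act_image: "A \<subseteq> diagram \<mu> \<Longrightarrow> act \<mu> \<pi> t ` A = \<pi> ` t ` A"
  by (force simp: act_def image_iff subset_iff)

lemma row_subset: "row \<mu> i \<subseteq> diagram \<mu>"
  by (auto simp: row_def)

lemma column_subset: "column \<mu> j \<subseteq> diagram \<mu>"
  by (auto simp: column_def)

lemma act_tableau:
  assumes "t \<in> tableaux \<mu>" "entry_perm \<mu> \<pi>"
  shows "act \<mu> \<pi> t \<in> tableaux \<mu>"
proof -
  have "bij_betw (\<pi> \<circ> t) (diagram \<mu>) {1..sum_list \<mu>}"
    using tableau_bij[OF assms(1)] permutes_imp_bij[OF assms(2)] by (rule bij_betw_trans)
  then have "bij_betw (act \<mu> \<pi> t) (diagram \<mu>) {1..sum_list \<mu>}"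
    by (subst bij_betw_cong[of _ _ "\<pi> \<circ> t"]) (auto simp: act_def)
  then show ?thesis
    by (simp add: tableaux_def act_def)
qed

lemma act_act: "act \<mu> \<pi> (act \<mu> \<sigma> t) = act \<mu> (\<pi> \<circ> \<sigma>) t"
  by (auto simp: act_def restrict_def)

lemma tableau_ext:
  assumes "s \<in> tableaux \<mu>" "t \<in> tableaux \<mu>" "\<And>x. x \<in> diagram \<mu> \<Longrightarrow> s x = t x"
  shows "s = t"
  using assms by (auto simp: tableaux_def intro: extensionalityI)

lemma act_id: "t \<in> tableaux \<mu> \<Longrightarrow> act \<mu> id t = t"
  by (rule tableau_ext[of _ \<mu>]) (auto simp: act_apply intro: act_tableau permutes_id)

lemma act_inv_act:
  assumes "t \<in> tableaux \<mu>" "entry_perm \<mu> \<pi>"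
  shows "act \<mu> (perm_inv \<pi>) (act \<mu> \<pi> t) = t" "act \<mu> \<pi> (act \<mu> (perm_inv \<pi>) t) = t"
  using assms permutes_inv_o[OF assms(2)] by (simp_all add: act_act act_id)

lemma ex_act:
  assumes s: "s \<in> tableaux \<mu>" and t: "t \<in> tableaux \<mu>"
  obtains \<pi> where "entry_perm \<mu> \<pi>" "s = act \<mu> \<pi> t"
proof -
  let ?D = "diagram \<mu>" and ?N = "{1..sum_list \<mu>}"
  define \<pi> where "\<pi> k = (if k \<in> ?N then s (inv_into ?D t k) else k)" for k
  have "bij_betw (s \<circ> inv_into ?D t) ?N ?N"
    using bij_betw_inv_into[OF tableau_bij[OF t]] tableau_bij[OF s] by (rule bij_betw_trans)
  then have "bij_betw \<pi> ?N ?N"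
    by (subst bij_betw_cong[of _ _ "s \<circ> inv_into ?D t"]) (auto simp: \<pi>_def)
  then have "entry_perm \<mu> \<pi>"
    by (rule bij_imp_permutes) (auto simp: \<pi>_def)
  moreover from this have "s = act \<mu> \<pi> t"
    using s t tableau_range[OF t] inv_into_f_f[OF tableau_inj[OF t]]
    by (intro tableau_ext[of _ \<mu>] act_tableau) (auto simp: act_apply \<pi>_def)
  ultimately show ?thesis
    using that by blast
qed

text \<open>Positions are read off from the entries, so that equality of tabloids and membership in
  a column stabilizer become conditions on each single entry, which a permutation merely
  relabels.\<close>

definition entry_row :: "nat list \<Rightarrow> tableau \<Rightarrow> nat \<Rightarrow> nat" where
  "entry_row \<mu> t k = fst (inv_into (diagram \<mu>) t k)"

definition entry_col :: "nat list \<Rightarrow> tableau \<Rightarrow> nat \<Rightarrow> nat" where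
  "entry_col \<mu> t k = snd (inv_into (diagram \<mu>) t k)"

lemma inv_into_tableau: "t \<in> tableaux \<mu> \<Longrightarrow> x \<in> diagram \<mu> \<Longrightarrow> inv_into (diagram \<mu>) t (t x) = x"
  by (simp add: inv_into_f_f tableau_inj)

lemma entry_row_tableau: "t \<in> tableaux \<mu> \<Longrightarrow> x \<in> diagram \<mu> \<Longrightarrow> entry_row \<mu> t (t x) = fst x"
  and entry_col_tableau: "t \<in> tableaux \<mu> \<Longrightarrow> x \<in> diagram \<mu> \<Longrightarrow> entry_col \<mu> t (t x) = snd x"
  by (simp_all add: entry_row_def entry_col_def inv_into_tableau)

lemma tableau_cell:
  assumes "t \<in> tableaux \<mu>" "k \<in> {1..sum_list \<mu>}"
  obtains x where "x \<in> diagram \<mu>" "t x = k"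
proof -
  have "k \<in> t ` diagram \<mu>"
    using assms(2) bij_betw_imp_surj_on[OF tableau_bij[OF assms(1)]] by simp
  then show ?thesis
    using that by blast
qed

lemma image_row:
  assumes "t \<in> tableaux \<mu>"
  shows "t ` row \<mu> i = {k \<in> {1..sum_list \<mu>}. entry_row \<mu> t k = i}"
proof (intro equalityI subsetI)
  fix k assume "k \<in> {k \<in> {1..sum_list \<mu>}. entry_row \<mu> t k = i}"
  then obtain x where x: "x \<in> diagram \<mu>" "t x = k" "entry_row \<mu> t k = i"
    using tableau_cell[OF assms] by blast
  then have "x \<in> row \<mu> i"
    using entry_row_tableau[OF assms x(1)] by (simp add: row_def)
  with x(2) show "k \<in> t ` row \<mu> i"
    by blast
qed (use tableau_range[OF assms] entry_row_tableau[OF assms] in \<open>auto simp: row_def\<close>)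

lemma image_column:
  assumes "t \<in> tableaux \<mu>"
  shows "t ` column \<mu> j = {k \<in> {1..sum_list \<mu>}. entry_col \<mu> t k = j}"
proof (intro equalityI subsetI)
  fix k assume "k \<in> {k \<in> {1..sum_list \<mu>}. entry_col \<mu> t k = j}"
  then obtain x where x: "x \<in> diagram \<mu>" "t x = k" "entry_col \<mu> t k = j"
    using tableau_cell[OF assms] by blast
  then have "x \<in> column \<mu> j"
    using entry_col_tableau[OF assms x(1)] by (simp add: column_def)
  with x(2) show "k \<in> t ` column \<mu> j"
    by blast
qed (use tableau_range[OF assms] entry_col_tableau[OF assms] in \<open>auto simp: column_def\<close>)

lemma inv_into_act:
  assumes "t \<in> tableaux \<mu>" "entry_perm \<mu> \<pi>" "k \<in> {1..sum_list \<mu>}"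
  shows "inv_into (diagram \<mu>) (act \<mu> \<pi> t) (\<pi> k) = inv_into (diagram \<mu>) t k"
proof -
  obtain x where x: "x \<in> diagram \<mu>" "t x = k"
    using tableau_cell[OF assms(1,3)] .
  then have "\<pi> k = act \<mu> \<pi> t x"
    by (simp add: act_apply)
  then show ?thesis
    using inv_into_tableau[OF act_tableau[OF assms(1,2)] x(1)] inv_into_tableau[OF assms(1) x(1)] x(2) by simp
qed

lemma entry_row_act:
  assumes "t \<in> tableaux \<mu>" "entry_perm \<mu> \<pi>" "k \<in> {1..sum_list \<mu>}"
  shows "entry_row \<mu> (act \<mu> \<pi> t) (\<pi> k) = entry_row \<mu> t k"
  by (simp only: entry_row_def inv_into_act[OF assms])

lemma entry_col_act:
  assumes "t \<in> tableaux \<mu>" "entry_perm \<mu> \<pi>" "k \<in> {1..sum_list \<mu>}"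
  shows "entry_col \<mu> (act \<mu> \<pi> t) (\<pi> k) = entry_col \<mu> t k"
  by (simp only: entry_col_def inv_into_act[OF assms])

definition row_equiv :: "nat list \<Rightarrow> tableau \<Rightarrow> tableau \<Rightarrow> bool" where
  "row_equiv \<mu> s t \<longleftrightarrow> (\<forall>k\<in>{1..sum_list \<mu>}. entry_row \<mu> s k = entry_row \<mu> t k)"

lemma row_equiv_iff_rows:
  assumes "s \<in> tableaux \<mu>" "t \<in> tableaux \<mu>"
  shows "row_equiv \<mu> s t \<longleftrightarrow> (\<forall>i. s ` row \<mu> i = t ` row \<mu> i)"
proof
  assume "row_equiv \<mu> s t"
  then show "\<forall>i. s ` row \<mu> i = t ` row \<mu> i"
    unfolding image_row[OF assms(1)] image_row[OF assms(2)] row_equiv_def by auto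
next
  assume rows: "\<forall>i. s ` row \<mu> i = t ` row \<mu> i"
  show "row_equiv \<mu> s t"
    unfolding row_equiv_def
  proof
    fix k assume "k \<in> {1..sum_list \<mu>}"
    then have "k \<in> s ` row \<mu> (entry_row \<mu> s k)"
      unfolding image_row[OF assms(1)] by simp
    then have "k \<in> t ` row \<mu> (entry_row \<mu> s k)"
      using rows by simp
    then show "entry_row \<mu> s k = entry_row \<mu> t k"
      unfolding image_row[OF assms(2)] by simp
  qed
qed

lemma tabloid_alt:
  assumes t: "t \<in> tableaux \<mu>"
  shows "tabloid \<mu> t = {s \<in> tableaux \<mu>. row_equiv \<mu> s t}"
proof -
  have iff: "\<pi> \<in> row_stabilizer \<mu> t \<longleftrightarrow> entry_perm \<mu> \<pi> \<and> row_equiv \<mu> (act \<mu> \<pi> t) t" for \<pi>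
    using row_equiv_iff_rows[OF act_tableau[OF t] t, of \<pi>]
    by (auto simp only: row_stabilizer_def act_image[OF row_subset] mem_Collect_eq)
  show ?thesis
  proof (intro equalityI subsetI)
    fix s assume "s \<in> tabloid \<mu> t"
    then show "s \<in> {s \<in> tableaux \<mu>. row_equiv \<mu> s t}"
      unfolding tabloid_def using act_tableau[OF t] iff by blast
  next
    fix s assume "s \<in> {s \<in> tableaux \<mu>. row_equiv \<mu> s t}"
    then have s: "s \<in> tableaux \<mu>" "row_equiv \<mu> s t"
      by auto
    obtain \<pi> where "entry_perm \<mu> \<pi>" "s = act \<mu> \<pi> t"
      using ex_act[OF s(1) t] .
    with s show "s \<in> tabloid \<mu> t"
      unfolding tabloid_def using iff by blast
  qed
qed

lemma row_equiv_refl: "row_equiv \<mu> t t"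
  by (simp add: row_equiv_def)

lemma tabloid_eq_iff:
  assumes "s \<in> tableaux \<mu>" "t \<in> tableaux \<mu>"
  shows "tabloid \<mu> s = tabloid \<mu> t \<longleftrightarrow> row_equiv \<mu> s t"
proof
  assume "tabloid \<mu> s = tabloid \<mu> t"
  then have "s \<in> tabloid \<mu> t"
    using tabloid_alt[OF assms(1)] assms(1) row_equiv_refl by blast
  then show "row_equiv \<mu> s t"
    using tabloid_alt[OF assms(2)] by blast
next
  assume "row_equiv \<mu> s t"
  then have "row_equiv \<mu> u s \<longleftrightarrow> row_equiv \<mu> u t" for u
    by (simp add: row_equiv_def)
  then show "tabloid \<mu> s = tabloid \<mu> t"
    unfolding tabloid_alt[OF assms(1)] tabloid_alt[OF assms(2)] by simp
qed

lemma tabloid_act_eq_iff: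
  assumes s: "s \<in> tableaux \<mu>" and t: "t \<in> tableaux \<mu>" and \<pi>: "entry_perm \<mu> \<pi>"
  shows "tabloid \<mu> (act \<mu> \<pi> s) = tabloid \<mu> (act \<mu> \<pi> t) \<longleftrightarrow> tabloid \<mu> s = tabloid \<mu> t"
proof -
  have "(\<forall>k\<in>{1..sum_list \<mu>}. entry_row \<mu> (act \<mu> \<pi> s) k = entry_row \<mu> (act \<mu> \<pi> t) k)
    \<longleftrightarrow> (\<forall>k\<in>\<pi> ` {1..sum_list \<mu>}. entry_row \<mu> (act \<mu> \<pi> s) k = entry_row \<mu> (act \<mu> \<pi> t) k)"
    using permutes_image[OF \<pi>] by simp
  also have "\<dots> \<longleftrightarrow> (\<forall>k\<in>{1..sum_list \<mu>}. entry_row \<mu> s k = entry_row \<mu> t k)"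
    by (simp only: ball_simps entry_row_act[OF s \<pi>] entry_row_act[OF t \<pi>] cong: ball_cong)
  finally show ?thesis
    unfolding tabloid_eq_iff[OF s t] tabloid_eq_iff[OF act_tableau[OF s \<pi>] act_tableau[OF t \<pi>]] row_equiv_def .
qed

lemma tabloid_act:
  assumes t: "t \<in> tableaux \<mu>" and \<pi>: "entry_perm \<mu> \<pi>"
  shows "act \<mu> \<pi> ` tabloid \<mu> t = tabloid \<mu> (act \<mu> \<pi> t)"
proof -
  have mem: "u \<in> tabloid \<mu> t \<longleftrightarrow> u \<in> tableaux \<mu> \<and> tabloid \<mu> u = tabloid \<mu> t"
    if "t \<in> tableaux \<mu>" for t u
    using tabloid_alt[OF that] tabloid_eq_iff[OF _ that] by blast
  note t' = act_tableau[OF t \<pi>]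
  show ?thesis
  proof (intro equalityI subsetI)
    fix s assume "s \<in> act \<mu> \<pi> ` tabloid \<mu> t"
    then obtain u where u: "s = act \<mu> \<pi> u" "u \<in> tabloid \<mu> t"
      by (rule imageE)
    then have u': "u \<in> tableaux \<mu>" "tabloid \<mu> u = tabloid \<mu> t"
      using mem[OF t] by auto
    then show "s \<in> tabloid \<mu> (act \<mu> \<pi> t)"
      unfolding mem[OF t'] u(1) using act_tableau[OF u'(1) \<pi>] tabloid_act_eq_iff[OF u'(1) t \<pi>] by simp
  next
    fix s assume "s \<in> tabloid \<mu> (act \<mu> \<pi> t)"
    then have s: "s \<in> tableaux \<mu>" "tabloid \<mu> s = tabloid \<mu> (act \<mu> \<pi> t)"
      using mem[OF t'] by auto
    let ?s = "act \<mu> (perm_inv \<pi>) s"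
    have s': "?s \<in> tableaux \<mu>" "act \<mu> \<pi> ?s = s"
      using act_tableau[OF s(1) permutes_inv[OF \<pi>]] act_inv_act(2)[OF s(1) \<pi>] by auto
    then have "tabloid \<mu> ?s = tabloid \<mu> t"
      using tabloid_act_eq_iff[OF s'(1) t \<pi>] s(2) by simp
    then have "?s \<in> tabloid \<mu> t"
      using mem[OF t] s'(1) by blast
    then show "s \<in> act \<mu> \<pi> ` tabloid \<mu> t"
      using s'(2) by (metis imageI)
  qed
qed

section \<open>The permutation module and its invariant form\<close>

definition perm_module :: "nat list \<Rightarrow> (tabloid \<Rightarrow> rat) set" where
  "perm_module \<mu> = {x. \<forall>X. X \<notin> tabloids \<mu> \<longrightarrow> x X = 0}"

text \<open>Pulling back along the inverse moves the basis vector of a tabloid by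
  \<open>\<pi>\<close>. The explicit 0 places the result in \<open>perm_module \<mu>\<close> for
  every argument.\<close>

definition perm_act :: "nat list \<Rightarrow> (nat \<Rightarrow> nat) \<Rightarrow> (tabloid \<Rightarrow> rat) \<Rightarrow> tabloid \<Rightarrow> rat" where
  "perm_act \<mu> \<pi> x = (\<lambda>X. if X \<in> tabloids \<mu> then x (act \<mu> (perm_inv \<pi>) ` X) else 0)"

lemma tabloid_in_tabloids: "t \<in> tableaux \<mu> \<Longrightarrow> tabloid \<mu> t \<in> tabloids \<mu>"
  by (simp add: tabloids_def)

lemma perm_act_in: "perm_act \<mu> \<pi> x \<in> perm_module \<mu>"
  by (simp add: perm_act_def perm_module_def)

lemma perm_act_tabloid:
  "t \<in> tableaux \<mu> \<Longrightarrow> entry_perm \<mu> \<pi> \<Longrightarrow> perm_act \<mu> \<pi> x (tabloid \<mu> t) = x (tabloid \<mu> (act \<mu> (perm_inv \<pi>) t))"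
  by (simp add: perm_act_def tabloid_in_tabloids tabloid_act permutes_inv)

lemma perm_act_tabloid':
  "t \<in> tableaux \<mu> \<Longrightarrow> entry_perm \<mu> \<pi> \<Longrightarrow> perm_act \<mu> \<pi> x (tabloid \<mu> (act \<mu> \<pi> t)) = x (tabloid \<mu> t)"
  by (simp only: perm_act_tabloid[OF act_tableau] act_inv_act)

lemma perm_module_eqI:
  assumes "x \<in> perm_module \<mu>" "y \<in> perm_module \<mu>"
    "\<And>t. t \<in> tableaux \<mu> \<Longrightarrow> x (tabloid \<mu> t) = y (tabloid \<mu> t)"
  shows "x = y"
proof
  fix X
  show "x X = y X"
    using assms by (cases "X \<in> tabloids \<mu>") (auto simp: perm_module_def tabloids_def)
qed

lemma perm_act_comp:
  assumes "entry_perm \<mu> \<pi>" "entry_perm \<mu> \<sigma>"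
  shows "perm_act \<mu> \<pi> (perm_act \<mu> \<sigma> x) = perm_act \<mu> (\<pi> \<circ> \<sigma>) x"
proof (rule perm_module_eqI[of _ \<mu>])
  fix t assume t: "t \<in> tableaux \<mu>"
  have "perm_inv (\<pi> \<circ> \<sigma>) = perm_inv \<sigma> \<circ> perm_inv \<pi>"
    using assms by (intro o_inv_distrib permutes_bij)
  then show "perm_act \<mu> \<pi> (perm_act \<mu> \<sigma> x) (tabloid \<mu> t) = perm_act \<mu> (\<pi> \<circ> \<sigma>) x (tabloid \<mu> t)"
    unfolding perm_act_tabloid[OF t assms(1)] perm_act_tabloid[OF t permutes_compose[OF assms(2,1)]]
      perm_act_tabloid[OF act_tableau[OF t permutes_inv[OF assms(1)]] assms(2)] act_act by simp
qed (rule perm_act_in)+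

lemma perm_act_id: "x \<in> perm_module \<mu> \<Longrightarrow> perm_act \<mu> id x = x"
proof (rule perm_module_eqI[of _ \<mu>])
  fix t assume "t \<in> tableaux \<mu>"
  then show "perm_act \<mu> id x (tabloid \<mu> t) = x (tabloid \<mu> t)"
    by (simp only: perm_act_tabloid permutes_id inv_id act_id)
qed (rule perm_act_in)

lemma perm_act_add: "perm_act \<mu> \<pi> (x + y) = perm_act \<mu> \<pi> x + perm_act \<mu> \<pi> y"
  by (auto simp: perm_act_def fun_eq_iff)

lemma perm_act_diff: "perm_act \<mu> \<pi> (x - y) = perm_act \<mu> \<pi> x - perm_act \<mu> \<pi> y"
  by (auto simp: perm_act_def fun_eq_iff)

lemma perm_act_scale: "perm_act \<mu> \<pi> (\<lambda>X. c * x X) = (\<lambda>X. c * perm_act \<mu> \<pi> x X)"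
  by (auto simp: perm_act_def fun_eq_iff)

lemma perm_act_zero: "perm_act \<mu> \<pi> 0 = 0"
  by (auto simp: perm_act_def fun_eq_iff)

lemma perm_act_sum: "perm_act \<mu> \<pi> (\<Sum>a\<in>A. f a) = (\<Sum>a\<in>A. perm_act \<mu> \<pi> (f a))"
  by (induction A rule: infinite_finite_induct)
    (simp_all only: sum.infinite sum.empty sum.insert perm_act_add perm_act_zero not_False_eq_True)

lemma finite_tabloids: "finite (tabloids \<mu>)"
  by (simp add: tabloids_def finite_tableaux)

lemma tabloid_form_perm_act:
  assumes \<pi>: "entry_perm \<mu> \<pi>"
  shows "tabloid_form \<mu> (perm_act \<mu> \<pi> x) (perm_act \<mu> \<pi> y) = tabloid_form \<mu> x y"
proof -
  have in1: "act \<mu> \<sigma> ` X \<in> tabloids \<mu>" if X: "X \<in> tabloids \<mu>" and \<sigma>: "entry_perm \<mu> \<sigma>" for X \<sigma>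
  proof -
    obtain t where t: "t \<in> tableaux \<mu>" and X: "X = tabloid \<mu> t"
      using X unfolding tabloids_def by (rule imageE)
    show ?thesis
      unfolding X tabloid_act[OF t \<sigma>] by (rule tabloid_in_tabloids[OF act_tableau[OF t \<sigma>]])
  qed
  have inv1: "act \<mu> \<pi> ` act \<mu> (perm_inv \<pi>) ` X = X" "act \<mu> (perm_inv \<pi>) ` act \<mu> \<pi> ` X = X" if X: "X \<in> tabloids \<mu>" for X
  proof -
    obtain t where t: "t \<in> tableaux \<mu>" and X: "X = tabloid \<mu> t"
      using X unfolding tabloids_def by blast
    note p' = permutes_inv[OF \<pi>]
    show "act \<mu> \<pi> ` act \<mu> (perm_inv \<pi>) ` X = X" "act \<mu> (perm_inv \<pi>) ` act \<mu> \<pi> ` X = X"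
      unfolding X tabloid_act[OF t p'] tabloid_act[OF t \<pi>] tabloid_act[OF act_tableau[OF t p'] \<pi>]
        tabloid_act[OF act_tableau[OF t \<pi>] p'] act_inv_act[OF t \<pi>] by (rule refl)+
  qed
  have "tabloid_form \<mu> (perm_act \<mu> \<pi> x) (perm_act \<mu> \<pi> y)
      = (\<Sum>X\<in>tabloids \<mu>. x (act \<mu> (perm_inv \<pi>) ` X) * y (act \<mu> (perm_inv \<pi>) ` X))"
    by (simp add: tabloid_form_def perm_act_def)
  also have "\<dots> = (\<Sum>X\<in>tabloids \<mu>. x X * y X)"
    by (rule sum.reindex_bij_witness[where i = "\<lambda>X. act \<mu> \<pi> ` X" and j = "\<lambda>X. act \<mu> (perm_inv \<pi>) ` X"])
      (simp_all only: inv1 in1 \<pi> permutes_inv[OF \<pi>])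
  finally show ?thesis
    by (simp add: tabloid_form_def)
qed

lemma tabloid_form_commute: "tabloid_form \<mu> x y = tabloid_form \<mu> y x"
  by (simp add: tabloid_form_def mult.commute)

lemma tabloid_form_add_left: "tabloid_form \<mu> (x + y) z = tabloid_form \<mu> x z + tabloid_form \<mu> y z"
  by (simp add: tabloid_form_def sum.distrib distrib_right)

lemma tabloid_form_scale_left: "tabloid_form \<mu> (\<lambda>X. c * x X) z = c * tabloid_form \<mu> x z"
  by (simp add: tabloid_form_def sum_distrib_left mult.assoc)

lemma tabloid_form_sum_left: "tabloid_form \<mu> (\<Sum>a\<in>A. f a) z = (\<Sum>a\<in>A. tabloid_form \<mu> (f a) z)"
proof (induction A rule: infinite_finite_induct)
  case (insert a A)
  then show ?case
    by (simp only: sum.insert not_False_eq_True tabloid_form_add_left)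
qed (simp_all add: tabloid_form_def)

lemma tabloid_form_add_right: "tabloid_form \<mu> z (x + y) = tabloid_form \<mu> z x + tabloid_form \<mu> z y"
  by (simp add: tabloid_form_def sum.distrib distrib_left)

lemma tabloid_form_scale_right: "tabloid_form \<mu> z (\<lambda>X. c * x X) = c * tabloid_form \<mu> z x"
  by (simp add: tabloid_form_def sum_distrib_left mult.left_commute)

lemma tabloid_form_sum_right: "tabloid_form \<mu> z (\<Sum>a\<in>A. f a) = (\<Sum>a\<in>A. tabloid_form \<mu> z (f a))"
proof -
  have "tabloid_form \<mu> z (\<Sum>a\<in>A. f a) = tabloid_form \<mu> (\<Sum>a\<in>A. f a) z"
    by (rule tabloid_form_commute)
  also have "\<dots> = (\<Sum>a\<in>A. tabloid_form \<mu> (f a) z)"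
    by (rule tabloid_form_sum_left)
  also have "\<dots> = (\<Sum>a\<in>A. tabloid_form \<mu> z (f a))"
    by (intro sum.cong refl tabloid_form_commute)
  finally show ?thesis .
qed

text \<open>Positive definiteness over the rationals. It later forces an intertwined vector of norm
  0 to vanish.\<close>

lemma tabloid_form_eq_0_iff:
  fixes x :: "tabloid \<Rightarrow> rat"
  assumes "x \<in> perm_module \<mu>"
  shows "tabloid_form \<mu> x x = 0 \<longleftrightarrow> x = 0"
proof
  assume "tabloid_form \<mu> x x = 0"
  then have "\<forall>X\<in>tabloids \<mu>. x X * x X = 0"
    unfolding tabloid_form_def by (subst (asm) sum_nonneg_eq_0_iff) (auto simp: finite_tabloids)
  then show "x = 0"
    using assms by (auto simp: perm_module_def fun_eq_iff)
qed (simp add: tabloid_form_def)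

lemma subspace_perm_module: "tabloid_space.subspace (perm_module \<mu>)"
  by (auto simp: tabloid_space.subspace_def perm_module_def)

section \<open>Polytabloids and column-alternating vectors\<close>

abbreviation ptab :: "nat list \<Rightarrow> tableau \<Rightarrow> tabloid \<Rightarrow> rat" where
  "ptab \<mu> t \<equiv> polytabloid \<mu> t"

lemma finite_column_stabilizer: "finite (column_stabilizer \<mu> t)"
  by (rule finite_subset[OF _ finite_permutations[of "{1..sum_list \<mu>}"]]) (auto simp: column_stabilizer_def)

lemma column_stabilizer_iff:
  assumes t: "t \<in> tableaux \<mu>"
  shows "\<pi> \<in> column_stabilizer \<mu> t \<longleftrightarrow>
    entry_perm \<mu> \<pi> \<and> (\<forall>k\<in>{1..sum_list \<mu>}. entry_col \<mu> t (\<pi> k) = entry_col \<mu> t k)"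
proof
  assume "\<pi> \<in> column_stabilizer \<mu> t"
  then have \<pi>: "entry_perm \<mu> \<pi>" "\<And>j. \<pi> ` t ` column \<mu> j = t ` column \<mu> j"
    by (auto simp: column_stabilizer_def)
  have "entry_col \<mu> t (\<pi> k) = entry_col \<mu> t k" if "k \<in> {1..sum_list \<mu>}" for k
  proof -
    have "k \<in> t ` column \<mu> (entry_col \<mu> t k)"
      using that unfolding image_column[OF t] by simp
    then have "\<pi> k \<in> t ` column \<mu> (entry_col \<mu> t k)"
      using \<pi>(2) by blast
    then show ?thesis
      unfolding image_column[OF t] by simp
  qed
  then show "entry_perm \<mu> \<pi> \<and> (\<forall>k\<in>{1..sum_list \<mu>}. entry_col \<mu> t (\<pi> k) = entry_col \<mu> t k)"
    using \<pi>(1) by blast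
next
  assume \<pi>: "entry_perm \<mu> \<pi> \<and> (\<forall>k\<in>{1..sum_list \<mu>}. entry_col \<mu> t (\<pi> k) = entry_col \<mu> t k)"
  then have p: "entry_perm \<mu> \<pi>"
    by blast
  have "\<pi> ` t ` column \<mu> j = t ` column \<mu> j" for j
  proof (rule endo_inj_surj)
    show "finite (t ` column \<mu> j)"
      by (intro finite_imageI finite_subset[OF column_subset finite_diagram])
    show "inj_on \<pi> (t ` column \<mu> j)"
      using permutes_inj_on[OF p] .
    show "\<pi> ` t ` column \<mu> j \<subseteq> t ` column \<mu> j"
      unfolding image_column[OF t] using \<pi> permutes_in_image[OF p] by auto
  qed
  then show "\<pi> \<in> column_stabilizer \<mu> t"
    using p by (simp add: column_stabilizer_def)
qed

lemma column_stabilizer_perm: "\<pi> \<in> column_stabilizer \<mu> t \<Longrightarrow> entry_perm \<mu> \<pi>"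
  by (simp add: column_stabilizer_def)

lemma entry_permutation: "entry_perm \<mu> \<pi> \<Longrightarrow> permutation \<pi>"
  using permutes_imp_permutation[OF finite_atLeastAtMost] .

lemma column_stabilizer_comp:
  assumes "t \<in> tableaux \<mu>" "\<pi> \<in> column_stabilizer \<mu> t" "\<sigma> \<in> column_stabilizer \<mu> t"
  shows "\<pi> \<circ> \<sigma> \<in> column_stabilizer \<mu> t"
proof -
  have \<pi>: "entry_perm \<mu> \<pi>" "entry_perm \<mu> \<sigma>"
    using assms column_stabilizer_perm by blast+
  moreover have "\<sigma> k \<in> {1..sum_list \<mu>}" if "k \<in> {1..sum_list \<mu>}" for k
    using permutes_in_image[OF \<pi>(2)] that by blast
  ultimately show ?thesis
    using assms unfolding column_stabilizer_iff[OF assms(1)] by (auto intro: permutes_compose)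
qed

lemma column_stabilizer_inv:
  assumes "t \<in> tableaux \<mu>" "\<pi> \<in> column_stabilizer \<mu> t"
  shows "perm_inv \<pi> \<in> column_stabilizer \<mu> t"
proof -
  have p: "entry_perm \<mu> \<pi>"
    using assms column_stabilizer_perm by blast
  have "entry_col \<mu> t (perm_inv \<pi> k) = entry_col \<mu> t k" if "k \<in> {1..sum_list \<mu>}" for k
  proof -
    have "perm_inv \<pi> k \<in> {1..sum_list \<mu>}"
      using permutes_in_image[OF permutes_inv[OF p]] that by blast
    then have "entry_col \<mu> t (\<pi> (perm_inv \<pi> k)) = entry_col \<mu> t (perm_inv \<pi> k)"
      using assms(2) unfolding column_stabilizer_iff[OF assms(1)] by blast
    then show ?thesis
      by (simp add: permutes_inverses[OF p])
  qed
  then show ?thesis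
    unfolding column_stabilizer_iff[OF assms(1)] using permutes_inv[OF p] by blast
qed

lemma transpose_in_column_stabilizer:
  assumes "t \<in> tableaux \<mu>" "k \<in> {1..sum_list \<mu>}" "l \<in> {1..sum_list \<mu>}" "entry_col \<mu> t k = entry_col \<mu> t l"
  shows "Transposition.transpose k l \<in> column_stabilizer \<mu> t"
  unfolding column_stabilizer_iff[OF assms(1)] using assms
  by (auto simp: transpose_def intro: permutes_swap_id)

lemma polytabloid_perm_module: "t \<in> tableaux \<mu> \<Longrightarrow> ptab \<mu> t \<in> perm_module \<mu>"
  unfolding perm_module_def polytabloid_def
  using tabloid_in_tabloids[OF act_tableau[OF _ column_stabilizer_perm]]
  by (fastforce intro!: sum.neutral)

lemma polytabloid_shifted:
  assumes t: "t \<in> tableaux \<mu>" and s: "s \<in> tableaux \<mu>" and \<sigma>: "entry_perm \<mu> \<sigma>"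
  shows "perm_act \<mu> \<sigma> (ptab \<mu> t) (tabloid \<mu> s)
    = (\<Sum>\<pi>\<in>column_stabilizer \<mu> t. of_int (sign \<pi>) * (if tabloid \<mu> s = tabloid \<mu> (act \<mu> (\<sigma> \<circ> \<pi>) t) then 1 else 0))"
proof -
  have "tabloid \<mu> (act \<mu> (perm_inv \<sigma>) s) = tabloid \<mu> (act \<mu> \<pi> t) \<longleftrightarrow> tabloid \<mu> s = tabloid \<mu> (act \<mu> (\<sigma> \<circ> \<pi>) t)"
    if "\<pi> \<in> column_stabilizer \<mu> t" for \<pi>
    using tabloid_act_eq_iff[OF act_tableau[OF s permutes_inv[OF \<sigma>]] act_tableau[OF t column_stabilizer_perm[OF that]] \<sigma>]
    unfolding act_inv_act(2)[OF s \<sigma>] unfolding act_act by (rule sym)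
  then show ?thesis
    unfolding perm_act_tabloid[OF s \<sigma>] polytabloid_def by (intro sum.cong refl) simp
qed

lemma perm_act_column:
  assumes t: "t \<in> tableaux \<mu>" and \<sigma>: "\<sigma> \<in> column_stabilizer \<mu> t"
  shows "perm_act \<mu> \<sigma> (ptab \<mu> t) = (\<lambda>X. of_int (sign \<sigma>) * ptab \<mu> t X)"
proof (rule perm_module_eqI[of _ \<mu>])
  show "(\<lambda>X. of_int (sign \<sigma>) * ptab \<mu> t X) \<in> perm_module \<mu>"
    using polytabloid_perm_module[OF t] by (simp add: perm_module_def)
  fix s assume s: "s \<in> tableaux \<mu>"
  note p = column_stabilizer_perm[OF \<sigma>]
  have comp: "\<sigma> \<circ> (perm_inv \<sigma> \<circ> \<pi>) = \<pi>" "perm_inv \<sigma> \<circ> (\<sigma> \<circ> \<pi>) = \<pi>" for \<pi>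
    using permutes_inv_o[OF p] by (simp_all flip: comp_assoc)
  have "(\<Sum>\<pi>\<in>column_stabilizer \<mu> t. of_int (sign \<pi>) * (if tabloid \<mu> s = tabloid \<mu> (act \<mu> (\<sigma> \<circ> \<pi>) t) then 1 else 0))
      = (\<Sum>\<pi>\<in>column_stabilizer \<mu> t. of_int (sign \<sigma>) *
          (of_int (sign \<pi>) * (if tabloid \<mu> s = tabloid \<mu> (act \<mu> \<pi> t) then 1 else 0 :: rat)))"
  proof (rule sum.reindex_bij_witness[where i = "\<lambda>\<pi>. perm_inv \<sigma> \<circ> \<pi>" and j = "\<lambda>\<pi>. \<sigma> \<circ> \<pi>"])
    fix \<pi> assume \<pi>: "\<pi> \<in> column_stabilizer \<mu> t"
    show "\<sigma> \<circ> \<pi> \<in> column_stabilizer \<mu> t" "perm_inv \<sigma> \<circ> \<pi> \<in> column_stabilizer \<mu> t"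
      using column_stabilizer_comp[OF t] column_stabilizer_inv[OF t] \<sigma> \<pi> by blast+
    have "sign (\<sigma> \<circ> \<pi>) = sign \<sigma> * sign \<pi>"
      using entry_permutation column_stabilizer_perm \<sigma> \<pi> by (intro sign_compose) blast+
    then have "sign \<sigma> * sign (\<sigma> \<circ> \<pi>) = sign \<pi>"
      by simp
    then have "of_int (sign \<sigma>) * (of_int (sign (\<sigma> \<circ> \<pi>)) * x) = of_int (sign \<pi>) * (x :: rat)" for x
      unfolding mult.assoc[symmetric] of_int_mult[symmetric] by simp
    then show "of_int (sign \<sigma>) * (of_int (sign (\<sigma> \<circ> \<pi>)) * (if tabloid \<mu> s = tabloid \<mu> (act \<mu> (\<sigma> \<circ> \<pi>) t) then 1 else 0))
        = of_int (sign \<pi>) * (if tabloid \<mu> s = tabloid \<mu> (act \<mu> (\<sigma> \<circ> \<pi>) t) then 1 else 0 :: rat)" .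
  qed (rule comp)+
  then show "perm_act \<mu> \<sigma> (ptab \<mu> t) (tabloid \<mu> s) = of_int (sign \<sigma>) * ptab \<mu> t (tabloid \<mu> s)"
    unfolding polytabloid_shifted[OF t s p] unfolding polytabloid_def sum_distrib_left .
qed (rule perm_act_in)

lemma column_stabilizer_conj:
  assumes t: "t \<in> tableaux \<mu>" and \<sigma>: "entry_perm \<mu> \<sigma>" and \<pi>: "\<pi> \<in> column_stabilizer \<mu> t"
  shows "\<sigma> \<circ> \<pi> \<circ> perm_inv \<sigma> \<in> column_stabilizer \<mu> (act \<mu> \<sigma> t)"
proof -
  note p = column_stabilizer_perm[OF \<pi>]
  have "entry_col \<mu> (act \<mu> \<sigma> t) ((\<sigma> \<circ> \<pi> \<circ> perm_inv \<sigma>) k) = entry_col \<mu> (act \<mu> \<sigma> t) k"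
    if "k \<in> {1..sum_list \<mu>}" for k
  proof -
    define l where "l = perm_inv \<sigma> k"
    have k: "k = \<sigma> l"
      by (simp add: l_def permutes_inverses[OF \<sigma>])
    have l: "l \<in> {1..sum_list \<mu>}"
      using permutes_in_image[OF permutes_inv[OF \<sigma>]] that unfolding l_def by blast
    moreover from l have "\<pi> l \<in> {1..sum_list \<mu>}"
      using permutes_in_image[OF p] by blast
    moreover have "entry_col \<mu> t (\<pi> l) = entry_col \<mu> t l"
      using \<pi> l unfolding column_stabilizer_iff[OF t] by blast
    moreover have "(\<sigma> \<circ> \<pi> \<circ> perm_inv \<sigma>) k = \<sigma> (\<pi> l)"
      by (simp add: l_def)
    ultimately show ?thesis
      unfolding k by (simp only: entry_col_act[OF t \<sigma>])
  qed
  moreover have "entry_perm \<mu> (\<sigma> \<circ> \<pi> \<circ> perm_inv \<sigma>)"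
    by (intro permutes_compose permutes_inv \<sigma> p)
  ultimately show ?thesis
    unfolding column_stabilizer_iff[OF act_tableau[OF t \<sigma>]] by blast
qed

lemma perm_act_polytabloid:
  assumes t: "t \<in> tableaux \<mu>" and \<sigma>: "entry_perm \<mu> \<sigma>"
  shows "perm_act \<mu> \<sigma> (ptab \<mu> t) = ptab \<mu> (act \<mu> \<sigma> t)"
proof (rule perm_module_eqI[of _ \<mu>])
  show "ptab \<mu> (act \<mu> \<sigma> t) \<in> perm_module \<mu>"
    by (intro polytabloid_perm_module act_tableau t \<sigma>)
  fix s assume s: "s \<in> tableaux \<mu>"
  note t' = act_tableau[OF t \<sigma>] and \<sigma>' = permutes_inv[OF \<sigma>]
  have comp: "perm_inv \<sigma> \<circ> (\<sigma> \<circ> \<pi> \<circ> perm_inv \<sigma>) \<circ> \<sigma> = \<pi>"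
    "\<sigma> \<circ> (perm_inv \<sigma> \<circ> \<pi> \<circ> \<sigma>) \<circ> perm_inv \<sigma> = \<pi>" "\<sigma> \<circ> \<pi> \<circ> perm_inv \<sigma> \<circ> \<sigma> = \<sigma> \<circ> \<pi>" for \<pi>
    by (auto simp: fun_eq_iff permutes_inverses[OF \<sigma>])
  have "(\<Sum>\<pi>\<in>column_stabilizer \<mu> t. of_int (sign \<pi>) * (if tabloid \<mu> s = tabloid \<mu> (act \<mu> (\<sigma> \<circ> \<pi>) t) then 1 else 0))
      = (\<Sum>\<pi>\<in>column_stabilizer \<mu> (act \<mu> \<sigma> t).
          of_int (sign \<pi>) * (if tabloid \<mu> s = tabloid \<mu> (act \<mu> \<pi> (act \<mu> \<sigma> t)) then 1 else 0 :: rat))"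
  proof (rule sum.reindex_bij_witness[where i = "\<lambda>\<pi>. perm_inv \<sigma> \<circ> \<pi> \<circ> \<sigma>" and j = "\<lambda>\<pi>. \<sigma> \<circ> \<pi> \<circ> perm_inv \<sigma>"])
    fix \<pi> assume \<pi>: "\<pi> \<in> column_stabilizer \<mu> t"
    show "\<sigma> \<circ> \<pi> \<circ> perm_inv \<sigma> \<in> column_stabilizer \<mu> (act \<mu> \<sigma> t)"
      by (rule column_stabilizer_conj[OF t \<sigma> \<pi>])
    have "sign (\<sigma> \<circ> \<pi> \<circ> perm_inv \<sigma>) = sign \<pi>"
      using entry_permutation[OF \<sigma>] entry_permutation[OF column_stabilizer_perm[OF \<pi>]] entry_permutation[OF \<sigma>']
      by (simp add: sign_compose sign_inverse permutation_compose)
    then show "of_int (sign (\<sigma> \<circ> \<pi> \<circ> perm_inv \<sigma>)) *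
        (if tabloid \<mu> s = tabloid \<mu> (act \<mu> (\<sigma> \<circ> \<pi> \<circ> perm_inv \<sigma>) (act \<mu> \<sigma> t)) then 1 else 0)
        = of_int (sign \<pi>) * (if tabloid \<mu> s = tabloid \<mu> (act \<mu> (\<sigma> \<circ> \<pi>) t) then 1 else 0 :: rat)"
      by (simp only: act_act comp)
  next
    fix \<pi> assume "\<pi> \<in> column_stabilizer \<mu> (act \<mu> \<sigma> t)"
    from column_stabilizer_conj[OF t' \<sigma>' this] show "perm_inv \<sigma> \<circ> \<pi> \<circ> \<sigma> \<in> column_stabilizer \<mu> t"
      by (simp only: act_inv_act[OF t \<sigma>] permutes_inv_inv[OF \<sigma>])
  qed (rule comp)+
  then show "perm_act \<mu> \<sigma> (ptab \<mu> t) (tabloid \<mu> s) = ptab \<mu> (act \<mu> \<sigma> t) (tabloid \<mu> s)"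
    unfolding polytabloid_shifted[OF t s \<sigma>] by (simp only: polytabloid_def)
qed (rule perm_act_in)

text \<open>A column permutation that also fixes the tabloid preserves both the row and the column
  of each entry, hence is the identity. So exactly one term of the signed sum contributes.\<close>

lemma polytabloid_self:
  assumes t: "t \<in> tableaux \<mu>"
  shows "ptab \<mu> t (tabloid \<mu> t) = 1"
proof -
  have "\<pi> = id" if \<pi>: "\<pi> \<in> column_stabilizer \<mu> t" and eq: "tabloid \<mu> t = tabloid \<mu> (act \<mu> \<pi> t)" for \<pi>
  proof
    fix k
    note p = column_stabilizer_perm[OF \<pi>]
    show "\<pi> k = id k"
    proof (cases "k \<in> {1..sum_list \<mu>}")
      case True
      have \<pi>k: "\<pi> k \<in> {1..sum_list \<mu>}"
        using True permutes_in_image[OF p] by blast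
      have "row_equiv \<mu> t (act \<mu> \<pi> t)"
        using eq tabloid_eq_iff[OF t act_tableau[OF t p]] by simp
      then have "entry_row \<mu> t (\<pi> k) = entry_row \<mu> (act \<mu> \<pi> t) (\<pi> k)"
        using \<pi>k unfolding row_equiv_def by blast
      then have row: "entry_row \<mu> t (\<pi> k) = entry_row \<mu> t k"
        by (simp only: entry_row_act[OF t p True])
      have col: "entry_col \<mu> t (\<pi> k) = entry_col \<mu> t k"
        using \<pi> True unfolding column_stabilizer_iff[OF t] by blast
      obtain x where x: "x \<in> diagram \<mu>" "t x = k"
        using tableau_cell[OF t True] .
      obtain y where y: "y \<in> diagram \<mu>" "t y = \<pi> k"
        using tableau_cell[OF t \<pi>k] .
      have "x = y"
        using row col unfolding x(2)[symmetric] y(2)[symmetric]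
          entry_row_tableau[OF t x(1)] entry_col_tableau[OF t x(1)]
        by (metis x(2) y(2) y(1) entry_row_tableau[OF t] entry_col_tableau[OF t] prod_eqI)
      with x y show ?thesis
        by simp
    next
      case False
      then show ?thesis
        using permutes_not_in[OF p] by simp
    qed
  qed
  moreover have "id \<in> column_stabilizer \<mu> t"
    by (simp add: column_stabilizer_def permutes_id)
  ultimately have "ptab \<mu> t (tabloid \<mu> t) = (\<Sum>\<pi>\<in>{id}. of_int (sign \<pi>) * (if tabloid \<mu> t = tabloid \<mu> (act \<mu> \<pi> t) then 1 else 0))"
    unfolding polytabloid_def by (intro sum.mono_neutral_right finite_column_stabilizer) auto
  then show ?thesis
    by (simp add: act_id[OF t])
qed

definition column_alternating :: "nat list \<Rightarrow> tableau \<Rightarrow> (tabloid \<Rightarrow> rat) \<Rightarrow> bool" where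
  "column_alternating \<mu> t x \<longleftrightarrow> x \<in> perm_module \<mu> \<and>
     (\<forall>\<sigma>\<in>column_stabilizer \<mu> t. perm_act \<mu> \<sigma> x = (\<lambda>X. of_int (sign \<sigma>) * x X))"

text \<open>The transposition fixes the tabloid and negates \<open>x\<close>, so the coefficient
  equals its own negative.\<close>

lemma vanish_if_transpose_fixes:
  assumes s: "s \<in> tableaux \<mu>" and kl: "k \<in> {1..sum_list \<mu>}" "l \<in> {1..sum_list \<mu>}"
    and row: "entry_row \<mu> s k = entry_row \<mu> s l"
    and x: "perm_act \<mu> (Transposition.transpose k l) x = - x"
  shows "x (tabloid \<mu> s) = 0"
proof -
  let ?\<tau> = "Transposition.transpose k l"
  have \<tau>: "entry_perm \<mu> ?\<tau>"
    using kl by (rule permutes_swap_id)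
  have inv: "perm_inv ?\<tau> = ?\<tau>"
    by simp
  have "row_equiv \<mu> (act \<mu> ?\<tau> s) s"
    unfolding row_equiv_def
  proof
    fix m assume m: "m \<in> {1..sum_list \<mu>}"
    have "?\<tau> m \<in> {1..sum_list \<mu>}"
      using m permutes_in_image[OF \<tau>] by blast
    from entry_row_act[OF s \<tau> this] have "entry_row \<mu> (act \<mu> ?\<tau> s) m = entry_row \<mu> s (?\<tau> m)"
      by simp
    also have "\<dots> = entry_row \<mu> s m"
      using row by (simp add: transpose_def)
    finally show "entry_row \<mu> (act \<mu> ?\<tau> s) m = entry_row \<mu> s m" .
  qed
  then have "tabloid \<mu> (act \<mu> ?\<tau> s) = tabloid \<mu> s"
    using tabloid_eq_iff[OF act_tableau[OF s \<tau>] s] by simp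
  then have "perm_act \<mu> ?\<tau> x (tabloid \<mu> s) = x (tabloid \<mu> s)"
    using perm_act_tabloid[OF s \<tau>, of x] by (simp only: inv)
  moreover have "perm_act \<mu> ?\<tau> x (tabloid \<mu> s) = - x (tabloid \<mu> s)"
    using x by (simp only: fun_Compl_def)
  ultimately show ?thesis
    by simp
qed

lemma column_alternating_polytabloid:
  "t \<in> tableaux \<mu> \<Longrightarrow> column_alternating \<mu> t (ptab \<mu> t)"
  by (simp add: column_alternating_def polytabloid_perm_module perm_act_column)

lemma column_alternating_transpose:
  assumes "column_alternating \<mu> t x" "t \<in> tableaux \<mu>" "k \<in> {1..sum_list \<mu>}" "l \<in> {1..sum_list \<mu>}"
    "k \<noteq> l" "entry_col \<mu> t k = entry_col \<mu> t l"
  shows "perm_act \<mu> (Transposition.transpose k l) x = - x"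
proof -
  have "perm_act \<mu> (Transposition.transpose k l) x = (\<lambda>X. of_int (sign (Transposition.transpose k l)) * x X)"
    using assms(1) transpose_in_column_stabilizer[OF assms(2-4,6)] unfolding column_alternating_def by blast
  then show ?thesis
    using assms(5) by (simp add: sign_swap_id fun_Compl_def)
qed

definition column_height :: "nat list \<Rightarrow> nat \<Rightarrow> nat" where
  "column_height \<mu> j = card {i. (i, j) \<in> diagram \<mu>}"

lemma lower_set_eq_lessThan:
  fixes A :: "nat set"
  assumes "finite A" "\<And>i j. j \<in> A \<Longrightarrow> i \<le> j \<Longrightarrow> i \<in> A"
  shows "A = {..<card A}"
proof -
  have "A \<subseteq> {..<card A}"
  proof
    fix j assume "j \<in> A"
    then have "card {..j} \<le> card A"
      using assms by (intro card_mono) auto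
    then show "j \<in> {..<card A}"
      by simp
  qed
  then show ?thesis
    by (intro card_subset_eq) auto
qed

lemma finite_column_rows: "finite {i. (i, j) \<in> diagram \<mu>}"
  by (rule finite_subset[of _ "{..<length \<mu>}"]) (auto simp: mem_diagram_iff)

lemma column_rows:
  assumes "sorted_wrt (\<ge>) \<mu>"
  shows "{i. (i, j) \<in> diagram \<mu>} = {..<column_height \<mu> j}"
  unfolding column_height_def
proof (rule lower_set_eq_lessThan[OF finite_column_rows])
  fix i i' assume "i' \<in> {i. (i, j) \<in> diagram \<mu>}" "i \<le> i'"
  then show "i \<in> {i. (i, j) \<in> diagram \<mu>}"
    using sorted_nth_mono[OF assms, of i i'] by (auto simp: mem_diagram_iff)
qed

lemma diagram_column_iff: "sorted_wrt (\<ge>) \<mu> \<Longrightarrow> (i, j) \<in> diagram \<mu> \<longleftrightarrow> i < column_height \<mu> j"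
  using column_rows by blast

lemma column_height_mono:
  assumes "sorted_wrt (\<ge>) \<mu>" "j \<le> j'"
  shows "column_height \<mu> j' \<le> column_height \<mu> j"
  unfolding column_height_def
  by (intro card_mono finite_column_rows) (use assms(2) in \<open>auto simp: mem_diagram_iff\<close>)

lemma card_column_image:
  assumes "t \<in> tableaux \<mu>"
  shows "card (t ` column \<mu> j) = column_height \<mu> j"
proof -
  have "card (t ` column \<mu> j) = card (column \<mu> j)"
    by (rule card_image) (rule inj_on_subset[OF tableau_inj[OF assms] column_subset])
  also have "\<dots> = card ((\<lambda>i. (i, j)) ` {i. (i, j) \<in> diagram \<mu>})"
    by (rule arg_cong[where f = card]) (auto simp: column_def)
  also have "\<dots> = column_height \<mu> j"
    unfolding column_height_def by (rule card_image) (auto simp: inj_on_def)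
  finally show ?thesis .
qed

text \<open>The equality case is the point: a finite set of natural numbers whose sum is minimal for
  its size is an initial segment.\<close>

lemma sum_lessThan_card_le:
  fixes A :: "nat set"
  assumes "finite A"
  shows "\<Sum>{..<card A} \<le> \<Sum>A" and "\<Sum>A = \<Sum>{..<card A} \<Longrightarrow> A = {..<card A}"
proof -
  have "\<Sum>{..<card A} \<le> \<Sum>A \<and> (\<Sum>A = \<Sum>{..<card A} \<longrightarrow> A = {..<card A})"
    using assms
  proof (induction A rule: finite_linorder_max_induct)
    case (insert b A)
    have sub: "A \<subseteq> {..<b}"
      using insert.hyps(2) by auto
    then have le: "card A \<le> b"
      using card_mono[OF _ sub] by simp
    have b: "b \<notin> A"
      using insert.hyps(2) by blast
    have eqs: "card (insert b A) = Suc (card A)" "\<Sum>(insert b A) = b + \<Sum>A"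
        "\<Sum>{..<Suc (card A)} = card A + \<Sum>{..<card A}"
      using insert.hyps(1) b by simp_all
    show ?case
      unfolding eqs
    proof (intro conjI impI)
      show "card A + \<Sum>{..<card A} \<le> b + \<Sum>A"
        using le insert.IH by linarith
      assume "b + \<Sum>A = card A + \<Sum>{..<card A}"
      then have "card A = b" "\<Sum>A = \<Sum>{..<card A}"
        using le insert.IH by linarith+
      moreover from this(2) have "A = {..<card A}"
        using insert.IH by blast
      ultimately show "insert b A = {..<Suc (card A)}"
        unfolding lessThan_Suc by simp
    qed
  qed simp
  then show "\<Sum>{..<card A} \<le> \<Sum>A" and "\<Sum>A = \<Sum>{..<card A} \<Longrightarrow> A = {..<card A}"
    by blast+
qed

text \<open>The rows occupied in \<open>s\<close> by a column of \<open>t\<close> have at least the sum of the rows of that column of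
  the diagram, and summed over all columns both sides agree.\<close>

lemma column_transversal_rows:
  assumes sorted: "sorted_wrt (\<ge>) \<mu>" and s: "s \<in> tableaux \<mu>" and t: "t \<in> tableaux \<mu>"
    and inj: "\<And>k l. k \<in> {1..sum_list \<mu>} \<Longrightarrow> l \<in> {1..sum_list \<mu>} \<Longrightarrow> k \<noteq> l \<Longrightarrow>
      entry_col \<mu> t k = entry_col \<mu> t l \<Longrightarrow> entry_row \<mu> s k \<noteq> entry_row \<mu> s l"
  shows "entry_row \<mu> s ` t ` column \<mu> j = {..<column_height \<mu> j}"
proof -
  define J where "J = snd ` diagram \<mu>"
  have J: "finite J"
    by (simp add: J_def finite_diagram)
  let ?R = "\<lambda>j. entry_row \<mu> s ` t ` column \<mu> j"
  have fin: "finite (t ` column \<mu> j)" for j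
    by (intro finite_imageI finite_subset[OF column_subset finite_diagram])
  have inj': "inj_on (entry_row \<mu> s) (t ` column \<mu> j)" for j
  proof (intro inj_onI, rule ccontr)
    fix k l assume "k \<in> t ` column \<mu> j" "l \<in> t ` column \<mu> j"
      "entry_row \<mu> s k = entry_row \<mu> s l" "k \<noteq> l"
    then show False
      using inj[of k l] unfolding image_column[OF t] by simp
  qed
  then have card: "card (?R j) = column_height \<mu> j" for j
    by (simp add: card_image card_column_image[OF t])
  have le: "\<Sum>{..<column_height \<mu> j} \<le> \<Sum>(?R j)" for j
    using sum_lessThan_card_le(1)[of "?R j"] fin card by simp
  have group: "(\<Sum>x\<in>diagram \<mu>. f x) = (\<Sum>j\<in>J. \<Sum>x\<in>column \<mu> j. f x)" for f :: "nat \<times> nat \<Rightarrow> nat"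
  proof -
    have "(\<Sum>j\<in>J. \<Sum>x\<in>{x \<in> diagram \<mu>. snd x = j}. f x) = (\<Sum>x\<in>diagram \<mu>. f x)"
      by (rule sum.group[OF finite_diagram J]) (simp add: J_def)
    then show ?thesis
      by (simp only: column_def)
  qed
  have "(\<Sum>j\<in>J. \<Sum>(?R j)) = (\<Sum>j\<in>J. \<Sum>x\<in>column \<mu> j. entry_row \<mu> s (t x))"
  proof (intro sum.cong refl)
    fix j
    have "inj_on t (column \<mu> j)"
      by (rule inj_on_subset[OF tableau_inj[OF t] column_subset])
    then show "\<Sum>(?R j) = (\<Sum>x\<in>column \<mu> j. entry_row \<mu> s (t x))"
      unfolding sum.reindex[OF inj'] comp_id sum.reindex[OF \<open>inj_on t (column \<mu> j)\<close>] by simp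
  qed
  also have "\<dots> = (\<Sum>x\<in>diagram \<mu>. entry_row \<mu> s (t x))"
    by (rule group[symmetric])
  also have "\<dots> = (\<Sum>k\<in>{1..sum_list \<mu>}. entry_row \<mu> s k)"
    using sum.reindex_bij_betw[OF tableau_bij[OF t]] .
  also have "\<dots> = (\<Sum>x\<in>diagram \<mu>. entry_row \<mu> s (s x))"
    using sum.reindex_bij_betw[OF tableau_bij[OF s], symmetric] .
  also have "\<dots> = (\<Sum>x\<in>diagram \<mu>. fst x)"
    by (intro sum.cong refl entry_row_tableau[OF s])
  also have "\<dots> = (\<Sum>j\<in>J. \<Sum>x\<in>column \<mu> j. fst x)"
    by (rule group)
  also have "\<dots> = (\<Sum>j\<in>J. \<Sum>{..<column_height \<mu> j})"
  proof (intro sum.cong refl)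
    fix j
    have "column \<mu> j = (\<lambda>i. (i, j)) ` {..<column_height \<mu> j}"
      using diagram_column_iff[OF sorted] by (auto simp: column_def)
    then show "(\<Sum>x\<in>column \<mu> j. fst x) = \<Sum>{..<column_height \<mu> j}"
      by (simp add: sum.reindex inj_on_def)
  qed
  finally have eq: "(\<Sum>j\<in>J. \<Sum>(?R j)) = (\<Sum>j\<in>J. \<Sum>{..<column_height \<mu> j})" .
  show ?thesis
  proof (cases "j \<in> J")
    case True
    have "\<Sum>(?R j) = \<Sum>{..<column_height \<mu> j}"
    proof (rule ccontr)
      assume "\<Sum>(?R j) \<noteq> \<Sum>{..<column_height \<mu> j}"
      then have "\<Sum>{..<column_height \<mu> j} < \<Sum>(?R j)"
        using le[of j] by linarith
      then have "(\<Sum>j\<in>J. \<Sum>{..<column_height \<mu> j}) < (\<Sum>j\<in>J. \<Sum>(?R j))"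
        using le True J by (intro sum_strict_mono_ex1) auto
      then show False
        using eq by simp
    qed
    then show ?thesis
      using sum_lessThan_card_le(2)[of "?R j"] fin card by simp
  next
    case False
    then have "column \<mu> j = {}"
      by (force simp: J_def column_def)
    then show ?thesis
      using card[of j] by simp
  qed
qed

text \<open>Sending an entry to its row in \<open>s\<close> and its column in \<open>t\<close> is
  injective by assumption and stays inside the diagram by \<open>column_transversal_rows\<close>.
  The inverse map is a tableau \<open>u\<close> with the rows of \<open>s\<close> and the columns of
  \<open>t\<close>, and the permutation from \<open>t\<close> to \<open>u\<close> preserves
  columns.\<close>

lemma ex_column_stabilizer_row_equiv:
  assumes sorted: "sorted_wrt (\<ge>) \<mu>" and s: "s \<in> tableaux \<mu>" and t: "t \<in> tableaux \<mu>"
    and inj: "\<And>k l. k \<in> {1..sum_list \<mu>} \<Longrightarrow> l \<in> {1..sum_list \<mu>} \<Longrightarrow> k \<noteq> l \<Longrightarrow>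
      entry_col \<mu> t k = entry_col \<mu> t l \<Longrightarrow> entry_row \<mu> s k \<noteq> entry_row \<mu> s l"
  shows "\<exists>\<sigma>\<in>column_stabilizer \<mu> t. tabloid \<mu> s = tabloid \<mu> (act \<mu> \<sigma> t)"
proof -
  let ?N = "{1..sum_list \<mu>}" and ?D = "diagram \<mu>"
  define f where "f k = (entry_row \<mu> s k, entry_col \<mu> t k)" for k
  have "inj_on f ?N"
  proof (intro inj_onI, rule ccontr)
    fix k l assume "k \<in> ?N" "l \<in> ?N" "f k = f l" "k \<noteq> l"
    then show False
      using inj[of k l] by (simp add: f_def)
  qed
  moreover have "f ` ?N \<subseteq> ?D"
  proof
    fix p assume "p \<in> f ` ?N"
    then obtain k where k: "k \<in> ?N" "p = f k"
      by blast
    then have "k \<in> t ` column \<mu> (entry_col \<mu> t k)"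
      unfolding image_column[OF t] by simp
    then have "entry_row \<mu> s k \<in> {..<column_height \<mu> (entry_col \<mu> t k)}"
      using column_transversal_rows[OF sorted s t inj, of "entry_col \<mu> t k"] by blast
    then show "p \<in> ?D"
      using diagram_column_iff[OF sorted] k(2) by (simp add: f_def)
  qed
  moreover have "card ?N = card ?D"
    using bij_betw_same_card[OF tableau_bij[OF t]] by simp
  ultimately have "f ` ?N = ?D"
    by (intro card_subset_eq finite_diagram) (simp_all add: card_image)
  with \<open>inj_on f ?N\<close> have bij: "bij_betw f ?N ?D"
    by (simp add: bij_betw_def)
  define u where "u = restrict (inv_into ?N f) ?D"
  have "bij_betw u ?D ?N"
    unfolding u_def using bij_betw_inv_into[OF bij] by (rule bij_betw_restrict_eq[THEN iffD2])
  then have u: "u \<in> tableaux \<mu>"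
    by (simp add: tableaux_def u_def)
  have fu: "f (u x) = x" if "x \<in> ?D" for x
    using that bij_betw_inv_into_right[OF bij] by (simp add: u_def)
  obtain \<sigma> where \<sigma>: "entry_perm \<mu> \<sigma>" "u = act \<mu> \<sigma> t"
    using ex_act[OF u t] .
  have "entry_col \<mu> t (\<sigma> k) = entry_col \<mu> t k" if k: "k \<in> ?N" for k
  proof -
    obtain x where x: "x \<in> ?D" "t x = k"
      using tableau_cell[OF t k] .
    have "\<sigma> k = u x"
      by (simp add: \<sigma>(2) act_apply[OF x(1)] x(2))
    then have "entry_col \<mu> t (\<sigma> k) = snd x"
      using arg_cong[OF fu[OF x(1)], of snd] by (simp add: f_def)
    then show ?thesis
      using entry_col_tableau[OF t x(1)] x(2) by simp
  qed
  then have "\<sigma> \<in> column_stabilizer \<mu> t"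
    unfolding column_stabilizer_iff[OF t] using \<sigma>(1) by blast
  moreover have "row_equiv \<mu> s u"
    unfolding row_equiv_def
  proof
    fix k assume "k \<in> ?N"
    then obtain x where x: "x \<in> ?D" "u x = k"
      using tableau_cell[OF u] by blast
    have "entry_row \<mu> s k = fst x"
      using arg_cong[OF fu[OF x(1)], of fst] x(2) by (simp add: f_def)
    then show "entry_row \<mu> s k = entry_row \<mu> u k"
      using entry_row_tableau[OF u x(1)] x(2) by simp
  qed
  ultimately show ?thesis
    using tabloid_eq_iff[OF s u] \<sigma>(2) by blast
qed

lemma polytabloid_nonzero_imp:
  assumes "ptab \<mu> t X \<noteq> 0"
  shows "\<exists>\<sigma>\<in>column_stabilizer \<mu> t. X = tabloid \<mu> (act \<mu> \<sigma> t)"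
proof (rule ccontr)
  assume "\<not> ?thesis"
  then have "ptab \<mu> t X = 0"
    unfolding polytabloid_def by (intro sum.neutral) auto
  with assms show False ..
qed

text \<open>For a tabloid there are two cases. If two entries of a column of \<open>t\<close> share
  a row, every alternating vector vanishes there. Otherwise the tabloid arises from \<open>t\<close>
  by a column permutation, and the coefficient is determined by the one at \<open>t\<close>, which
  is 1 for the polytabloid.\<close>

lemma column_alternating_eq:
  assumes sorted: "sorted_wrt (\<ge>) \<mu>" and t: "t \<in> tableaux \<mu>" and x: "column_alternating \<mu> t x"
  shows "x = (\<lambda>X. x (tabloid \<mu> t) * ptab \<mu> t X)"
proof (rule perm_module_eqI[of _ \<mu>])
  show "x \<in> perm_module \<mu>"
    using x by (simp add: column_alternating_def)
  show "(\<lambda>X. x (tabloid \<mu> t) * ptab \<mu> t X) \<in> perm_module \<mu>"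
    using polytabloid_perm_module[OF t] by (simp add: perm_module_def)
  note e = column_alternating_polytabloid[OF t]
  fix s assume s: "s \<in> tableaux \<mu>"
  show "x (tabloid \<mu> s) = x (tabloid \<mu> t) * ptab \<mu> t (tabloid \<mu> s)"
  proof (cases "\<exists>k\<in>{1..sum_list \<mu>}. \<exists>l\<in>{1..sum_list \<mu>}. k \<noteq> l \<and>
      entry_col \<mu> t k = entry_col \<mu> t l \<and> entry_row \<mu> s k = entry_row \<mu> s l")
    case True
    then obtain k l where kl: "k \<in> {1..sum_list \<mu>}" "l \<in> {1..sum_list \<mu>}" "k \<noteq> l"
        "entry_col \<mu> t k = entry_col \<mu> t l" "entry_row \<mu> s k = entry_row \<mu> s l"
      by blast
    have zero: "y (tabloid \<mu> s) = 0" if "column_alternating \<mu> t y" for y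
      using vanish_if_transpose_fixes[OF s kl(1,2,5) column_alternating_transpose[OF that t kl(1-4)]] .
    show ?thesis
      unfolding zero[OF x] zero[OF e] by simp
  next
    case False
    then obtain \<sigma> where \<sigma>: "\<sigma> \<in> column_stabilizer \<mu> t" "tabloid \<mu> s = tabloid \<mu> (act \<mu> \<sigma> t)"
      using ex_column_stabilizer_row_equiv[OF sorted s t] by blast
    have val: "y (tabloid \<mu> s) = of_int (sign \<sigma>) * y (tabloid \<mu> t)" if y: "column_alternating \<mu> t y" for y
    proof -
      have "perm_act \<mu> \<sigma> y (tabloid \<mu> (act \<mu> \<sigma> t)) = of_int (sign \<sigma>) * y (tabloid \<mu> (act \<mu> \<sigma> t))"
        using y \<sigma>(1) unfolding column_alternating_def by metis
      then have "y (tabloid \<mu> t) = of_int (sign \<sigma>) * y (tabloid \<mu> s)"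
        unfolding perm_act_tabloid'[OF t column_stabilizer_perm[OF \<sigma>(1)]] \<sigma>(2) .
      then have "of_int (sign \<sigma>) * y (tabloid \<mu> t) = of_int (sign \<sigma> * sign \<sigma>) * y (tabloid \<mu> s)"
        unfolding of_int_mult mult.assoc by (rule arg_cong)
      then show ?thesis
        by simp
    qed
    show ?thesis
      unfolding val[OF x] val[OF e] polytabloid_self[OF t] by simp
  qed
qed

lemma sum_fun_eq: "(\<Sum>a\<in>A. f a) X = (\<Sum>a\<in>A. f a X)" for f :: "'a \<Rightarrow> 'b \<Rightarrow> 'c::comm_monoid_add"
  by (induction A rule: infinite_finite_induct) simp_all

lemma perm_act_uminus: "perm_act \<mu> \<pi> (- x) = - perm_act \<mu> \<pi> x"
  by (auto simp: perm_act_def fun_eq_iff)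

text \<open>The tabloid comes from a column permutation of \<open>t\<close>, so an entry can only
  occupy rows that its column in \<open>t\<close> reaches. This bounds the number of available rows
  in the pigeonhole argument for the Garnir relation.\<close>

lemma polytabloid_row_bound:
  assumes sorted: "sorted_wrt (\<ge>) \<mu>" and t: "t \<in> tableaux \<mu>" and s: "s \<in> tableaux \<mu>"
    and nz: "ptab \<mu> t (tabloid \<mu> s) \<noteq> 0" and k: "k \<in> {1..sum_list \<mu>}"
  shows "entry_row \<mu> s k < column_height \<mu> (entry_col \<mu> t k)"
proof -
  obtain \<sigma> where \<sigma>: "\<sigma> \<in> column_stabilizer \<mu> t" "tabloid \<mu> s = tabloid \<mu> (act \<mu> \<sigma> t)"
    using polytabloid_nonzero_imp[OF nz] by blast
  note p = column_stabilizer_perm[OF \<sigma>(1)]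
  define l where "l = perm_inv \<sigma> k"
  have kl: "k = \<sigma> l"
    by (simp add: l_def permutes_inverses[OF p])
  have l: "l \<in> {1..sum_list \<mu>}"
    using permutes_in_image[OF permutes_inv[OF p]] k unfolding l_def by blast
  obtain x where x: "x \<in> diagram \<mu>" "t x = l"
    using tableau_cell[OF t l] .
  have "row_equiv \<mu> s (act \<mu> \<sigma> t)"
    using \<sigma>(2) tabloid_eq_iff[OF s act_tableau[OF t p]] by simp
  then have "entry_row \<mu> s k = entry_row \<mu> (act \<mu> \<sigma> t) (\<sigma> l)"
    using k kl unfolding row_equiv_def by blast
  also have "\<dots> = fst x"
    unfolding entry_row_act[OF t p l] using entry_row_tableau[OF t x(1)] x(2) by simp
  also have "\<dots> < column_height \<mu> (snd x)"
    using diagram_column_iff[OF sorted, of "fst x" "snd x"] x(1) by simp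
  also have "snd x = entry_col \<mu> t l"
    using entry_col_tableau[OF t x(1)] x(2) by simp
  also have "\<dots> = entry_col \<mu> t k"
    using \<sigma>(1) l unfolding column_stabilizer_iff[OF t] kl by simp
  finally show ?thesis .
qed

section \<open>A Garnir relation for one entry and one column to its left\<close>

lemma transpose_conj:
  assumes "bij \<pi>"
  shows "\<pi> \<circ> Transposition.transpose a b = Transposition.transpose (\<pi> a) (\<pi> b) \<circ> \<pi>"
  using bij_is_inj[OF assms] by (auto simp: fun_eq_iff transpose_def inj_eq)

lemma perm_act_transpose:
  assumes "entry_perm \<mu> \<pi>" "a \<in> {1..sum_list \<mu>}" "b \<in> {1..sum_list \<mu>}"
  shows "perm_act \<mu> \<pi> (perm_act \<mu> (Transposition.transpose a b) x)
    = perm_act \<mu> (Transposition.transpose (\<pi> a) (\<pi> b)) (perm_act \<mu> \<pi> x)"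
proof -
  have "\<pi> a \<in> {1..sum_list \<mu>}" "\<pi> b \<in> {1..sum_list \<mu>}"
    using assms permutes_in_image[OF assms(1)] by blast+
  then show ?thesis
    unfolding perm_act_comp[OF assms(1) permutes_swap_id[OF assms(2,3)]]
    by (simp only: perm_act_comp[OF permutes_swap_id assms(1)] transpose_conj[OF permutes_bij[OF assms(1)]])
qed

lemma perm_act_transpose_twice:
  assumes "a \<in> {1..sum_list \<mu>}" "b \<in> {1..sum_list \<mu>}" "x \<in> perm_module \<mu>"
  shows "perm_act \<mu> (Transposition.transpose a b) (perm_act \<mu> (Transposition.transpose a b) x) = x"
  unfolding perm_act_comp[OF permutes_swap_id[OF assms(1,2)] permutes_swap_id[OF assms(1,2)]]
  by (simp only: transpose_comp_involutory perm_act_id[OF assms(3)])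

text \<open>The difference \<open>x\<close> of the two sides alternates under the permutations of column \<open>j\<close> together with
  \<open>k\<close>. On the support of \<open>x\<close> these entries lie in only \<open>column_height \<mu> j\<close> rows, so two of them
  share a row.\<close>

lemma garnir_single:
  assumes sorted: "sorted_wrt (\<ge>) \<mu>" and t: "t \<in> tableaux \<mu>" and k: "k \<in> {1..sum_list \<mu>}"
    and j: "j < entry_col \<mu> t k"
  shows "(\<Sum>a\<in>t ` column \<mu> j. perm_act \<mu> (Transposition.transpose a k) (ptab \<mu> t)) = ptab \<mu> t"
proof -
  let ?e = "ptab \<mu> t" and ?A = "t ` column \<mu> j" and ?h = "column_height \<mu> j"
  let ?\<tau> = "\<lambda>a b. Transposition.transpose a b :: nat \<Rightarrow> nat"
  define x where "x = ?e - (\<Sum>a\<in>?A. perm_act \<mu> (?\<tau> a k) ?e)"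
  have finA: "finite ?A"
    by (intro finite_imageI finite_subset[OF column_subset finite_diagram])
  have A: "a \<in> {1..sum_list \<mu>}" "entry_col \<mu> t a = j" "a \<noteq> k" if "a \<in> ?A" for a
    using that j unfolding image_column[OF t] by auto
  have e: "?e \<in> perm_module \<mu>"
    by (rule polytabloid_perm_module[OF t])
  have swap: "perm_act \<mu> (?\<tau> a b) ?e = - ?e" if "a \<in> ?A" "b \<in> ?A" "a \<noteq> b" for a b
    using column_alternating_transpose[OF column_alternating_polytabloid[OF t] t] A[OF that(1)] A[OF that(2)] that(3)
    by simp
  have group: "p - (e + - r) = - (e - (p + r))" "- e - - r = - (e - r)" for p e r :: "tabloid \<Rightarrow> rat"
    by (auto simp: fun_eq_iff)
  have Y: "insert k ?A \<subseteq> {1..sum_list \<mu>}"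
    using A(1) k by blast
  \<comment> \<open>The transposition of \<open>b\<close> and \<open>k\<close> exchanges
    \<open>?e\<close> with the term for \<open>b\<close>. Each other term is negated: by conjugation
    the transposition turns into one inside the column, which negates \<open>?e\<close>.\<close>
  have swap_k: "perm_act \<mu> (?\<tau> b k) x = - x" if b: "b \<in> ?A" for b
  proof -
    have "perm_act \<mu> (?\<tau> b k) x
        = perm_act \<mu> (?\<tau> b k) ?e - (\<Sum>a\<in>?A. perm_act \<mu> (?\<tau> b k) (perm_act \<mu> (?\<tau> a k) ?e))"
      unfolding x_def by (simp only: perm_act_diff perm_act_sum)
    also have "(\<Sum>a\<in>?A. perm_act \<mu> (?\<tau> b k) (perm_act \<mu> (?\<tau> a k) ?e))
        = ?e + (\<Sum>a\<in>?A - {b}. perm_act \<mu> (?\<tau> b k) (perm_act \<mu> (?\<tau> a k) ?e))"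
      unfolding sum.remove[OF finA b] perm_act_transpose_twice[OF A(1)[OF b] k e] ..
    also have "(\<Sum>a\<in>?A - {b}. perm_act \<mu> (?\<tau> b k) (perm_act \<mu> (?\<tau> a k) ?e))
        = (\<Sum>a\<in>?A - {b}. - perm_act \<mu> (?\<tau> a k) ?e)"
    proof (rule sum.cong[OF refl])
      fix a assume "a \<in> ?A - {b}"
      then have a: "a \<in> ?A" "a \<noteq> b"
        by auto
      have "perm_act \<mu> (?\<tau> a k) (perm_act \<mu> (?\<tau> a b) ?e)
          = perm_act \<mu> (?\<tau> (?\<tau> a k a) (?\<tau> a k b)) (perm_act \<mu> (?\<tau> a k) ?e)"
        by (rule perm_act_transpose[OF permutes_swap_id[OF A(1)[OF a(1)] k] A(1)[OF a(1)] A(1)[OF b]])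
      moreover have "?\<tau> a k a = k" "?\<tau> a k b = b"
        using a(2) A(3)[OF b] by (simp_all add: transpose_def)
      ultimately have "perm_act \<mu> (?\<tau> k b) (perm_act \<mu> (?\<tau> a k) ?e) = perm_act \<mu> (?\<tau> a k) (perm_act \<mu> (?\<tau> a b) ?e)"
        by simp
      also have "\<dots> = - perm_act \<mu> (?\<tau> a k) ?e"
        unfolding swap[OF a(1) b a(2)] by (rule perm_act_uminus)
      finally show "perm_act \<mu> (?\<tau> b k) (perm_act \<mu> (?\<tau> a k) ?e) = - perm_act \<mu> (?\<tau> a k) ?e"
        by (simp only: transpose_commute)
    qed
    also have "perm_act \<mu> (?\<tau> b k) ?e - (?e + (\<Sum>a\<in>?A - {b}. - perm_act \<mu> (?\<tau> a k) ?e)) = - x"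
      unfolding x_def sum.remove[OF finA b] sum_negf by (rule group)
    finally show ?thesis .
  qed
  have swap_A: "perm_act \<mu> (?\<tau> b c) x = - x" if bc: "b \<in> ?A" "c \<in> ?A" "b \<noteq> c" for b c
  proof -
    have \<tau>A: "?\<tau> b c a \<in> ?A" if "a \<in> ?A" for a
      using that bc by (auto simp: transpose_def)
    have "perm_act \<mu> (?\<tau> b c) x
        = perm_act \<mu> (?\<tau> b c) ?e - (\<Sum>a\<in>?A. perm_act \<mu> (?\<tau> b c) (perm_act \<mu> (?\<tau> a k) ?e))"
      unfolding x_def by (simp only: perm_act_diff perm_act_sum)
    also have "(\<Sum>a\<in>?A. perm_act \<mu> (?\<tau> b c) (perm_act \<mu> (?\<tau> a k) ?e))
        = (\<Sum>a\<in>?A. - perm_act \<mu> (?\<tau> (?\<tau> b c a) k) ?e)"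
    proof (rule sum.cong[OF refl])
      fix a assume a: "a \<in> ?A"
      have "?\<tau> b c k = k"
        using A(3)[OF bc(1)] A(3)[OF bc(2)] by (simp add: transpose_def)
      then show "perm_act \<mu> (?\<tau> b c) (perm_act \<mu> (?\<tau> a k) ?e) = - perm_act \<mu> (?\<tau> (?\<tau> b c a) k) ?e"
        unfolding perm_act_transpose[OF permutes_swap_id[OF A(1)[OF bc(1)] A(1)[OF bc(2)]] A(1)[OF a] k]
          swap[OF bc] perm_act_uminus by simp
    qed
    also have "\<dots> = - (\<Sum>a\<in>?A. perm_act \<mu> (?\<tau> (?\<tau> b c a) k) ?e)"
      by (rule sum_negf)
    also have "(\<Sum>a\<in>?A. perm_act \<mu> (?\<tau> (?\<tau> b c a) k) ?e) = (\<Sum>a\<in>?A. perm_act \<mu> (?\<tau> a k) ?e)"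
      by (rule sum.reindex_bij_witness[where i = "?\<tau> b c" and j = "?\<tau> b c"]) (use \<tau>A in \<open>simp_all only: transpose_involutory\<close>)
    also have "perm_act \<mu> (?\<tau> b c) ?e - - (\<Sum>a\<in>?A. perm_act \<mu> (?\<tau> a k) ?e) = - x"
      unfolding x_def swap[OF bc] by (rule group)
    finally show ?thesis .
  qed
  have "x \<in> perm_module \<mu>"
    unfolding x_def using e perm_act_in
    by (intro tabloid_space.subspace_diff tabloid_space.subspace_sum subspace_perm_module)
  moreover have "x (tabloid \<mu> s) = 0" if s: "s \<in> tableaux \<mu>" for s
  proof (cases "inj_on (entry_row \<mu> s) (insert k ?A)")
    case False
    then obtain y z where yz: "y \<in> insert k ?A" "z \<in> insert k ?A" "y \<noteq> z" "entry_row \<mu> s y = entry_row \<mu> s z"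
      unfolding inj_on_def by blast
    have N: "y \<in> {1..sum_list \<mu>}" "z \<in> {1..sum_list \<mu>}"
      using subsetD[OF Y] yz(1,2) by simp_all
    have "perm_act \<mu> (?\<tau> y z) x = - x"
    proof (cases "y = k \<or> z = k")
      case True
      then show ?thesis
      proof
        assume "y = k"
        then have "z \<in> ?A"
          using yz(2,3) by blast
        from swap_k[OF this] show ?thesis
          unfolding \<open>y = k\<close> transpose_commute[of k z] .
      next
        assume "z = k"
        then have "y \<in> ?A"
          using yz(1,3) by blast
        from swap_k[OF this] show ?thesis
          unfolding \<open>z = k\<close> .
      qed
    next
      case False
      then show ?thesis
        using yz(1-3) swap_A[of y z] by blast
    qed
    then show ?thesis
      by (rule vanish_if_transpose_fixes[OF s N yz(4)])
  next
    case inj: True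
    show ?thesis
    proof (rule ccontr)
      assume "x (tabloid \<mu> s) \<noteq> 0"
      moreover have "x (tabloid \<mu> s) = ?e (tabloid \<mu> s) - (\<Sum>a\<in>?A. perm_act \<mu> (?\<tau> a k) ?e (tabloid \<mu> s))"
        unfolding x_def fun_diff_def sum_fun_eq ..
      ultimately have "?e (tabloid \<mu> s) \<noteq> 0 \<or> (\<exists>a\<in>?A. perm_act \<mu> (?\<tau> a k) ?e (tabloid \<mu> s) \<noteq> 0)"
        using sum.neutral[of ?A "\<lambda>a. perm_act \<mu> (?\<tau> a k) ?e (tabloid \<mu> s)"] by (metis diff_0_right)
      \<comment> \<open>A nonzero coefficient stems from \<open>?e\<close> or from one transposed
        copy. Either way \<open>?e\<close> is nonzero at a tabloid obtained from \<open>s\<close> by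
        a permutation that preserves the set of entries under consideration.\<close>
      then obtain \<tau> where \<tau>: "entry_perm \<mu> \<tau>" "\<And>y. y \<in> insert k ?A \<Longrightarrow> \<tau> y \<in> insert k ?A"
        "?e (tabloid \<mu> (act \<mu> \<tau> s)) \<noteq> 0"
      proof
        assume nz: "?e (tabloid \<mu> s) \<noteq> 0"
        show thesis
          by (rule that[of id]) (use nz in \<open>simp_all add: permutes_id act_id[OF s]\<close>)
      next
        assume "\<exists>a\<in>?A. perm_act \<mu> (?\<tau> a k) ?e (tabloid \<mu> s) \<noteq> 0"
        then obtain a where a: "a \<in> ?A" "perm_act \<mu> (?\<tau> a k) ?e (tabloid \<mu> s) \<noteq> 0"
          by blast
        note p = permutes_swap_id[OF A(1)[OF a(1)] k]
        show thesis
        proof (rule that[OF p])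
          show "?\<tau> a k y \<in> insert k ?A" if "y \<in> insert k ?A" for y
            using that a(1) by (auto simp: transpose_def)
          show "?e (tabloid \<mu> (act \<mu> (?\<tau> a k) s)) \<noteq> 0"
            using a(2) unfolding perm_act_tabloid[OF s p] by simp
        qed
      qed
      have "entry_row \<mu> s ` insert k ?A \<subseteq> {..<?h}"
      proof
        fix i assume "i \<in> entry_row \<mu> s ` insert k ?A"
        then obtain y where y: "y \<in> insert k ?A" "i = entry_row \<mu> s y"
          by blast
        have yN: "y \<in> {1..sum_list \<mu>}" "\<tau> y \<in> {1..sum_list \<mu>}"
          using subsetD[OF Y] y(1) \<tau>(2)[OF y(1)] by simp_all
        have "i = entry_row \<mu> (act \<mu> \<tau> s) (\<tau> y)"
          unfolding entry_row_act[OF s \<tau>(1) yN(1)] by (rule y(2))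
        also have "\<dots> < column_height \<mu> (entry_col \<mu> t (\<tau> y))"
          by (rule polytabloid_row_bound[OF sorted t act_tableau[OF s \<tau>(1)] \<tau>(3) yN(2)])
        also have "\<dots> \<le> ?h"
          using \<tau>(2)[OF y(1)] A(2) j by (intro column_height_mono[OF sorted]) auto
        finally show "i \<in> {..<?h}"
          by simp
      qed
      from card_inj_on_le[OF inj this] have "card (insert k ?A) \<le> ?h"
        by simp
      moreover have "k \<notin> ?A"
        using A(3) by blast
      ultimately show False
        using card_column_image[OF t, of j] finA by simp
    qed
  qed
  moreover have "(0 :: tabloid \<Rightarrow> rat) \<in> perm_module \<mu>"
    by (simp add: perm_module_def)
  ultimately have "x = 0"
    by (intro perm_module_eqI[of _ \<mu>]) simp_all
  then show ?thesis
    unfolding x_def right_minus_eq by (rule sym)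
qed

section \<open>Jucys-Murphy elements\<close>

definition col_less :: "nat \<times> nat \<Rightarrow> nat \<times> nat \<Rightarrow> bool" where
  "col_less x y \<longleftrightarrow> snd x < snd y \<or> snd x = snd y \<and> fst x < fst y"

definition column_reading :: "nat list \<Rightarrow> tableau" where
  "column_reading \<mu> = restrict (\<lambda>x. Suc (card {y \<in> diagram \<mu>. col_less y x})) (diagram \<mu>)"

lemma card_diagram: "card (diagram \<mu>) = sum_list \<mu>"
proof -
  have "diagram \<mu> = (SIGMA i:{..<length \<mu>}. {..<\<mu> ! i})"
    by (auto simp: diagram_def)
  then show ?thesis
    by (simp add: sum_list_sum_nth atLeast0LessThan)
qed

lemma column_reading_less:
  assumes "x \<in> diagram \<mu>" "y \<in> diagram \<mu>" "col_less x y"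
  shows "column_reading \<mu> x < column_reading \<mu> y"
proof -
  have "{z \<in> diagram \<mu>. col_less z x} \<subset> {z \<in> diagram \<mu>. col_less z y}"
    using assms by (auto simp: col_less_def)
  then have "card {z \<in> diagram \<mu>. col_less z x} < card {z \<in> diagram \<mu>. col_less z y}"
    by (intro psubset_card_mono) (simp_all add: finite_diagram)
  then show ?thesis
    using assms by (simp add: column_reading_def)
qed

lemma col_less_total: "x \<noteq> y \<Longrightarrow> col_less x y \<or> col_less y x"
  by (cases x; cases y) (auto simp: col_less_def)

lemma column_reading_less_iff:
  assumes "x \<in> diagram \<mu>" "y \<in> diagram \<mu>"
  shows "column_reading \<mu> x < column_reading \<mu> y \<longleftrightarrow> col_less x y"
  using column_reading_less[OF assms] column_reading_less[OF assms(2,1)] col_less_total[of x y]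
  by (cases "x = y") (auto simp: col_less_def)

lemma column_reading_tableau: "column_reading \<mu> \<in> tableaux \<mu>"
proof -
  have inj: "inj_on (column_reading \<mu>) (diagram \<mu>)"
  proof (intro inj_onI, rule ccontr)
    fix x y assume xy: "x \<in> diagram \<mu>" "y \<in> diagram \<mu>" "column_reading \<mu> x = column_reading \<mu> y" "x \<noteq> y"
    then show False
      using column_reading_less[OF xy(1,2)] column_reading_less[OF xy(2,1)] col_less_total[OF xy(4)] by auto
  qed
  have "column_reading \<mu> ` diagram \<mu> \<subseteq> {1..sum_list \<mu>}"
  proof
    fix k assume "k \<in> column_reading \<mu> ` diagram \<mu>"
    then obtain x where x: "x \<in> diagram \<mu>" "k = column_reading \<mu> x"
      by blast
    have "{y \<in> diagram \<mu>. col_less y x} \<subset> diagram \<mu>"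
      using x(1) by (auto simp: col_less_def)
    then have "card {y \<in> diagram \<mu>. col_less y x} < card (diagram \<mu>)"
      by (intro psubset_card_mono finite_diagram)
    then show "k \<in> {1..sum_list \<mu>}"
      using x by (simp add: column_reading_def card_diagram)
  qed
  then have "column_reading \<mu> ` diagram \<mu> = {1..sum_list \<mu>}"
    by (intro card_subset_eq) (simp_all add: card_image[OF inj] card_diagram)
  with inj show ?thesis
    by (simp add: tableaux_def bij_betw_def column_reading_def)
qed

lemma column_reading_standard: "column_reading \<mu> \<in> standard_tableaux \<mu>"
  using column_reading_tableau column_reading_less
  by (auto simp: standard_tableaux_def col_less_def)

section \<open>Action of the Jucys-Murphy elements on the permutation module\<close>

definition jucys_murphy :: "nat list \<Rightarrow> nat \<Rightarrow> (tabloid \<Rightarrow> rat) \<Rightarrow> tabloid \<Rightarrow> rat" where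
  "jucys_murphy \<mu> k x = (\<Sum>a\<in>{1..<k}. perm_act \<mu> (Transposition.transpose a k) x)"

definition entry_content :: "nat list \<Rightarrow> tableau \<Rightarrow> nat \<Rightarrow> int" where
  "entry_content \<mu> t k = cell_content (inv_into (diagram \<mu>) t k)"

lemma entry_content_tableau:
  "t \<in> tableaux \<mu> \<Longrightarrow> x \<in> diagram \<mu> \<Longrightarrow> entry_content \<mu> t (t x) = cell_content x"
  by (simp add: entry_content_def inv_into_tableau)

text \<open>The entries below \<open>k\<close> fill all columns to the left completely and the part
  of its own column above it. By the Garnir relation each full column contributes 1, and each entry
  above contributes -1 by alternation. The eigenvalue is the column index minus the row
  index.\<close>

lemma jucys_murphy_column_reading:
  assumes sorted: "sorted_wrt (\<ge>) \<mu>" and k: "k \<in> {1..sum_list \<mu>}"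
  shows "jucys_murphy \<mu> k (ptab \<mu> (column_reading \<mu>))
    = (\<lambda>X. of_int (entry_content \<mu> (column_reading \<mu>) k) * ptab \<mu> (column_reading \<mu>) X)"
proof
  fix X
  let ?t = "column_reading \<mu>" and ?D = "diagram \<mu>"
  let ?e = "ptab \<mu> ?t"
  let ?F = "\<lambda>a. perm_act \<mu> (Transposition.transpose a k) ?e"
  note t = column_reading_tableau[of \<mu>]
  obtain x where x: "x \<in> ?D" "?t x = k"
    using tableau_cell[OF t k] .
  obtain i j where ij: "x = (i, j)"
    by (cases x)
  have col: "entry_col \<mu> ?t k = j"
    using entry_col_tableau[OF t x(1)] x(2) ij by simp
  let ?S1 = "{y \<in> ?D. snd y < j}" and ?S2 = "{y \<in> ?D. snd y = j \<and> fst y < i}"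
  have inj: "inj_on ?t A" if "A \<subseteq> ?D" for A
    by (rule inj_on_subset[OF tableau_inj[OF t] that])
  have "{1..<k} = ?t ` {y \<in> ?D. col_less y x}"
  proof (intro equalityI subsetI)
    fix a assume a: "a \<in> {1..<k}"
    then have "a \<in> {1..sum_list \<mu>}"
      using k by auto
    then obtain y where y: "y \<in> ?D" "?t y = a"
      using tableau_cell[OF t] by blast
    then show "a \<in> ?t ` {y \<in> ?D. col_less y x}"
      using column_reading_less_iff[OF y(1) x(1)] a x(2) by auto
  next
    fix a assume "a \<in> ?t ` {y \<in> ?D. col_less y x}"
    then obtain y where y: "y \<in> ?D" "col_less y x" "a = ?t y"
      by blast
    then show "a \<in> {1..<k}"
      using column_reading_less[OF y(1) x(1) y(2)] tableau_range[OF t y(1)] x(2) by simp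
  qed
  also have "{y \<in> ?D. col_less y x} = ?S1 \<union> ?S2"
    by (auto simp: col_less_def ij)
  finally have "jucys_murphy \<mu> k ?e X = (\<Sum>a\<in>?t ` (?S1 \<union> ?S2). ?F a X)"
    unfolding jucys_murphy_def sum_fun_eq by simp
  also have "\<dots> = (\<Sum>y\<in>?S1 \<union> ?S2. ?F (?t y) X)"
    by (subst sum.reindex[OF inj]) auto
  also have "\<dots> = (\<Sum>y\<in>?S1. ?F (?t y) X) + (\<Sum>y\<in>?S2. ?F (?t y) X)"
    by (rule sum.union_disjoint) (auto simp: finite_diagram)
  also have "(\<Sum>y\<in>?S1. ?F (?t y) X) = (\<Sum>l<j. \<Sum>y\<in>{y \<in> ?S1. snd y = l}. ?F (?t y) X)"
    by (rule sum.group[symmetric]) (auto simp: finite_diagram)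
  also have "\<dots> = (\<Sum>l<j. ?e X)"
  proof (rule sum.cong[OF refl])
    fix l assume l: "l \<in> {..<j}"
    have "{y \<in> ?S1. snd y = l} = column \<mu> l"
      using l by (auto simp: column_def)
    then have "(\<Sum>y\<in>{y \<in> ?S1. snd y = l}. ?F (?t y) X) = (\<Sum>a\<in>?t ` column \<mu> l. ?F a X)"
      by (simp add: sum.reindex[OF inj[OF column_subset]])
    also have "\<dots> = ?e X"
      using fun_cong[OF garnir_single[OF sorted t k, of l], of X] l col by (simp add: sum_fun_eq)
    finally show "(\<Sum>y\<in>{y \<in> ?S1. snd y = l}. ?F (?t y) X) = ?e X" .
  qed
  also have "(\<Sum>y\<in>?S2. ?F (?t y) X) = (\<Sum>y\<in>?S2. - ?e X)"
  proof (rule sum.cong[OF refl])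
    fix y assume "y \<in> ?S2"
    then have y: "y \<in> ?D" "snd y = j" "y \<noteq> x"
      by (cases y; auto simp: ij)+
    have "?t y \<noteq> k"
      using inj_onD[OF tableau_inj[OF t] _ y(1) x(1)] x(2) y(3) by auto
    then have "?F (?t y) = - ?e"
      using tableau_range[OF t y(1)] k entry_col_tableau[OF t y(1)] col y(2)
      by (intro column_alternating_transpose[OF column_alternating_polytabloid[OF t] t]) simp_all
    then show "?F (?t y) X = - ?e X"
      by (simp add: fun_Compl_def)
  qed
  also have "?S2 = (\<lambda>i'. (i', j)) ` {..<i}"
  proof -
    have "(i', j) \<in> ?D" if "i' < i" for i'
      using that x(1) diagram_column_iff[OF sorted] unfolding ij by auto
    then show ?thesis
      by auto
  qed
  also have "(\<Sum>y\<in>(\<lambda>i'. (i', j)) ` {..<i}. - ?e X) = - (of_nat i * ?e X)"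
    by (subst sum.reindex) (auto simp: inj_on_def)
  also have "(\<Sum>l<j. ?e X) + - (of_nat i * ?e X) = of_int (int j - int i) * ?e X"
    by (simp add: algebra_simps)
  also have "int j - int i = entry_content \<mu> ?t k"
    using entry_content_tableau[OF t x(1)] x(2) by (simp add: ij cell_content_def)
  finally show "jucys_murphy \<mu> k ?e X = of_int (entry_content \<mu> ?t k) * ?e X" .
qed

lemma jucys_murphy_in: "jucys_murphy \<mu> k x \<in> perm_module \<mu>"
  unfolding jucys_murphy_def
  by (intro tabloid_space.subspace_sum subspace_perm_module perm_act_in)

text \<open>Each transposition is an isometry and an involution, hence self-adjoint.\<close>

lemma jucys_murphy_selfadjoint:
  assumes "k \<in> {1..sum_list \<mu>}" "x \<in> perm_module \<mu>" "y \<in> perm_module \<mu>"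
  shows "tabloid_form \<mu> (jucys_murphy \<mu> k x) y = tabloid_form \<mu> x (jucys_murphy \<mu> k y)"
proof -
  have "tabloid_form \<mu> (perm_act \<mu> (Transposition.transpose a k) x) y
      = tabloid_form \<mu> x (perm_act \<mu> (Transposition.transpose a k) y)" if "a \<in> {1..<k}" for a
  proof -
    have a: "a \<in> {1..sum_list \<mu>}"
      using that assms(1) by auto
    have "tabloid_form \<mu> (perm_act \<mu> (Transposition.transpose a k) x) y
        = tabloid_form \<mu> (perm_act \<mu> (Transposition.transpose a k) x)
            (perm_act \<mu> (Transposition.transpose a k) (perm_act \<mu> (Transposition.transpose a k) y))"
      by (simp only: perm_act_transpose_twice[OF a assms(1,3)])
    then show ?thesis
      by (simp only: tabloid_form_perm_act[OF permutes_swap_id[OF a assms(1)]])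
  qed
  then show ?thesis
    unfolding jucys_murphy_def tabloid_form_sum_left tabloid_form_sum_right by (rule sum.cong[OF refl])
qed

lemma transpose_Suc_perm: "1 \<le> i \<Longrightarrow> i < sum_list \<mu> \<Longrightarrow> entry_perm \<mu> (Transposition.transpose i (Suc i))"
  by (rule permutes_swap_id) auto

lemma jucys_murphy_transpose_other:
  assumes i: "1 \<le> i" "i < sum_list \<mu>" and k: "k \<in> {1..sum_list \<mu>}" "k \<noteq> i" "k \<noteq> Suc i"
  shows "jucys_murphy \<mu> k (perm_act \<mu> (Transposition.transpose i (Suc i)) x)
    = perm_act \<mu> (Transposition.transpose i (Suc i)) (jucys_murphy \<mu> k x)"
proof -
  let ?s = "Transposition.transpose i (Suc i) :: nat \<Rightarrow> nat"
  note p = transpose_Suc_perm[OF i]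
  have sk: "?s k = k"
    using k by (simp add: transpose_def)
  have "perm_act \<mu> ?s (jucys_murphy \<mu> k x)
      = (\<Sum>a\<in>{1..<k}. perm_act \<mu> ?s (perm_act \<mu> (Transposition.transpose a k) x))"
    unfolding jucys_murphy_def by (rule perm_act_sum)
  also have "\<dots> = (\<Sum>a\<in>{1..<k}. perm_act \<mu> (Transposition.transpose (?s a) k) (perm_act \<mu> ?s x))"
  proof (rule sum.cong[OF refl])
    fix a assume "a \<in> {1..<k}"
    then have "a \<in> {1..sum_list \<mu>}"
      using k(1) by auto
    from perm_act_transpose[OF p this k(1)]
    show "perm_act \<mu> ?s (perm_act \<mu> (Transposition.transpose a k) x)
        = perm_act \<mu> (Transposition.transpose (?s a) k) (perm_act \<mu> ?s x)"
      by (simp only: sk)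
  qed
  also have "\<dots> = (\<Sum>a\<in>{1..<k}. perm_act \<mu> (Transposition.transpose a k) (perm_act \<mu> ?s x))"
  proof (rule sum.reindex_bij_witness[where i = ?s and j = ?s])
    fix a assume "a \<in> {1..<k}"
    then show "?s a \<in> {1..<k}"
      using i k by (auto simp: transpose_def)
    then show "?s a \<in> {1..<k}" .
  qed (simp_all only: transpose_involutory)
  finally show ?thesis
    by (simp only: jucys_murphy_def)
qed

text \<open>Conjugation by the adjacent transposition carries the summands of the element for
  \<open>i\<close> to those for \<open>Suc i\<close>, except for the transposition itself, which
  acts as an involution and leaves the extra \<open>x\<close>.\<close>

lemma jucys_murphy_transpose_Suc:
  assumes i: "1 \<le> i" "i < sum_list \<mu>" and x: "x \<in> perm_module \<mu>"
  shows "jucys_murphy \<mu> (Suc i) (perm_act \<mu> (Transposition.transpose i (Suc i)) x)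
    = perm_act \<mu> (Transposition.transpose i (Suc i)) (jucys_murphy \<mu> i x) + x"
proof -
  let ?s = "Transposition.transpose i (Suc i) :: nat \<Rightarrow> nat"
  note p = transpose_Suc_perm[OF i]
  have N: "i \<in> {1..sum_list \<mu>}" "Suc i \<in> {1..sum_list \<mu>}"
    using i by auto
  have "perm_act \<mu> ?s (jucys_murphy \<mu> i x)
      = (\<Sum>a\<in>{1..<i}. perm_act \<mu> ?s (perm_act \<mu> (Transposition.transpose a i) x))"
    unfolding jucys_murphy_def by (rule perm_act_sum)
  also have "\<dots> = (\<Sum>a\<in>{1..<i}. perm_act \<mu> (Transposition.transpose a (Suc i)) (perm_act \<mu> ?s x))"
  proof (rule sum.cong[OF refl])
    fix a assume a: "a \<in> {1..<i}"
    then have "a \<in> {1..sum_list \<mu>}"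
      using i by auto
    moreover have "?s a = a" "?s i = Suc i"
      using a by (auto simp: transpose_def)
    ultimately show "perm_act \<mu> ?s (perm_act \<mu> (Transposition.transpose a i) x)
        = perm_act \<mu> (Transposition.transpose a (Suc i)) (perm_act \<mu> ?s x)"
      using perm_act_transpose[OF p, of a i x] N(1) by (simp only:)
  qed
  finally have 1: "perm_act \<mu> ?s (jucys_murphy \<mu> i x)
      = (\<Sum>a\<in>{1..<i}. perm_act \<mu> (Transposition.transpose a (Suc i)) (perm_act \<mu> ?s x))" .
  have "{1..<Suc i} = insert i {1..<i}"
    using i by auto
  then have "jucys_murphy \<mu> (Suc i) (perm_act \<mu> ?s x) = perm_act \<mu> ?s (perm_act \<mu> ?s x)
      + (\<Sum>a\<in>{1..<i}. perm_act \<mu> (Transposition.transpose a (Suc i)) (perm_act \<mu> ?s x))"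
    unfolding jucys_murphy_def by simp
  then show ?thesis
    unfolding 1 perm_act_transpose_twice[OF N x] by (simp only: add.commute)
qed

lemma jucys_murphy_transpose_self:
  assumes i: "1 \<le> i" "i < sum_list \<mu>" and x: "x \<in> perm_module \<mu>"
  shows "jucys_murphy \<mu> i (perm_act \<mu> (Transposition.transpose i (Suc i)) x)
    = perm_act \<mu> (Transposition.transpose i (Suc i)) (jucys_murphy \<mu> (Suc i) x) - x"
proof -
  let ?s = "Transposition.transpose i (Suc i) :: nat \<Rightarrow> nat"
  have N: "i \<in> {1..sum_list \<mu>}" "Suc i \<in> {1..sum_list \<mu>}"
    using i by auto
  have "jucys_murphy \<mu> (Suc i) x = jucys_murphy \<mu> (Suc i) (perm_act \<mu> ?s (perm_act \<mu> ?s x))"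
    unfolding perm_act_transpose_twice[OF N x] ..
  also have "\<dots> = perm_act \<mu> ?s (jucys_murphy \<mu> i (perm_act \<mu> ?s x)) + perm_act \<mu> ?s x"
    by (rule jucys_murphy_transpose_Suc[OF i perm_act_in])
  finally have "perm_act \<mu> ?s (jucys_murphy \<mu> (Suc i) x)
      = perm_act \<mu> ?s (perm_act \<mu> ?s (jucys_murphy \<mu> i (perm_act \<mu> ?s x)) + perm_act \<mu> ?s x)"
    by (rule arg_cong)
  also have "\<dots> = jucys_murphy \<mu> i (perm_act \<mu> ?s x) + x"
    unfolding perm_act_add perm_act_transpose_twice[OF N x] perm_act_transpose_twice[OF N jucys_murphy_in] ..
  finally show ?thesis
    by (simp only: add_diff_cancel_right')
qed

section \<open>Consecutive entries, contents and admissible swaps\<close>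

lemma standard_tableau_mono:
  assumes sorted: "sorted_wrt (\<ge>) \<mu>" and t: "t \<in> standard_tableaux \<mu>"
    and xy: "x \<in> diagram \<mu>" "y \<in> diagram \<mu>" "fst x \<le> fst y" "snd x \<le> snd y" "x \<noteq> y"
  shows "t x < t y"
proof -
  obtain i j i' j' where x: "x = (i, j)" and y: "y = (i', j')"
    by (cases x; cases y)
  have le: "i \<le> i'" "j \<le> j'"
    using xy by (auto simp: x y)
  have D: "(i, j') \<in> diagram \<mu>"
    using xy(2) le(1) unfolding y diagram_column_iff[OF sorted] by simp
  have "t (i, j) \<le> t (i, j')" if "(i, j) \<in> diagram \<mu>"
    using standard_tableauD(2)[OF t that D] le(2) by (cases "j = j'") auto
  moreover have "t (i, j') \<le> t (i', j')" if "(i', j') \<in> diagram \<mu>"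
    using standard_tableauD(3)[OF t D that] le(1) by (cases "i = i'") auto
  ultimately have "t x \<le> t y"
    using xy(1,2) by (auto simp: x y)
  moreover have "t x \<noteq> t y"
    using inj_onD[OF tableau_inj[OF standard_tableauD(1)[OF t]] _ xy(1,2)] xy(5) by blast
  ultimately show ?thesis
    by simp
qed

lemma standard_swap:
  assumes t: "t \<in> standard_tableaux \<mu>" and xy: "x \<in> diagram \<mu>" "y \<in> diagram \<mu>" "t y = Suc (t x)"
    and ne: "fst x \<noteq> fst y" "snd x \<noteq> snd y"
  shows "act \<mu> (Transposition.transpose (t x) (Suc (t x))) t \<in> standard_tableaux \<mu>"
proof -
  note tt = standard_tableauD(1)[OF t]
  let ?s = "Transposition.transpose (t x) (Suc (t x)) :: nat \<Rightarrow> nat"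
  have N: "t x \<in> {1..sum_list \<mu>}" "Suc (t x) \<in> {1..sum_list \<mu>}"
    using tableau_range[OF tt xy(1)] tableau_range[OF tt xy(2)] xy(3) by auto
  have mono: "?s (t u) < ?s (t v)"
    if uv: "u \<in> diagram \<mu>" "v \<in> diagram \<mu>" "t u < t v" "fst u = fst v \<or> snd u = snd v" for u v
  proof -
    have "\<not> (t u = t x \<and> t v = Suc (t x))"
    proof
      assume "t u = t x \<and> t v = Suc (t x)"
      then have "u = x" "v = y"
        using inj_onD[OF tableau_inj[OF tt] _ uv(1) xy(1)] inj_onD[OF tableau_inj[OF tt] _ uv(2) xy(2)] xy(3)
        by auto
      with uv(4) ne show False
        by auto
    qed
    with uv(3) show ?thesis
      by (auto simp: transpose_def)
  qed
  have "act \<mu> ?s t \<in> tableaux \<mu>"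
    by (rule act_tableau[OF tt permutes_swap_id[OF N]])
  moreover have "act \<mu> ?s t (i, j) < act \<mu> ?s t (i, j')"
    if "(i, j) \<in> diagram \<mu>" "(i, j') \<in> diagram \<mu>" "j < j'" for i j j'
    using mono[OF that(1,2) standard_tableauD(2)[OF t that]] that(1,2) by (simp add: act_apply)
  moreover have "act \<mu> ?s t (i, j) < act \<mu> ?s t (i', j)"
    if "(i, j) \<in> diagram \<mu>" "(i', j) \<in> diagram \<mu>" "i < i'" for i i' j
    using mono[OF that(1,2) standard_tableauD(3)[OF t that]] that(1,2) by (simp add: act_apply)
  ultimately show ?thesis
    unfolding standard_tableaux_def by blast
qed

lemma consecutive_same_row:
  assumes sorted: "sorted_wrt (\<ge>) \<mu>" and t: "t \<in> standard_tableaux \<mu>"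
    and xy: "x \<in> diagram \<mu>" "y \<in> diagram \<mu>" "t y = Suc (t x)" and row: "fst x = fst y"
  shows "cell_content y - cell_content x = 1"
proof -
  obtain i j j' where x: "x = (i, j)" and y: "y = (i, j')"
    using row by (cases x; cases y) auto
  have "y \<noteq> x"
    using xy(3) by auto
  then have "\<not> j' \<le> j"
    using standard_tableau_mono[OF sorted t xy(2,1)] xy(3) unfolding x y by fastforce
  moreover have "\<not> Suc j < j'"
  proof
    assume "Suc j < j'"
    moreover from this have D: "(i, Suc j) \<in> diagram \<mu>"
      using xy(2) by (auto simp: y mem_diagram_iff)
    ultimately have "t x < t (i, Suc j)" "t (i, Suc j) < t y"
      using standard_tableauD(2)[OF t] xy(1,2) unfolding x y by blast+
    then show False
      using xy(3) by simp
  qed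
  ultimately have "j' = Suc j"
    by simp
  then show ?thesis
    by (simp add: x y cell_content_def)
qed

lemma consecutive_same_column:
  assumes sorted: "sorted_wrt (\<ge>) \<mu>" and t: "t \<in> standard_tableaux \<mu>"
    and xy: "x \<in> diagram \<mu>" "y \<in> diagram \<mu>" "t y = Suc (t x)" and col: "snd x = snd y"
  shows "cell_content y - cell_content x = - 1"
proof -
  obtain i i' j where x: "x = (i, j)" and y: "y = (i', j)"
    using col by (cases x; cases y) auto
  have "y \<noteq> x"
    using xy(3) by auto
  then have "\<not> i' \<le> i"
    using standard_tableau_mono[OF sorted t xy(2,1)] xy(3) unfolding x y by fastforce
  moreover have "\<not> Suc i < i'"
  proof
    assume "Suc i < i'"
    moreover from this have D: "(Suc i, j) \<in> diagram \<mu>"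
      using xy(2) unfolding y diagram_column_iff[OF sorted] by simp
    ultimately have "t x < t (Suc i, j)" "t (Suc i, j) < t y"
      using standard_tableauD(3)[OF t] xy(1,2) unfolding x y by blast+
    then show False
      using xy(3) by simp
  qed
  ultimately have "i' = Suc i"
    by simp
  then show ?thesis
    by (simp add: x y cell_content_def)
qed

text \<open>If \<open>y\<close> lay strictly below and to the right of \<open>x\<close>, the cell in
  the row of \<open>x\<close> and the column of \<open>y\<close> would hold an entry between two
  consecutive ones; the opposite position contradicts monotonicity. So the cells lie in opposite
  directions across the diagonals, and both coordinates add to the difference.\<close>

lemma consecutive_elsewhere:
  assumes sorted: "sorted_wrt (\<ge>) \<mu>" and t: "t \<in> standard_tableaux \<mu>"
    and xy: "x \<in> diagram \<mu>" "y \<in> diagram \<mu>" "t y = Suc (t x)"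
    and ne: "fst x \<noteq> fst y" "snd x \<noteq> snd y"
  shows "2 \<le> \<bar>cell_content y - cell_content x\<bar>"
proof -
  obtain i j i' j' where x: "x = (i, j)" and y: "y = (i', j')"
    by (cases x; cases y)
  have "y \<noteq> x"
    using ne by auto
  then have 1: "\<not> (i' \<le> i \<and> j' \<le> j)"
    using standard_tableau_mono[OF sorted t xy(2,1)] xy(3) unfolding x y by fastforce
  have 2: "\<not> (i < i' \<and> j < j')"
  proof
    assume lt: "i < i' \<and> j < j'"
    then have D: "(i, j') \<in> diagram \<mu>"
      using xy(2) unfolding y diagram_column_iff[OF sorted] by simp
    have "t x < t (i, j')" "t (i, j') < t y"
      using standard_tableauD(2)[OF t _ D, of j] standard_tableauD(3)[OF t D, of i'] lt xy(1,2) unfolding x y by blast+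
    then show False
      using xy(3) by simp
  qed
  show ?thesis
    using 1 2 ne by (auto simp: x y cell_content_def)
qed

lemma entry_content_act:
  assumes "t \<in> tableaux \<mu>" "entry_perm \<mu> \<pi>" "k \<in> {1..sum_list \<mu>}"
  shows "entry_content \<mu> (act \<mu> \<pi> t) (\<pi> k) = entry_content \<mu> t k"
  by (simp only: entry_content_def inv_into_act[OF assms])

lemma entry_content_swap:
  assumes "t \<in> tableaux \<mu>" "1 \<le> i" "i < sum_list \<mu>" "k \<in> {1..sum_list \<mu>}"
  shows "entry_content \<mu> (act \<mu> (Transposition.transpose i (Suc i)) t) k
    = entry_content \<mu> t (Transposition.transpose i (Suc i) k)"
proof -
  note p = transpose_Suc_perm[OF assms(2,3)]
  have "Transposition.transpose i (Suc i) k \<in> {1..sum_list \<mu>}"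
    using permutes_in_image[OF p] assms(4) by blast
  from entry_content_act[OF assms(1) p this] show ?thesis
    by (simp only: transpose_involutory)
qed

text \<open>Cells of equal content lie on one diagonal and are comparable. If the smallest entry
  placed differently were at \<open>x\<close> in \<open>s\<close> and at \<open>y\<close> in
  \<open>t\<close>, the upper left one of these cells would hold a smaller entry in the other
  tableau, and that entry is already known to agree.\<close>

lemma standard_tableaux_contents_differ:
  assumes sorted: "sorted_wrt (\<ge>) \<mu>" and s: "s \<in> standard_tableaux \<mu>" and t: "t \<in> standard_tableaux \<mu>"
    and ne: "s \<noteq> t"
  shows "\<exists>k\<in>{1..sum_list \<mu>}. entry_content \<mu> s k \<noteq> entry_content \<mu> t k"
proof (rule ccontr)
  assume "\<not> ?thesis"
  then have eq: "entry_content \<mu> s k = entry_content \<mu> t k" if "k \<in> {1..sum_list \<mu>}" for k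
    using that by blast
  note ss = standard_tableauD(1)[OF s] and tt = standard_tableauD(1)[OF t]
  have "\<forall>x\<in>diagram \<mu>. s x = k \<longrightarrow> t x = k" for k
  proof (induction k rule: less_induct)
    case (less k)
    show ?case
    proof (intro ballI impI)
      fix x assume x: "x \<in> diagram \<mu>" "s x = k"
      have k: "k \<in> {1..sum_list \<mu>}"
        using tableau_range[OF ss x(1)] x(2) by simp
      obtain y where y: "y \<in> diagram \<mu>" "t y = k"
        using tableau_cell[OF tt k] .
      have content: "cell_content x = cell_content y"
        using eq[OF k] entry_content_tableau[OF ss x(1)] entry_content_tableau[OF tt y(1)] x(2) y(2) by simp
      have "x = y"
      proof (rule ccontr)
        assume ne: "x \<noteq> y"
        consider "fst x \<le> fst y" "snd x \<le> snd y" | "fst y \<le> fst x" "snd y \<le> snd x"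
          using content by (force simp: cell_content_def)
        then show False
        proof cases
          case 1
          have "t x < k"
            using standard_tableau_mono[OF sorted t x(1) y(1) 1 ne] y(2) by simp
          moreover obtain z where z: "z \<in> diagram \<mu>" "s z = t x"
            using tableau_cell[OF ss tableau_range[OF tt x(1)]] .
          ultimately have "t z = t x"
            using less.IH by blast
          then have "z = x"
            using inj_onD[OF tableau_inj[OF tt] _ z(1) x(1)] by blast
          with z(2) x(2) \<open>t x < k\<close> show False
            by simp
        next
          case 2
          have "s y < k"
            using standard_tableau_mono[OF sorted s y(1) x(1) 2] ne x(2) by auto
          then have "t y = s y"
            using less.IH y(1) by blast
          with y(2) \<open>s y < k\<close> show False
            by simp
        qed
      qed
      with y(2) show "t x = k"
        by simp
    qed
  qed
  then have "s = t"
    by (intro tableau_ext[OF ss tt]) metis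
  with ne show False ..
qed

lemma inversion_product_swap:
  assumes t: "t \<in> tableaux \<mu>" and xy: "x \<in> diagram \<mu>" "y \<in> diagram \<mu>" "t y = Suc (t x)"
    and less: "fst x < fst y"
  shows "inversion_product \<mu> (act \<mu> (Transposition.transpose (t x) (Suc (t x))) t)
    = ((cell_content y - cell_content x)\<^sup>2 - 1) * inversion_product \<mu> t"
proof -
  let ?s = "Transposition.transpose (t x) (Suc (t x)) :: nat \<Rightarrow> nat"
  have inj: "u = x" if "u \<in> diagram \<mu>" "t u = t x" for u
    using inj_onD[OF tableau_inj[OF t] that(2) that(1) xy(1)] .
  have inj': "u = y" if "u \<in> diagram \<mu>" "t u = Suc (t x)" for u
    using inj_onD[OF tableau_inj[OF t] _ that(1) xy(2)] that(2) xy(3) by simp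
  have "?s (t v) < ?s (t u) \<longleftrightarrow> t v < t u \<or> (u, v) = (x, y)"
    if uv: "u \<in> diagram \<mu>" "v \<in> diagram \<mu>" "fst u < fst v" for u v
  proof -
    consider "t u = t x" | "t u = Suc (t x)" | "t u \<noteq> t x" "t u \<noteq> Suc (t x)"
      by blast
    then show ?thesis
    proof cases
      case 1
      then have "u = x"
        using inj uv(1) by blast
      then show ?thesis
        using inj'[OF uv(2)] inj[OF uv(2)] xy(3) uv(3) by (auto simp: transpose_def)
    next
      case 2
      then have "u = y"
        using inj' uv(1) by blast
      moreover have "v \<noteq> x" "v \<noteq> y"
        using uv(3) less \<open>u = y\<close> by auto
      ultimately show ?thesis
        using inj'[OF uv(2)] inj[OF uv(2)] 2 less by (auto simp: transpose_def)
    next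
      case 3
      then show ?thesis
        using uv(3) by (auto simp: transpose_def)
    qed
  qed
  then have "inversions \<mu> (act \<mu> ?s t) = insert (x, y) (inversions \<mu> t)"
    using xy less unfolding inversions_def by (auto simp: act_apply)
  moreover have "(x, y) \<notin> inversions \<mu> t"
    using xy(3) by (simp add: inversions_def)
  ultimately have "inversion_product \<mu> (act \<mu> ?s t) = ((cell_content x - cell_content y)\<^sup>2 - 1) * inversion_product \<mu> t"
    unfolding inversion_product_def by (simp add: finite_inversions)
  then show ?thesis
    by (simp add: power2_commute)
qed

text \<open>The column reading tableau is reached from any standard tableau by admissible swaps that
  increase the correlation \<open>\<Sum>x. t x * column_reading \<mu> x\<close>.\<close>

lemma standard_tableaux_swap_induct:
  assumes sorted: "sorted_wrt (\<ge>) \<mu>" and t: "t \<in> standard_tableaux \<mu>"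
    and base: "P (column_reading \<mu>)"
    and step: "\<And>t i. t \<in> standard_tableaux \<mu> \<Longrightarrow> 1 \<le> i \<Longrightarrow> i < sum_list \<mu> \<Longrightarrow>
      act \<mu> (Transposition.transpose i (Suc i)) t \<in> standard_tableaux \<mu> \<Longrightarrow> P t \<Longrightarrow>
      P (act \<mu> (Transposition.transpose i (Suc i)) t)"
  shows "P t"
proof -
  let ?c = "column_reading \<mu>" and ?D = "diagram \<mu>" and ?n = "sum_list \<mu>"
  note ct = column_reading_tableau[of \<mu>]
  define m where "m t = (\<Sum>x\<in>?D. t x * ?c x)" for t :: tableau
  have bound: "m t \<le> (\<Sum>x\<in>?D. ?n * ?n)" if "t \<in> standard_tableaux \<mu>" for t
    unfolding m_def using tableau_range[OF standard_tableauD(1)[OF that]] tableau_range[OF ct]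
    by (intro sum_mono mult_mono) auto
  show ?thesis
    using t
  proof (induction "(\<Sum>x\<in>?D. ?n * ?n) - m t" arbitrary: t rule: less_induct)
    case less
    note t = less.prems
    note tt = standard_tableauD(1)[OF t]
    show ?case
    proof (cases "\<exists>x\<in>?D. \<exists>y\<in>?D. t y = Suc (t x) \<and> ?c y < ?c x")
      case True
      then obtain x y where xy: "x \<in> ?D" "y \<in> ?D" "t y = Suc (t x)" "?c y < ?c x"
        by blast
      have i: "1 \<le> t x" "t x < ?n"
        using tableau_range[OF tt xy(1)] tableau_range[OF tt xy(2)] xy(3) by auto
      let ?s = "Transposition.transpose (t x) (Suc (t x)) :: nat \<Rightarrow> nat"
      let ?t = "act \<mu> ?s t"
      note p = transpose_Suc_perm[OF i]
      have cl: "col_less y x"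
        using column_reading_less_iff[OF xy(2,1)] xy(4) by simp
      have not_le: "\<not> (fst y \<le> fst x \<and> snd y \<le> snd x)"
      proof
        assume "fst y \<le> fst x \<and> snd y \<le> snd x"
        moreover have "y \<noteq> x"
          using xy(3) by auto
        ultimately have "t y < t x"
          using standard_tableau_mono[OF sorted t xy(2,1)] by blast
        with xy(3) show False
          by simp
      qed
      \<comment> \<open>\<open>y\<close> precedes \<open>x\<close> in column order without lying
        weakly above and to the left, so it lies strictly lower in a column strictly to the
        left.\<close>
      then have "fst x \<noteq> fst y" "snd x \<noteq> snd y"
        using cl by (auto simp: col_less_def)
      from standard_swap[OF t xy(1-3) this] have t': "?t \<in> standard_tableaux \<mu>" .
      \<comment> \<open>The larger entry moves to the cell with the larger column reading number;
        the gain is \<open>?c x - ?c y\<close>.\<close>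
      have "m t < m ?t"
      proof -
        have ne: "x \<noteq> y"
          using xy(4) by auto
        have split: "(\<Sum>z\<in>?D. f z) = (f x + f y) + (\<Sum>z\<in>?D - {x, y}. f z)" for f :: "nat \<times> nat \<Rightarrow> nat"
          using xy(1,2) ne finite_diagram[of \<mu>] by (simp add: sum.subset_diff[of "{x, y}" ?D])
        have "(\<Sum>z\<in>?D - {x, y}. ?t z * ?c z) = (\<Sum>z\<in>?D - {x, y}. t z * ?c z)"
        proof (rule sum.cong[OF refl])
          fix z assume z: "z \<in> ?D - {x, y}"
          then have "t z \<noteq> t x" "t z \<noteq> Suc (t x)"
            using inj_onD[OF tableau_inj[OF tt], of z x] inj_onD[OF tableau_inj[OF tt], of z y] xy(1-3) by auto
          with z show "?t z * ?c z = t z * ?c z"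
            by (simp add: act_apply transpose_def)
        qed
        moreover have "?t x = Suc (t x)" "?t y = t x"
          using xy(1-3) by (simp_all add: act_apply)
        ultimately show ?thesis
          unfolding m_def split using xy(3,4) by simp
      qed
      then have "P ?t"
        using bound[OF t'] by (intro less.hyps[OF _ t']) linarith
      \<comment> \<open>\<open>step\<close> is applied backwards: from the tableau closer to the
        column reading the same swap leads to \<open>t\<close>.\<close>
      moreover have "act \<mu> ?s ?t = t"
        using act_inv_act(1)[OF tt p] by simp
      ultimately show ?thesis
        using step[OF t' i] t by simp
    next
      case False
      have step1: "?c x < ?c y" if "x \<in> ?D" "y \<in> ?D" "t y = Suc (t x)" for x y
      proof -
        have "x \<noteq> y"
          using that(3) by auto
        then have "?c x \<noteq> ?c y"
          using inj_onD[OF tableau_inj[OF ct] _ that(1,2)] by blast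
        moreover have "\<not> ?c y < ?c x"
          using False that by blast
        ultimately show ?thesis
          by simp
      qed
      have step2: "?c x + d \<le> ?c y" if "x \<in> ?D" "y \<in> ?D" "t y = t x + d" for x y d
        using that
      proof (induction d arbitrary: y)
        case 0
        then have "x = y"
          using inj_onD[OF tableau_inj[OF tt], of x y] by simp
        then show ?case
          by simp
      next
        case (Suc d)
        have "t x + d \<in> {1..?n}"
          using tableau_range[OF tt Suc.prems(1)] tableau_range[OF tt Suc.prems(2)] Suc.prems(3) by auto
        then obtain z where z: "z \<in> ?D" "t z = t x + d"
          using tableau_cell[OF tt] by blast
        have "?c x + d \<le> ?c z"
          using Suc.IH[OF Suc.prems(1) z] .
        moreover have "?c z < ?c y"
          using step1[OF z(1) Suc.prems(2)] Suc.prems(3) z(2) by simp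
        ultimately show ?case
          by simp
      qed
      \<comment> \<open>Along the entries of \<open>t\<close> the column reading number grows by at
        least one each time, and both number the cells from 1 to \<open>?n\<close>. Comparison with
        the first and the last entry leaves no slack.\<close>
      have "t x = ?c x" if x: "x \<in> ?D" for x
      proof -
        have pos: "1 \<le> t x" "t x \<le> ?n"
          using tableau_range[OF tt x] by auto
        then have N: "1 \<in> {1..?n}" "?n \<in> {1..?n}"
          by auto
        obtain a where a: "a \<in> ?D" "t a = 1"
          using tableau_cell[OF tt N(1)] .
        obtain b where b: "b \<in> ?D" "t b = ?n"
          using tableau_cell[OF tt N(2)] .
        have "?c a + (t x - 1) \<le> ?c x" "?c x + (?n - t x) \<le> ?c b"
          using step2[OF a(1) x, of "t x - 1"] step2[OF x b(1), of "?n - t x"] a(2) b(2) pos by simp_all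
        moreover have "1 \<le> ?c a" "?c b \<le> ?n"
          using tableau_range[OF ct a(1)] tableau_range[OF ct b(1)] by auto
        ultimately show ?thesis
          using pos by linarith
      qed
      then have "t = ?c"
        by (intro tableau_ext[OF tt ct])
      with base show ?thesis
        by simp
    qed
  qed
qed

section \<open>The seminormal basis\<close>

lemma subspace_specht: "tabloid_space.subspace (specht_module \<mu>)"
  unfolding specht_module_def by (rule tabloid_space.subspace_span)

lemma polytabloid_in_specht: "t \<in> tableaux \<mu> \<Longrightarrow> ptab \<mu> t \<in> specht_module \<mu>"
  unfolding specht_module_def by (intro tabloid_space.span_base imageI)

lemma specht_subset: "specht_module \<mu> \<subseteq> perm_module \<mu>"
  unfolding specht_module_def
  by (intro tabloid_space.span_minimal subspace_perm_module) (auto intro: polytabloid_perm_module)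

lemma subspace_perm_act_vimage:
  assumes "tabloid_space.subspace U"
  shows "tabloid_space.subspace {x. perm_act \<mu> \<pi> x \<in> U}"
  using assms unfolding tabloid_space.subspace_def mem_Collect_eq perm_act_zero perm_act_add perm_act_scale
  by blast

lemma perm_act_specht:
  assumes "entry_perm \<mu> \<pi>" "x \<in> specht_module \<mu>"
  shows "perm_act \<mu> \<pi> x \<in> specht_module \<mu>"
proof -
  have "ptab \<mu> ` tableaux \<mu> \<subseteq> {x. perm_act \<mu> \<pi> x \<in> specht_module \<mu>}"
  proof (intro image_subsetI CollectI)
    fix t assume t: "t \<in> tableaux \<mu>"
    show "perm_act \<mu> \<pi> (ptab \<mu> t) \<in> specht_module \<mu>"
      unfolding perm_act_polytabloid[OF t assms(1)] by (rule polytabloid_in_specht[OF act_tableau[OF t assms(1)]])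
  qed
  then have "specht_module \<mu> \<subseteq> {x. perm_act \<mu> \<pi> x \<in> specht_module \<mu>}"
    unfolding specht_module_def[of \<mu>]
    by (rule tabloid_space.span_minimal[OF _ subspace_perm_act_vimage[OF tabloid_space.subspace_span]])
  with assms(2) show ?thesis
    by blast
qed

text \<open>The eigenvalues are an arbitrary function \<open>c\<close> and not a tableau, because
  intertwining permutes them irrespective of whether the result is the content function of a
  standard tableau.\<close>

definition weight_space :: "nat list \<Rightarrow> (nat \<Rightarrow> int) \<Rightarrow> (tabloid \<Rightarrow> rat) set" where
  "weight_space \<mu> c = {x \<in> specht_module \<mu>.
     \<forall>k\<in>{1..sum_list \<mu>}. jucys_murphy \<mu> k x = (\<lambda>X. of_int (c k) * x X)}"

lemma weight_space_specht: "x \<in> weight_space \<mu> c \<Longrightarrow> x \<in> specht_module \<mu>"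
  by (simp add: weight_space_def)

lemma weight_space_perm_module: "x \<in> weight_space \<mu> c \<Longrightarrow> x \<in> perm_module \<mu>"
  using weight_space_specht specht_subset by blast

lemma weight_space_cong:
  assumes "\<And>k. k \<in> {1..sum_list \<mu>} \<Longrightarrow> c k = c' k"
  shows "weight_space \<mu> c = weight_space \<mu> c'"
  using assms unfolding weight_space_def by (intro Collect_cong conj_cong ball_cong refl) simp

lemma weight_space_orthogonal:
  assumes x: "x \<in> weight_space \<mu> c" and y: "y \<in> weight_space \<mu> c'"
    and k: "k \<in> {1..sum_list \<mu>}" "c k \<noteq> c' k"
  shows "tabloid_form \<mu> x y = 0"
proof -
  have "tabloid_form \<mu> (jucys_murphy \<mu> k x) y = tabloid_form \<mu> x (jucys_murphy \<mu> k y)"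
    by (rule jucys_murphy_selfadjoint[OF k(1) weight_space_perm_module[OF x] weight_space_perm_module[OF y]])
  moreover have "jucys_murphy \<mu> k x = (\<lambda>X. of_int (c k) * x X)" "jucys_murphy \<mu> k y = (\<lambda>X. of_int (c' k) * y X)"
    using x y k(1) unfolding weight_space_def by blast+
  ultimately have "of_int (c k) * tabloid_form \<mu> x y = of_int (c' k) * tabloid_form \<mu> x y"
    by (simp only: tabloid_form_scale_left tabloid_form_scale_right)
  with k(2) show ?thesis
    by simp
qed

lemma jucys_murphy_scale: "jucys_murphy \<mu> k (\<lambda>X. c * x X) = (\<lambda>X. c * jucys_murphy \<mu> k x X)"
  unfolding jucys_murphy_def perm_act_scale by (simp add: fun_eq_iff sum_fun_eq sum_distrib_left)

lemma jucys_murphy_diff: "jucys_murphy \<mu> k (x - y) = jucys_murphy \<mu> k x - jucys_murphy \<mu> k y"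
  unfolding jucys_murphy_def perm_act_diff by (rule sum_subtractf)

text \<open>Young's intertwiner: on a joint eigenvector with different eigenvalues at
  \<open>i\<close> and \<open>Suc i\<close> it removes from the transposed vector its component
  along \<open>x\<close>.\<close>

definition intertwine :: "nat list \<Rightarrow> (nat \<Rightarrow> int) \<Rightarrow> nat \<Rightarrow> (tabloid \<Rightarrow> rat) \<Rightarrow> tabloid \<Rightarrow> rat" where
  "intertwine \<mu> c i x = perm_act \<mu> (Transposition.transpose i (Suc i)) x
     - (\<lambda>X. 1 / of_int (c (Suc i) - c i) * x X)"

lemma scale_specht: "x \<in> specht_module \<mu> \<Longrightarrow> (\<lambda>X. c * x X) \<in> specht_module \<mu>"
  using tabloid_space.subspace_scale[OF subspace_specht] .

lemma perm_act_split:
  "perm_act \<mu> (Transposition.transpose i (Suc i)) x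
    = intertwine \<mu> c i x + (\<lambda>X. 1 / of_int (c (Suc i) - c i) * x X)"
  by (simp add: intertwine_def)

text \<open>The subtracted multiple of \<open>x\<close> cancels exactly the term \<open>x\<close> or
  \<open>- x\<close> that appears when the transposition is moved past the Jucys-Murphy elements for
  \<open>i\<close> and \<open>Suc i\<close>. The other elements commute with the
  transposition.\<close>

lemma intertwine_weight_space:
  assumes x: "x \<in> weight_space \<mu> c" and i: "1 \<le> i" "i < sum_list \<mu>" and ne: "c i \<noteq> c (Suc i)"
  shows "intertwine \<mu> c i x \<in> weight_space \<mu> (c \<circ> Transposition.transpose i (Suc i))"
proof -
  let ?s = "Transposition.transpose i (Suc i) :: nat \<Rightarrow> nat"
  let ?d = "of_int (c (Suc i) - c i) :: rat"
  have d: "?d \<noteq> 0"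
    using ne by simp
  note p = transpose_Suc_perm[OF i]
  note xS = weight_space_specht[OF x] and xM = weight_space_perm_module[OF x]
  have jx: "jucys_murphy \<mu> k x = (\<lambda>X. of_int (c k) * x X)" if "k \<in> {1..sum_list \<mu>}" for k
    using x that unfolding weight_space_def by blast
  have N: "i \<in> {1..sum_list \<mu>}" "Suc i \<in> {1..sum_list \<mu>}"
    using i by auto
  have "intertwine \<mu> c i x \<in> specht_module \<mu>"
    unfolding intertwine_def
    by (intro tabloid_space.subspace_diff subspace_specht perm_act_specht p xS scale_specht)
  moreover have "jucys_murphy \<mu> k (intertwine \<mu> c i x) = (\<lambda>X. of_int (c (?s k)) * intertwine \<mu> c i x X)"
    if k: "k \<in> {1..sum_list \<mu>}" for k
  proof -
    have j: "jucys_murphy \<mu> k (intertwine \<mu> c i x) X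
        = jucys_murphy \<mu> k (perm_act \<mu> ?s x) X - 1 / ?d * (of_int (c k) * x X)" for X
      unfolding intertwine_def jucys_murphy_diff jucys_murphy_scale jx[OF k] minus_apply ..
    have w: "intertwine \<mu> c i x X = perm_act \<mu> ?s x X - 1 / ?d * x X" for X
      unfolding intertwine_def minus_apply ..
    consider "k = i" | "k = Suc i" | "k \<noteq> i" "k \<noteq> Suc i"
      by blast
    then show ?thesis
    proof cases
      case 1
      have e: "jucys_murphy \<mu> k (perm_act \<mu> ?s x) X = of_int (c (Suc i)) * perm_act \<mu> ?s x X - x X" for X
        unfolding 1 jucys_murphy_transpose_self[OF i xM] jx[OF N(2)] perm_act_scale minus_apply ..
      have c: "c k = c i" "c (?s k) = c (Suc i)"
        unfolding 1 by simp_all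
      show ?thesis
        unfolding fun_eq_iff j w e c using d by (auto simp: field_simps)
    next
      case 2
      have e: "jucys_murphy \<mu> k (perm_act \<mu> ?s x) X = of_int (c i) * perm_act \<mu> ?s x X + x X" for X
        unfolding 2 jucys_murphy_transpose_Suc[OF i xM] jx[OF N(1)] perm_act_scale plus_fun_apply ..
      have c: "c k = c (Suc i)" "c (?s k) = c i"
        unfolding 2 by simp_all
      show ?thesis
        unfolding fun_eq_iff j w e c using d by (auto simp: field_simps)
    next
      case 3
      have e: "jucys_murphy \<mu> k (perm_act \<mu> ?s x) X = of_int (c k) * perm_act \<mu> ?s x X" for X
        unfolding jucys_murphy_transpose_other[OF i k 3] jx[OF k] perm_act_scale ..
      have c: "c (?s k) = c k"
        using 3 by (simp add: transpose_def)
      show ?thesis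
        unfolding fun_eq_iff j w e c by (auto simp: field_simps)
    qed
  qed
  ultimately show ?thesis
    unfolding weight_space_def comp_def by blast
qed

text \<open>Pythagoras: the transposed vector has the norm of \<open>x\<close> and is the sum of
  \<open>intertwine \<mu> c i x\<close> and a multiple of \<open>x\<close>, which are orthogonal
  because their eigenvalues at \<open>i\<close> differ.\<close>

lemma intertwine_norm:
  assumes x: "x \<in> weight_space \<mu> c" and i: "1 \<le> i" "i < sum_list \<mu>" and ne: "c i \<noteq> c (Suc i)"
  shows "tabloid_form \<mu> (intertwine \<mu> c i x) (intertwine \<mu> c i x)
    = (1 - 1 / (of_int (c (Suc i) - c i))\<^sup>2) * tabloid_form \<mu> x x"
proof -
  let ?s = "Transposition.transpose i (Suc i) :: nat \<Rightarrow> nat"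
  let ?d = "of_int (c (Suc i) - c i) :: rat" and ?w = "intertwine \<mu> c i x"
  have "tabloid_form \<mu> ?w x = 0"
    by (rule weight_space_orthogonal[OF intertwine_weight_space[OF x i ne] x, of i]) (use i ne in auto)
  moreover from this have "tabloid_form \<mu> x ?w = 0"
    by (simp only: tabloid_form_commute)
  moreover have "tabloid_form \<mu> x x = tabloid_form \<mu> (perm_act \<mu> ?s x) (perm_act \<mu> ?s x)"
    by (rule tabloid_form_perm_act[OF transpose_Suc_perm[OF i], symmetric])
  ultimately have "tabloid_form \<mu> x x = tabloid_form \<mu> ?w ?w + 1 / ?d * (1 / ?d * tabloid_form \<mu> x x)"
    unfolding perm_act_split[of \<mu> i x c]
    by (simp only: tabloid_form_add_left tabloid_form_add_right tabloid_form_scale_left tabloid_form_scale_right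
        mult_zero_right add_0_left add_0_right)
  moreover have "w = (1 - 1 / d\<^sup>2) * f" if "f = w + 1 / d * (1 / d * f)" for w d f :: rat
    using that by (simp add: algebra_simps power2_eq_square)
  ultimately show ?thesis
    by blast
qed

text \<open>The difference of the eigenvalues changes sign after the first application, so the mixed
  terms cancel. For a difference other than 1 and -1 the intertwiner is thus invertible.\<close>

lemma intertwine_twice:
  assumes x: "x \<in> weight_space \<mu> c" and i: "1 \<le> i" "i < sum_list \<mu>"
  shows "intertwine \<mu> (c \<circ> Transposition.transpose i (Suc i)) i (intertwine \<mu> c i x)
    = (\<lambda>X. (1 - 1 / (of_int (c (Suc i) - c i))\<^sup>2) * x X)"
proof
  fix X
  let ?s = "Transposition.transpose i (Suc i) :: nat \<Rightarrow> nat"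
  let ?d = "of_int (c (Suc i) - c i) :: rat" and ?w = "intertwine \<mu> c i x"
  have N: "i \<in> {1..sum_list \<mu>}" "Suc i \<in> {1..sum_list \<mu>}"
    using i by auto
  have "of_int ((c \<circ> ?s) (Suc i) - (c \<circ> ?s) i) = - ?d"
    by simp
  then have "intertwine \<mu> (c \<circ> ?s) i ?w X = perm_act \<mu> ?s ?w X - 1 / (- ?d) * ?w X"
    unfolding intertwine_def[of \<mu> "c \<circ> ?s"] minus_apply by simp
  also have "perm_act \<mu> ?s ?w X = x X - 1 / ?d * perm_act \<mu> ?s x X"
    unfolding intertwine_def perm_act_diff perm_act_scale
      perm_act_transpose_twice[OF N weight_space_perm_module[OF x]] minus_apply ..
  also have "?w X = perm_act \<mu> ?s x X - 1 / ?d * x X"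
    unfolding intertwine_def minus_apply ..
  also have "x X - 1 / ?d * perm_act \<mu> ?s x X - 1 / (- ?d) * (perm_act \<mu> ?s x X - 1 / ?d * x X)
      = (1 - 1 / ?d\<^sup>2) * x X"
  proof -
    have "y - 1 / d * z - 1 / (- d) * (z - 1 / d * y) = (1 - 1 / d\<^sup>2) * y" for y z d :: rat
      by (simp add: algebra_simps power2_eq_square)
    then show ?thesis .
  qed
  finally show "intertwine \<mu> (c \<circ> ?s) i ?w X = (1 - 1 / ?d\<^sup>2) * x X" .
qed

text \<open>For a difference of 1 or -1 the norm formula makes the intertwined vector isotropic,
  hence zero by positive definiteness. Only the multiple by the inverse of the difference remains,
  and the difference is its own inverse.\<close>

lemma perm_act_weight_adjacent:
  assumes x: "x \<in> weight_space \<mu> c" and i: "1 \<le> i" "i < sum_list \<mu>" and d: "\<bar>c (Suc i) - c i\<bar> = 1"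
  shows "perm_act \<mu> (Transposition.transpose i (Suc i)) x = (\<lambda>X. of_int (c (Suc i) - c i) * x X)"
proof -
  let ?d = "of_int (c (Suc i) - c i) :: rat"
  have "(c (Suc i) - c i)\<^sup>2 = 1"
    using d by (metis power2_abs power_one)
  then have sq: "?d\<^sup>2 = 1"
    by (metis of_int_1 of_int_power)
  have ne: "c i \<noteq> c (Suc i)"
    using d by auto
  have "tabloid_form \<mu> (intertwine \<mu> c i x) (intertwine \<mu> c i x) = 0"
    unfolding intertwine_norm[OF x i ne] sq by simp
  moreover have "intertwine \<mu> c i x \<in> perm_module \<mu>"
    by (rule weight_space_perm_module[OF intertwine_weight_space[OF x i ne]])
  ultimately have 0: "intertwine \<mu> c i x = 0"
    by (simp only: tabloid_form_eq_0_iff)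
  have inv: "1 / ?d = ?d"
    using sq by (metis divide_self_if mult_eq_0_iff nonzero_eq_divide_eq power2_eq_square zero_neq_one)
  show ?thesis
    unfolding perm_act_split[of \<mu> i x c] 0 add_0_left inv ..
qed

section \<open>The joint eigenspace of the column reading tableau\<close>

text \<open>The column stabilizer is generated by its transpositions. Composing
  \<open>\<sigma>\<close> with the transposition of \<open>k\<close> and \<open>\<sigma> k\<close>
  stays in the stabilizer, fixes \<open>k\<close> and moves no new entry, so the number of moved
  entries decreases.\<close>

lemma column_alternatingI:
  assumes t: "t \<in> tableaux \<mu>" and x: "x \<in> perm_module \<mu>"
    and swap: "\<And>k l. k \<in> {1..sum_list \<mu>} \<Longrightarrow> l \<in> {1..sum_list \<mu>} \<Longrightarrow> k \<noteq> l \<Longrightarrow>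
      entry_col \<mu> t k = entry_col \<mu> t l \<Longrightarrow> perm_act \<mu> (Transposition.transpose k l) x = - x"
  shows "column_alternating \<mu> t x"
proof -
  let ?n = "sum_list \<mu>"
  have "perm_act \<mu> \<sigma> x = (\<lambda>X. of_int (sign \<sigma>) * x X)" if "\<sigma> \<in> column_stabilizer \<mu> t" for \<sigma>
    using that
  proof (induction "card {k \<in> {1..?n}. \<sigma> k \<noteq> k}" arbitrary: \<sigma> rule: less_induct)
    case less
    note p = column_stabilizer_perm[OF less.prems]
    show ?case
    proof (cases "\<exists>k\<in>{1..?n}. \<sigma> k \<noteq> k")
      case False
      then have "\<sigma> = id"
        using permutes_not_in[OF p] by (auto simp: fun_eq_iff)
      then show ?thesis
        by (simp add: perm_act_id[OF x])
    next
      case True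
      then obtain k where k: "k \<in> {1..?n}" "\<sigma> k \<noteq> k"
        by blast
      let ?\<tau> = "Transposition.transpose k (\<sigma> k)"
      have \<sigma>k: "\<sigma> k \<in> {1..?n}"
        using k(1) permutes_in_image[OF p] by blast
      have col: "entry_col \<mu> t k = entry_col \<mu> t (\<sigma> k)"
        using less.prems k(1) unfolding column_stabilizer_iff[OF t] by simp
      have \<tau>: "?\<tau> \<in> column_stabilizer \<mu> t"
        by (rule transpose_in_column_stabilizer[OF t k(1) \<sigma>k col])
      have \<tau>\<sigma>: "?\<tau> \<circ> \<sigma> \<in> column_stabilizer \<mu> t"
        by (rule column_stabilizer_comp[OF t \<tau> less.prems])
      have "{l \<in> {1..?n}. (?\<tau> \<circ> \<sigma>) l \<noteq> l} \<subset> {l \<in> {1..?n}. \<sigma> l \<noteq> l}"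
      proof
        show "{l \<in> {1..?n}. (?\<tau> \<circ> \<sigma>) l \<noteq> l} \<subseteq> {l \<in> {1..?n}. \<sigma> l \<noteq> l}"
        proof (intro subsetI CollectI conjI)
          fix l assume l: "l \<in> {l \<in> {1..?n}. (?\<tau> \<circ> \<sigma>) l \<noteq> l}"
          then show "l \<in> {1..?n}"
            by simp
          show "\<sigma> l \<noteq> l"
          proof
            assume fix_l: "\<sigma> l = l"
            then have "l \<noteq> k"
              using k(2) by auto
            moreover have "l \<noteq> \<sigma> k"
              using fix_l k(2) permutes_inj[OF p] by (metis injD)
            ultimately have "?\<tau> (\<sigma> l) = l"
              using fix_l by (simp add: transpose_def)
            with l show False
              by simp
          qed
        qed
        have "k \<in> {l \<in> {1..?n}. \<sigma> l \<noteq> l}" "k \<notin> {l \<in> {1..?n}. (?\<tau> \<circ> \<sigma>) l \<noteq> l}"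
          using k by simp_all
        then show "{l \<in> {1..?n}. (?\<tau> \<circ> \<sigma>) l \<noteq> l} \<noteq> {l \<in> {1..?n}. \<sigma> l \<noteq> l}"
          by blast
      qed
      then have "card {l \<in> {1..?n}. (?\<tau> \<circ> \<sigma>) l \<noteq> l} < card {l \<in> {1..?n}. \<sigma> l \<noteq> l}"
        by (intro psubset_card_mono) simp_all
      from less.hyps[OF this \<tau>\<sigma>]
      have IH: "perm_act \<mu> (?\<tau> \<circ> \<sigma>) x = (\<lambda>X. of_int (sign (?\<tau> \<circ> \<sigma>)) * x X)" .
      have "sign (?\<tau> \<circ> \<sigma>) = sign ?\<tau> * sign \<sigma>"
        using entry_permutation[OF column_stabilizer_perm[OF \<tau>]] entry_permutation[OF p] by (rule sign_compose)
      then have sgn: "sign (?\<tau> \<circ> \<sigma>) = - sign \<sigma>"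
        using k(2) by (simp add: sign_swap_id)
      have "?\<tau> \<circ> (?\<tau> \<circ> \<sigma>) = \<sigma>"
        by (simp add: fun_eq_iff)
      then have "perm_act \<mu> \<sigma> x = perm_act \<mu> ?\<tau> (perm_act \<mu> (?\<tau> \<circ> \<sigma>) x)"
        unfolding perm_act_comp[OF column_stabilizer_perm[OF \<tau>] column_stabilizer_perm[OF \<tau>\<sigma>]] by simp
      also have "\<dots> = (\<lambda>X. of_int (- sign \<sigma>) * perm_act \<mu> ?\<tau> x X)"
        unfolding IH sgn by (rule perm_act_scale)
      also have "\<dots> = (\<lambda>X. of_int (sign \<sigma>) * x X)"
        unfolding swap[OF k(1) \<sigma>k k(2)[symmetric] col] by (simp add: fun_Compl_def)
      finally show ?thesis .
    qed
  qed
  then show ?thesis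
    using x by (simp add: column_alternating_def)
qed

lemma column_reading_Suc:
  assumes "(i, j) \<in> diagram \<mu>" "(Suc i, j) \<in> diagram \<mu>"
  shows "column_reading \<mu> (Suc i, j) = Suc (column_reading \<mu> (i, j))"
proof (rule ccontr)
  assume ne: "column_reading \<mu> (Suc i, j) \<noteq> Suc (column_reading \<mu> (i, j))"
  note t = column_reading_tableau[of \<mu>]
  have "column_reading \<mu> (i, j) < column_reading \<mu> (Suc i, j)"
    using assms by (intro column_reading_less) (auto simp: col_less_def)
  with ne have lt: "Suc (column_reading \<mu> (i, j)) < column_reading \<mu> (Suc i, j)"
    by simp
  moreover have "column_reading \<mu> (Suc i, j) \<le> sum_list \<mu>"
    using tableau_range[OF t assms(2)] by simp
  ultimately have "Suc (column_reading \<mu> (i, j)) \<in> {1..sum_list \<mu>}"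
    by simp
  then obtain z where z: "z \<in> diagram \<mu>" "column_reading \<mu> z = Suc (column_reading \<mu> (i, j))"
    using tableau_cell[OF t] by blast
  then have "col_less (i, j) z" "col_less z (Suc i, j)"
    using column_reading_less_iff[OF assms(1) z(1)] column_reading_less_iff[OF z(1) assms(2)] lt by simp_all
  then show False
    by (auto simp: col_less_def)
qed

text \<open>Vertical neighbours hold consecutive entries whose contents differ by -1, so their swap
  acts as -1. Larger distances follow by conjugation with the last neighbouring swap.\<close>

lemma weight_space_column_reading_swap:
  assumes sorted: "sorted_wrt (\<ge>) \<mu>"
    and x: "x \<in> weight_space \<mu> (entry_content \<mu> (column_reading \<mu>))"
    and D: "(i, j) \<in> diagram \<mu>" "(Suc (i + m), j) \<in> diagram \<mu>"
  shows "perm_act \<mu> (Transposition.transpose (column_reading \<mu> (i, j)) (column_reading \<mu> (Suc (i + m), j))) x = - x"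
  using D(2)
proof (induction m)
  case 0
  note t = column_reading_tableau[of \<mu>]
  let ?k = "column_reading \<mu> (i, j)"
  have D': "(Suc i, j) \<in> diagram \<mu>"
    using 0 by simp
  have S: "column_reading \<mu> (Suc i, j) = Suc ?k"
    by (rule column_reading_Suc[OF D(1) D'])
  have "entry_content \<mu> (column_reading \<mu>) (Suc ?k) - entry_content \<mu> (column_reading \<mu>) ?k = - 1"
    unfolding S[symmetric] entry_content_tableau[OF t D(1)] entry_content_tableau[OF t D'] by (simp add: cell_content_def)
  moreover have "1 \<le> ?k" "?k < sum_list \<mu>"
    using tableau_range[OF t D(1)] tableau_range[OF t D'] S by auto
  ultimately have "perm_act \<mu> (Transposition.transpose ?k (Suc ?k)) x = (\<lambda>X. - 1 * x X)"
    using perm_act_weight_adjacent[OF x, of ?k] by simp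
  then show ?case
    using S by (simp add: fun_Compl_def)
next
  case (Suc m)
  note t = column_reading_tableau[of \<mu>]
  let ?a = "column_reading \<mu> (i, j)" and ?b = "column_reading \<mu> (Suc (i + m), j)"
  have D1: "(Suc (i + m), j) \<in> diagram \<mu>"
    using Suc.prems unfolding diagram_column_iff[OF sorted] by simp
  have D2: "(Suc (Suc (i + m)), j) \<in> diagram \<mu>"
    using Suc.prems by simp
  have S: "column_reading \<mu> (Suc (Suc (i + m)), j) = Suc ?b"
    by (rule column_reading_Suc[OF D1 D2])
  have "?a < ?b"
    using D(1) D1 by (intro column_reading_less) (auto simp: col_less_def)
  have N: "?a \<in> {1..sum_list \<mu>}" "?b \<in> {1..sum_list \<mu>}" "Suc ?b \<in> {1..sum_list \<mu>}"
    using tableau_range[OF t D(1)] tableau_range[OF t D1] tableau_range[OF t D2] S by auto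
  let ?s = "Transposition.transpose ?b (Suc ?b)"
  have "entry_content \<mu> (column_reading \<mu>) (Suc ?b) - entry_content \<mu> (column_reading \<mu>) ?b = - 1"
    unfolding S[symmetric] entry_content_tableau[OF t D1] entry_content_tableau[OF t D2] by (simp add: cell_content_def)
  then have s: "perm_act \<mu> ?s x = - x"
    using perm_act_weight_adjacent[OF x, of ?b] N by (simp add: fun_Compl_def)
  have "?s ?a = ?a"
    using \<open>?a < ?b\<close> by (simp add: transpose_def)
  then have "perm_act \<mu> (Transposition.transpose ?a (Suc ?b)) (perm_act \<mu> ?s x)
      = perm_act \<mu> ?s (perm_act \<mu> (Transposition.transpose ?a ?b) x)"
    using perm_act_transpose[OF permutes_swap_id[OF N(2,3)] N(1,2), of x] by simp
  then have "- perm_act \<mu> (Transposition.transpose ?a (Suc ?b)) x = x"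
    unfolding Suc.IH[OF D1] s perm_act_uminus by simp
  then have "perm_act \<mu> (Transposition.transpose ?a (Suc ?b)) x = - x"
    by (metis minus_minus)
  then show ?case
    using S by simp
qed

lemma weight_space_column_reading:
  assumes sorted: "sorted_wrt (\<ge>) \<mu>"
    and x: "x \<in> weight_space \<mu> (entry_content \<mu> (column_reading \<mu>))"
  shows "x = (\<lambda>X. x (tabloid \<mu> (column_reading \<mu>)) * ptab \<mu> (column_reading \<mu>) X)"
proof (rule column_alternating_eq[OF sorted column_reading_tableau],
    rule column_alternatingI[OF column_reading_tableau weight_space_perm_module[OF x]])
  note t = column_reading_tableau[of \<mu>]
  fix k l assume kl: "k \<in> {1..sum_list \<mu>}" "l \<in> {1..sum_list \<mu>}" "k \<noteq> l"
    "entry_col \<mu> (column_reading \<mu>) k = entry_col \<mu> (column_reading \<mu>) l"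
  obtain y where y: "y \<in> diagram \<mu>" "column_reading \<mu> y = k"
    using tableau_cell[OF t kl(1)] .
  obtain z where z: "z \<in> diagram \<mu>" "column_reading \<mu> z = l"
    using tableau_cell[OF t kl(2)] .
  have "snd y = snd z"
    using kl(4) entry_col_tableau[OF t y(1)] entry_col_tableau[OF t z(1)] y(2) z(2) by simp
  then obtain i i' j where yz: "y = (i, j)" "z = (i', j)"
    by (cases y; cases z) auto
  have "i \<noteq> i'"
    using kl(3) y z yz by auto
  then consider m where "i' = Suc (i + m)" | m where "i = Suc (i' + m)"
    by (metis less_iff_Suc_add linorder_neqE_nat)
  then show "perm_act \<mu> (Transposition.transpose k l) x = - x"
  proof cases
    case 1
    then show ?thesis
      using weight_space_column_reading_swap[OF sorted x, of i j m] y z yz by simp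
  next
    case 2
    then show ?thesis
      using weight_space_column_reading_swap[OF sorted x, of i' j m] y z yz by (simp add: transpose_commute)
  qed
qed

text \<open>Joint eigenspaces are one-dimensional: at the column reading tableau by the preceding lemma, and
  an invertible intertwiner transports this to all other standard tableaux.\<close>

definition seminormal_vector :: "nat list \<Rightarrow> rat \<Rightarrow> tableau \<Rightarrow> (tabloid \<Rightarrow> rat) \<Rightarrow> bool" where
  "seminormal_vector \<mu> g t v \<longleftrightarrow> v \<in> weight_space \<mu> (entry_content \<mu> t) \<and>
     (\<forall>x\<in>weight_space \<mu> (entry_content \<mu> t). \<exists>a. x = (\<lambda>X. a * v X)) \<and>
     (\<exists>y. y \<noteq> 0 \<and> tabloid_form \<mu> v v = g * of_int (inversion_product \<mu> t) * y\<^sup>2)"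

section \<open>Transport of the eigenvectors along admissible swaps\<close>

lemma polytabloid_nonzero: "t \<in> tableaux \<mu> \<Longrightarrow> ptab \<mu> t \<noteq> 0"
  using polytabloid_self by fastforce

lemma polytabloid_form_nonzero:
  "t \<in> tableaux \<mu> \<Longrightarrow> tabloid_form \<mu> (ptab \<mu> t) (ptab \<mu> t) \<noteq> 0"
  using tabloid_form_eq_0_iff[OF polytabloid_perm_module] polytabloid_nonzero by blast

lemma polytabloid_weight_space:
  assumes "sorted_wrt (\<ge>) \<mu>"
  shows "ptab \<mu> (column_reading \<mu>) \<in> weight_space \<mu> (entry_content \<mu> (column_reading \<mu>))"
  unfolding weight_space_def
  using jucys_murphy_column_reading[OF assms] polytabloid_in_specht[OF column_reading_tableau] by blast

lemma cells_of_consecutive_entries: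
  assumes "t \<in> tableaux \<mu>" "1 \<le> i" "i < sum_list \<mu>"
  obtains x y where "x \<in> diagram \<mu>" "y \<in> diagram \<mu>" "t x = i" "t y = Suc (t x)"
    "entry_content \<mu> t (Suc i) - entry_content \<mu> t i = cell_content y - cell_content x"
proof -
  have N: "i \<in> {1..sum_list \<mu>}" "Suc i \<in> {1..sum_list \<mu>}"
    using assms(2,3) by auto
  obtain x where x: "x \<in> diagram \<mu>" "t x = i"
    using tableau_cell[OF assms(1) N(1)] .
  obtain y where y: "y \<in> diagram \<mu>" "t y = Suc i"
    using tableau_cell[OF assms(1) N(2)] .
  have "entry_content \<mu> t (Suc i) - entry_content \<mu> t i = cell_content y - cell_content x"
    using entry_content_tableau[OF assms(1) x(1)] entry_content_tableau[OF assms(1) y(1)] x(2) y(2) by simp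
  with x y show ?thesis
    using that by simp
qed

text \<open>The swap adds one inversion if \<open>x\<close> is above \<open>y\<close> and deletes
  one otherwise. Either way the two products differ by the factor \<open>d\<^sup>2 - 1\<close>, and
  which side carries it is immaterial up to squares.\<close>

lemma inversion_product_swap_square:
  assumes t: "t \<in> tableaux \<mu>" and xy: "x \<in> diagram \<mu>" "y \<in> diagram \<mu>" "t y = Suc (t x)"
    and ne: "fst x \<noteq> fst y"
  defines "s \<equiv> Transposition.transpose (t x) (Suc (t x))" and "d \<equiv> cell_content y - cell_content x"
  shows "(d\<^sup>2 - 1) * inversion_product \<mu> t = inversion_product \<mu> (act \<mu> s t) \<or>
    inversion_product \<mu> t = (d\<^sup>2 - 1) * inversion_product \<mu> (act \<mu> s t)"
proof (cases "fst x < fst y")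
  case True
  then show ?thesis
    using inversion_product_swap[OF t xy True] unfolding s_def d_def by simp
next
  case False
  then have less: "fst y < fst x"
    using ne by simp
  have N: "t x \<in> {1..sum_list \<mu>}" "Suc (t x) \<in> {1..sum_list \<mu>}"
    using tableau_range[OF t xy(1)] tableau_range[OF t xy(2)] xy(3) by auto
  have p: "entry_perm \<mu> s"
    unfolding s_def by (rule permutes_swap_id[OF N])
  let ?t = "act \<mu> s t"
  have ty: "?t y = t x" "?t x = Suc (?t y)"
    using xy by (simp_all add: act_apply s_def)
  then have s: "Transposition.transpose (?t y) (Suc (?t y)) = s"
    by (simp only: s_def)
  from inversion_product_swap[OF act_tableau[OF t p] xy(2,1) ty(2) less]
  have "inversion_product \<mu> (act \<mu> s ?t) = ((cell_content x - cell_content y)\<^sup>2 - 1) * inversion_product \<mu> ?t"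
    unfolding s .
  moreover have "act \<mu> s ?t = t"
    using act_inv_act(1)[OF t p] unfolding s_def by simp
  ultimately show ?thesis
    by (simp add: d_def power2_commute)
qed

lemma seminormal_vector_swap:
  assumes sorted: "sorted_wrt (\<ge>) \<mu>" and t: "t \<in> standard_tableaux \<mu>" and i: "1 \<le> i" "i < sum_list \<mu>"
    and st: "act \<mu> (Transposition.transpose i (Suc i)) t \<in> standard_tableaux \<mu>"
    and v: "seminormal_vector \<mu> g t v"
  shows "seminormal_vector \<mu> g (act \<mu> (Transposition.transpose i (Suc i)) t) (intertwine \<mu> (entry_content \<mu> t) i v)"
proof -
  let ?s = "Transposition.transpose i (Suc i) :: nat \<Rightarrow> nat"
  let ?c = "entry_content \<mu> t" and ?t = "act \<mu> (Transposition.transpose i (Suc i)) t"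
  note tt = standard_tableauD(1)[OF t]
  obtain x y where xy: "x \<in> diagram \<mu>" "y \<in> diagram \<mu>" "t x = i" "t y = Suc (t x)"
    and dc: "?c (Suc i) - ?c i = cell_content y - cell_content x"
    using cells_of_consecutive_entries[OF tt i] .
  have sw: "?t x = Suc i" "?t y = i"
    using xy by (simp_all add: act_apply)
  \<comment> \<open>Both \<open>t\<close> and the swapped tableau are standard, so neither cell may
    lie weakly above and to the left of the other.\<close>
  have not_le: "\<not> (fst x \<le> fst y \<and> snd x \<le> snd y)"
  proof
    assume "fst x \<le> fst y \<and> snd x \<le> snd y"
    moreover have "x \<noteq> y"
      using sw by auto
    ultimately have "?t x < ?t y"
      using standard_tableau_mono[OF sorted st xy(1,2)] by blast
    with sw show False
      by simp
  qed
  have not_ge: "\<not> (fst y \<le> fst x \<and> snd y \<le> snd x)"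
  proof
    assume "fst y \<le> fst x \<and> snd y \<le> snd x"
    moreover have "y \<noteq> x"
      using sw by auto
    ultimately have "t y < t x"
      using standard_tableau_mono[OF sorted t xy(2,1)] by blast
    with xy(4) show False
      by simp
  qed
  have ne: "fst x \<noteq> fst y" "snd x \<noteq> snd y"
    using not_le not_ge by auto
  define d where "d = cell_content y - cell_content x"
  have d2: "2 \<le> \<bar>d\<bar>"
    unfolding d_def by (rule consecutive_elsewhere[OF sorted t xy(1,2,4) ne])
  have "2\<^sup>2 \<le> \<bar>d\<bar>\<^sup>2"
    using d2 by (intro power_mono) auto
  then have dsq: "d\<^sup>2 - 1 \<noteq> 0"
    by auto
  define r where "r = (of_int d :: rat)"
  have r: "r \<noteq> 0" "r\<^sup>2 - 1 \<noteq> 0" "1 - 1 / r\<^sup>2 \<noteq> 0" "1 - 1 / r\<^sup>2 = (r\<^sup>2 - 1) / r\<^sup>2"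
  proof -
    show r0: "r \<noteq> 0"
      using d2 by (auto simp: r_def)
    have "r\<^sup>2 - 1 = of_int (d\<^sup>2 - 1)"
      by (simp add: r_def)
    then show r1: "r\<^sup>2 - 1 \<noteq> 0"
      using dsq by (metis of_int_eq_0_iff)
    show r2: "1 - 1 / r\<^sup>2 = (r\<^sup>2 - 1) / r\<^sup>2"
      using r0 by (simp add: diff_divide_distrib)
    show "1 - 1 / r\<^sup>2 \<noteq> 0"
      unfolding r2 using r0 r1 by simp
  qed
  have cr: "of_int (?c (Suc i) - ?c i) = r"
    unfolding dc r_def d_def ..
  have cne: "?c i \<noteq> ?c (Suc i)"
    using dc d2 unfolding d_def by linarith
  have Wt: "weight_space \<mu> (entry_content \<mu> ?t) = weight_space \<mu> (?c \<circ> ?s)"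
    using entry_content_swap[OF tt i] by (intro weight_space_cong) (simp only: comp_apply)
  have Ws: "weight_space \<mu> ((?c \<circ> ?s) \<circ> ?s) = weight_space \<mu> ?c"
    by (simp add: comp_assoc)
  have vW: "v \<in> weight_space \<mu> ?c" and v1: "\<And>x. x \<in> weight_space \<mu> ?c \<Longrightarrow> \<exists>a. x = (\<lambda>X. a * v X)"
    using v unfolding seminormal_vector_def by blast+
  obtain z where z: "z \<noteq> 0" "tabloid_form \<mu> v v = g * of_int (inversion_product \<mu> t) * z\<^sup>2"
    using v unfolding seminormal_vector_def by blast
  let ?w = "intertwine \<mu> ?c i v"
  have "?w \<in> weight_space \<mu> (entry_content \<mu> ?t)"
    unfolding Wt by (rule intertwine_weight_space[OF vW i cne])
  moreover have "\<exists>a. x = (\<lambda>X. a * ?w X)" if x: "x \<in> weight_space \<mu> (entry_content \<mu> ?t)" for x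
  proof -
    have x': "x \<in> weight_space \<mu> (?c \<circ> ?s)"
      using x unfolding Wt .
    have cne': "(?c \<circ> ?s) i \<noteq> (?c \<circ> ?s) (Suc i)"
      using cne by simp
    have cr': "(of_int ((?c \<circ> ?s) (Suc i) - (?c \<circ> ?s) i) :: rat) = - r"
      unfolding cr[symmetric] by simp
    \<comment> \<open>Intertwining back lands in the eigenspace of \<open>t\<close>, known to be
      spanned by \<open>v\<close>. Intertwining forward again multiplies \<open>x\<close> by the
      nonzero number \<open>1 - 1 / r\<^sup>2\<close>.\<close>
    have "intertwine \<mu> (?c \<circ> ?s) i x \<in> weight_space \<mu> ?c"
      using intertwine_weight_space[OF x' i cne'] unfolding Ws .
    then obtain a where a: "intertwine \<mu> (?c \<circ> ?s) i x = (\<lambda>X. a * v X)"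
      using v1 by blast
    have css: "(?c \<circ> ?s) \<circ> ?s = ?c"
      by (simp add: comp_assoc)
    have "intertwine \<mu> ?c i (intertwine \<mu> (?c \<circ> ?s) i x) = (\<lambda>X. (1 - 1 / r\<^sup>2) * x X)"
      using intertwine_twice[OF x' i] unfolding css cr' by simp
    moreover have "intertwine \<mu> ?c i (\<lambda>X. a * v X) = (\<lambda>X. a * ?w X)"
      unfolding intertwine_def perm_act_scale by (simp add: fun_eq_iff algebra_simps)
    ultimately have "(1 - 1 / r\<^sup>2) * x X = a * ?w X" for X
      unfolding a by (simp only: fun_eq_iff)
    then have "x X = a / (1 - 1 / r\<^sup>2) * ?w X" for X
      using r(3) by (metis eq_divide_imp mult.commute times_divide_eq_left)
    then show ?thesis
      by blast
  qed
  moreover have "\<exists>y. y \<noteq> 0 \<and> tabloid_form \<mu> ?w ?w = g * of_int (inversion_product \<mu> ?t) * y\<^sup>2"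
  proof -
    have norm: "tabloid_form \<mu> ?w ?w = (r\<^sup>2 - 1) / r\<^sup>2 * (g * of_int (inversion_product \<mu> t) * z\<^sup>2)"
      using intertwine_norm[OF vW i cne] unfolding cr z(2) r(4) .
    have rd: "of_int (d\<^sup>2 - 1) = r\<^sup>2 - 1"
      by (simp add: r_def)
    have "(d\<^sup>2 - 1) * inversion_product \<mu> t = inversion_product \<mu> ?t \<or>
        inversion_product \<mu> t = (d\<^sup>2 - 1) * inversion_product \<mu> ?t"
      using inversion_product_swap_square[OF tt xy(1,2,4) ne(1)] unfolding d_def xy(3) .
    then show ?thesis
    proof
      assume eq: "(d\<^sup>2 - 1) * inversion_product \<mu> t = inversion_product \<mu> ?t"
      have "tabloid_form \<mu> ?w ?w = g * of_int (inversion_product \<mu> ?t) * (z / r)\<^sup>2"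
        unfolding norm eq[symmetric] of_int_mult rd by (simp add: power_divide)
      moreover have "z / r \<noteq> 0"
        using z(1) r(1) by simp
      ultimately show ?thesis
        by blast
    next
      \<comment> \<open>Here the inversion product loses the factor that the norm gains; the
        resulting second power of \<open>r\<^sup>2 - 1\<close> goes into the square.\<close>
      assume eq: "inversion_product \<mu> t = (d\<^sup>2 - 1) * inversion_product \<mu> ?t"
      have "tabloid_form \<mu> ?w ?w = g * of_int (inversion_product \<mu> ?t) * ((r\<^sup>2 - 1) * z / r)\<^sup>2"
        unfolding norm eq of_int_mult rd by (simp add: power_divide power_mult_distrib power2_eq_square)
      moreover have "(r\<^sup>2 - 1) * z / r \<noteq> 0"
        using z(1) r(1,2) by simp
      ultimately show ?thesis
        by blast
    qed
  qed
  ultimately show ?thesis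
    unfolding seminormal_vector_def by blast
qed

lemma ex_seminormal_vectors:
  assumes sorted: "sorted_wrt (\<ge>) \<mu>"
  obtains g v where "g \<noteq> 0" "\<And>t. t \<in> standard_tableaux \<mu> \<Longrightarrow> seminormal_vector \<mu> g t (v t)"
proof -
  let ?t = "column_reading \<mu>" and ?e = "ptab \<mu> (column_reading \<mu>)"
  define p where "p = (of_int (inversion_product \<mu> ?t) :: rat)"
  have p: "p \<noteq> 0"
    using inversion_product_pos[OF column_reading_standard sorted] by (simp add: p_def)
  \<comment> \<open>The induction starts at the column reading tableau, which in general has
    inversions. Their product is divided out so that one factor \<open>g\<close> serves all
    tableaux.\<close>
  define g where "g = tabloid_form \<mu> ?e ?e / p"
  have "g \<noteq> 0"
    using polytabloid_form_nonzero[OF column_reading_tableau] p by (simp add: g_def)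
  have "seminormal_vector \<mu> g ?t ?e"
    unfolding seminormal_vector_def
  proof (intro conjI ballI)
    show "?e \<in> weight_space \<mu> (entry_content \<mu> ?t)"
      by (rule polytabloid_weight_space[OF sorted])
    show "\<exists>a. x = (\<lambda>X. a * ?e X)" if "x \<in> weight_space \<mu> (entry_content \<mu> ?t)" for x
      using weight_space_column_reading[OF sorted that] by blast
    have "tabloid_form \<mu> ?e ?e = g * of_int (inversion_product \<mu> ?t) * 1\<^sup>2"
      using p unfolding p_def[symmetric] by (simp add: g_def)
    then show "\<exists>y. y \<noteq> 0 \<and> tabloid_form \<mu> ?e ?e = g * of_int (inversion_product \<mu> ?t) * y\<^sup>2"
      by (metis zero_neq_one)
  qed
  then have base: "\<exists>v. seminormal_vector \<mu> g ?t v"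
    by blast
  have "\<exists>v. seminormal_vector \<mu> g t v" if t: "t \<in> standard_tableaux \<mu>" for t
    using sorted t base
    by (rule standard_tableaux_swap_induct[where P = "\<lambda>t. \<exists>v. seminormal_vector \<mu> g t v"])
      (use seminormal_vector_swap[OF sorted] in blast)
  then obtain v where "\<And>t. t \<in> standard_tableaux \<mu> \<Longrightarrow> seminormal_vector \<mu> g t (v t)"
    by metis
  with \<open>g \<noteq> 0\<close> show ?thesis
    using that by blast
qed

section \<open>The Gram determinant\<close>

lemma subspace_perm_act_closed:
  assumes sub: "U \<subseteq> perm_module \<mu>"
    and adj: "\<And>i x. 1 \<le> i \<Longrightarrow> i < sum_list \<mu> \<Longrightarrow> x \<in> U \<Longrightarrow>
      perm_act \<mu> (Transposition.transpose i (Suc i)) x \<in> U"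
    and \<pi>: "entry_perm \<mu> \<pi>" and x: "x \<in> U"
  shows "perm_act \<mu> \<pi> x \<in> U"
proof -
  let ?N = "{1..sum_list \<mu>}"
  have less: "\<forall>x\<in>U. perm_act \<mu> (Transposition.transpose a (Suc (a + d))) x \<in> U"
    if "a \<in> ?N" "Suc (a + d) \<in> ?N" for a d
    using that(2)
  proof (induction d)
    case 0
    then show ?case
      using adj[of a] that(1) by auto
  next
    case (Suc d)
    let ?b = "Suc (a + d)"
    let ?s = "Transposition.transpose ?b (Suc ?b)"
    have N: "?b \<in> ?N" "Suc ?b \<in> ?N"
      using Suc.prems by auto
    note IH = Suc.IH[OF N(1)]
    have s: "1 \<le> ?b" "?b < sum_list \<mu>"
      using Suc.prems by auto
    have "perm_act \<mu> (Transposition.transpose a (Suc ?b)) x \<in> U" if x: "x \<in> U" for x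
    proof -
      have "?s a = a"
        by (simp add: transpose_def)
      then have "perm_act \<mu> ?s (perm_act \<mu> (Transposition.transpose a ?b) (perm_act \<mu> ?s x))
          = perm_act \<mu> (Transposition.transpose a (Suc ?b)) (perm_act \<mu> ?s (perm_act \<mu> ?s x))"
        using perm_act_transpose[OF permutes_swap_id[OF N] \<open>a \<in> ?N\<close> N(1)] by simp
      also have "perm_act \<mu> ?s (perm_act \<mu> ?s x) = x"
        using x sub by (intro perm_act_transpose_twice[OF N]) blast
      finally show ?thesis
        using adj[OF s] IH x by metis
    qed
    then show ?case
      by simp
  qed
  have transp: "perm_act \<mu> (Transposition.transpose a b) x \<in> U"
    if ab: "a \<in> ?N" "b \<in> ?N" "a \<noteq> b" and x: "x \<in> U" for a b x
  proof (cases "a < b")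
    case True
    then obtain d where d: "b = Suc (a + d)"
      using less_iff_Suc_add by blast
    show ?thesis
      using less[of a d] ab(1,2) x unfolding d by blast
  next
    case False
    then have "b < a"
      using ab(3) by simp
    then obtain d where d: "a = Suc (b + d)"
      using less_iff_Suc_add by blast
    show ?thesis
      using less[of b d] ab(1,2) x unfolding d transpose_commute[of "Suc (b + d)" b] by blast
  qed
  have "\<forall>x\<in>U. perm_act \<mu> \<pi> x \<in> U"
    using \<pi> finite_atLeastAtMost
  proof (induction rule: permutes_induct)
    case id
    show ?case
    proof
      fix x assume x: "x \<in> U"
      then have "x \<in> perm_module \<mu>"
        using sub by blast
      then show "perm_act \<mu> id x \<in> U"
        using x by (simp only: perm_act_id)
    qed
  next
    case (swap a b p)
    show ?case
      unfolding perm_act_comp[OF permutes_swap_id[OF swap(1,2)] swap(4), symmetric]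
      using transp[OF swap(1-3)] swap(5) by blast
  qed
  with x show ?thesis
    by blast
qed

context
  fixes \<mu> g v
  assumes sorted: "sorted_wrt (\<ge>) \<mu>" and g: "g \<noteq> 0"
    and v: "\<And>t. t \<in> standard_tableaux \<mu> \<Longrightarrow> seminormal_vector \<mu> g t (v t)"
begin

lemma seminormal_weight: "t \<in> standard_tableaux \<mu> \<Longrightarrow> v t \<in> weight_space \<mu> (entry_content \<mu> t)"
  and seminormal_multiple: "t \<in> standard_tableaux \<mu> \<Longrightarrow> x \<in> weight_space \<mu> (entry_content \<mu> t) \<Longrightarrow>
    \<exists>a. x = (\<lambda>X. a * v t X)"
  using v unfolding seminormal_vector_def by blast+

lemma seminormal_norm:
  assumes "t \<in> standard_tableaux \<mu>"
  shows "tabloid_form \<mu> (v t) (v t) \<noteq> 0"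
proof -
  obtain y where "y \<noteq> 0" "tabloid_form \<mu> (v t) (v t) = g * of_int (inversion_product \<mu> t) * y\<^sup>2"
    using v[OF assms] unfolding seminormal_vector_def by blast
  then show ?thesis
    using g inversion_product_pos[OF assms sorted] by simp
qed

lemma seminormal_orthogonal:
  assumes "s \<in> standard_tableaux \<mu>" "t \<in> standard_tableaux \<mu>" "s \<noteq> t"
  shows "tabloid_form \<mu> (v s) (v t) = 0"
proof -
  obtain k where "k \<in> {1..sum_list \<mu>}" "entry_content \<mu> s k \<noteq> entry_content \<mu> t k"
    using standard_tableaux_contents_differ[OF sorted assms] by blast
  then show ?thesis
    by (rule weight_space_orthogonal[OF seminormal_weight[OF assms(1)] seminormal_weight[OF assms(2)]])
qed

lemma seminormal_inj: "inj_on v (standard_tableaux \<mu>)"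
proof (rule inj_onI, rule ccontr)
  fix s t assume st: "s \<in> standard_tableaux \<mu>" "t \<in> standard_tableaux \<mu>" "v s = v t" "s \<noteq> t"
  then show False
    using seminormal_orthogonal[OF st(1,2,4)] seminormal_norm[OF st(1)] by simp
qed

abbreviation seminormal_span :: "(tabloid \<Rightarrow> rat) set" where
  "seminormal_span \<equiv> tabloid_space.span (v ` standard_tableaux \<mu>)"

lemma seminormal_in_span: "t \<in> standard_tableaux \<mu> \<Longrightarrow> (\<lambda>X. a * v t X) \<in> seminormal_span"
  by (intro tabloid_space.span_scale tabloid_space.span_base imageI)

text \<open>Young's seminormal form. Neighbours in a row or column have contents differing by 1 or
  -1, and the transposition acts as a scalar. Otherwise the swapped tableau is standard, and its
  one-dimensional eigenspace contains the intertwined vector.\<close>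

lemma perm_act_seminormal:
  assumes t: "t \<in> standard_tableaux \<mu>" and i: "1 \<le> i" "i < sum_list \<mu>"
  shows "perm_act \<mu> (Transposition.transpose i (Suc i)) (v t) \<in> seminormal_span"
proof -
  let ?s = "Transposition.transpose i (Suc i) :: nat \<Rightarrow> nat" and ?c = "entry_content \<mu> t"
  note tt = standard_tableauD(1)[OF t]
  obtain x y where xy: "x \<in> diagram \<mu>" "y \<in> diagram \<mu>" "t x = i" "t y = Suc (t x)"
    and dc: "?c (Suc i) - ?c i = cell_content y - cell_content x"
    using cells_of_consecutive_entries[OF tt i] .
  show ?thesis
  proof (cases "fst x = fst y \<or> snd x = snd y")
    case True
    then have "\<bar>?c (Suc i) - ?c i\<bar> = 1"
      using consecutive_same_row[OF sorted t xy(1,2,4)] consecutive_same_column[OF sorted t xy(1,2,4)]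
      unfolding dc by auto
    from perm_act_weight_adjacent[OF seminormal_weight[OF t] i this] show ?thesis
      using seminormal_in_span[OF t] by simp
  next
    case False
    then have ne: "fst x \<noteq> fst y" "snd x \<noteq> snd y"
      by auto
    have st: "act \<mu> ?s t \<in> standard_tableaux \<mu>"
      using standard_swap[OF t xy(1,2,4) ne] unfolding xy(3) .
    have "?c i \<noteq> ?c (Suc i)"
      using consecutive_elsewhere[OF sorted t xy(1,2,4) ne] dc by linarith
    from intertwine_weight_space[OF seminormal_weight[OF t] i this]
    have "intertwine \<mu> ?c i (v t) \<in> weight_space \<mu> (?c \<circ> ?s)" .
    also have "weight_space \<mu> (?c \<circ> ?s) = weight_space \<mu> (entry_content \<mu> (act \<mu> ?s t))"
      using entry_content_swap[OF tt i] by (intro weight_space_cong) (simp only: comp_apply)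
    finally obtain a where a: "intertwine \<mu> ?c i (v t) = (\<lambda>X. a * v (act \<mu> ?s t) X)"
      using seminormal_multiple[OF st] by blast
    show ?thesis
      unfolding perm_act_split[of \<mu> i "v t" ?c] a
      by (intro tabloid_space.span_add seminormal_in_span st t)
  qed
qed

text \<open>The span is stable under adjacent transpositions, hence under all permutations, and
  contains the polytabloid of the column reading tableau. The translates of this polytabloid are all
  polytabloids.\<close>

lemma seminormal_span_eq: "seminormal_span = specht_module \<mu>"
proof
  show "seminormal_span \<subseteq> specht_module \<mu>"
    using seminormal_weight weight_space_specht
    by (intro tabloid_space.span_minimal subspace_specht) blast
  have sub: "seminormal_span \<subseteq> perm_module \<mu>"
    using seminormal_weight weight_space_perm_module
    by (intro tabloid_space.span_minimal subspace_perm_module) blast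
  have adj: "perm_act \<mu> (Transposition.transpose i (Suc i)) x \<in> seminormal_span"
    if i: "1 \<le> i" "i < sum_list \<mu>" and x: "x \<in> seminormal_span" for i x
  proof -
    have "v ` standard_tableaux \<mu> \<subseteq> {x. perm_act \<mu> (Transposition.transpose i (Suc i)) x \<in> seminormal_span}"
      using perm_act_seminormal i by blast
    then have "seminormal_span \<subseteq> {x. perm_act \<mu> (Transposition.transpose i (Suc i)) x \<in> seminormal_span}"
      by (rule tabloid_space.span_minimal[OF _ subspace_perm_act_vimage[OF tabloid_space.subspace_span]])
    with x show ?thesis
      by blast
  qed
  let ?t = "column_reading \<mu>"
  obtain a where "ptab \<mu> ?t = (\<lambda>X. a * v ?t X)"
    using seminormal_multiple[OF column_reading_standard polytabloid_weight_space[OF sorted]] by blast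
  then have e: "ptab \<mu> ?t \<in> seminormal_span"
    using seminormal_in_span[OF column_reading_standard] by simp
  have "ptab \<mu> s \<in> seminormal_span" if s: "s \<in> tableaux \<mu>" for s
  proof -
    obtain \<pi> where \<pi>: "entry_perm \<mu> \<pi>" "s = act \<mu> \<pi> ?t"
      using ex_act[OF s column_reading_tableau] .
    show ?thesis
      unfolding \<pi>(2) perm_act_polytabloid[OF column_reading_tableau \<pi>(1), symmetric]
      by (rule subspace_perm_act_closed[OF sub adj \<pi>(1) e])
  qed
  then show "specht_module \<mu> \<subseteq> seminormal_span"
    unfolding specht_module_def by (intro tabloid_space.span_minimal tabloid_space.subspace_span) blast
qed

lemma specht_expansion:
  assumes "x \<in> specht_module \<mu>"
  shows "\<exists>a. x = (\<Sum>t\<in>standard_tableaux \<mu>. (\<lambda>X. a t * v t X))"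
proof -
  have "x \<in> range (\<lambda>u. \<Sum>w\<in>v ` standard_tableaux \<mu>. (\<lambda>X. u w * w X))"
    using assms unfolding seminormal_span_eq[symmetric]
      tabloid_space.span_finite[OF finite_imageI[OF finite_standard_tableaux]] .
  then obtain u where "x = (\<Sum>w\<in>v ` standard_tableaux \<mu>. (\<lambda>X. u w * w X))"
    by blast
  also have "\<dots> = (\<Sum>t\<in>standard_tableaux \<mu>. (\<lambda>X. u (v t) * v t X))"
    unfolding sum.reindex[OF seminormal_inj] comp_def ..
  finally show ?thesis
    by (rule exI[of _ "\<lambda>t. u (v t)"])
qed

lemma seminormal_form_sum:
  assumes "s \<in> standard_tableaux \<mu>"
  shows "tabloid_form \<mu> (v s) (\<Sum>t\<in>standard_tableaux \<mu>. (\<lambda>X. a t * v t X)) = a s * tabloid_form \<mu> (v s) (v s)"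
proof -
  have "tabloid_form \<mu> (v s) (\<Sum>t\<in>standard_tableaux \<mu>. (\<lambda>X. a t * v t X))
      = (\<Sum>t\<in>standard_tableaux \<mu>. a t * tabloid_form \<mu> (v s) (v t))"
    unfolding tabloid_form_sum_right tabloid_form_scale_right ..
  also have "\<dots> = (\<Sum>t\<in>{s}. a t * tabloid_form \<mu> (v s) (v t))"
    using assms seminormal_orthogonal[OF assms] finite_standard_tableaux
    by (intro sum.mono_neutral_right) auto
  finally show ?thesis
    by simp
qed

text \<open>Orthogonal vectors of nonzero norm are independent. This ties the assumption on the
  dimension to the number of standard tableaux that the beta numbers compute.\<close>

lemma specht_dim_eq: "specht_dim \<mu> = card (standard_tableaux \<mu>)"
proof -
  have "tabloid_space.independent (v ` standard_tableaux \<mu>)"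
  proof (rule tabloid_space.independent_if_scalars_zero[OF finite_imageI[OF finite_standard_tableaux]])
    fix f w assume sum0: "(\<Sum>w\<in>v ` standard_tableaux \<mu>. (\<lambda>X. f w * w X)) = 0" and w: "w \<in> v ` standard_tableaux \<mu>"
    obtain s where s: "s \<in> standard_tableaux \<mu>" "w = v s"
      using w by blast
    have "(\<Sum>t\<in>standard_tableaux \<mu>. (\<lambda>X. f (v t) * v t X)) = 0"
      using sum0 unfolding sum.reindex[OF seminormal_inj] comp_def .
    then have "f (v s) * tabloid_form \<mu> (v s) (v s) = tabloid_form \<mu> (v s) 0"
      unfolding seminormal_form_sum[OF s(1), of "\<lambda>t. f (v t)", symmetric] by (rule arg_cong)
    also have "\<dots> = 0"
      by (simp add: tabloid_form_def)
    finally show "f w = 0"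
      using seminormal_norm[OF s(1)] s(2) by simp
  qed
  moreover have "tabloid_space.span (v ` standard_tableaux \<mu>) = tabloid_space.span (specht_module \<mu>)"
    unfolding seminormal_span_eq unfolding specht_module_def tabloid_space.span_span ..
  ultimately have "specht_dim \<mu> = card (v ` standard_tableaux \<mu>)"
    unfolding specht_dim_def by (intro tabloid_space.dim_eq_card)
  then show ?thesis
    by (simp add: card_image[OF seminormal_inj])
qed

section \<open>The Gram determinant up to squares\<close>

lemma of_int_polytabloid: "of_int (polytabloid \<mu> t X) = ptab \<mu> t X"
  unfolding polytabloid_def of_int_sum of_int_mult by (intro sum.cong refl) simp

lemma of_int_tabloid_form:
  "of_int (tabloid_form \<mu> (polytabloid \<mu> s) (polytabloid \<mu> t)) = tabloid_form \<mu> (ptab \<mu> s) (ptab \<mu> t)"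
  unfolding tabloid_form_def of_int_sum of_int_mult of_int_polytabloid ..

text \<open>Expanding the standard polytabloids in the orthogonal basis writes the Gram matrix as
  \<open>A * (D * transpose_mat A)\<close> with \<open>D\<close> the diagonal matrix of norms;
  \<open>r\<close> is the determinant of \<open>A\<close>.\<close>

lemma gram_det_factorization:
  "\<exists>r. of_int (gram_det \<mu>) = r\<^sup>2 * (\<Prod>t\<in>standard_tableaux \<mu>. tabloid_form \<mu> (v t) (v t))"
proof -
  obtain ts where ts: "distinct ts" "set ts = standard_tableaux \<mu>"
    using ex_standard_enumeration by blast
  define N where "N = length ts"
  have tsN: "ts ! i \<in> standard_tableaux \<mu>" if "i < N" for i
    using nth_mem[of i ts] that unfolding N_def ts(2) .
  have "\<forall>s\<in>standard_tableaux \<mu>. \<exists>a. ptab \<mu> s = (\<Sum>t\<in>standard_tableaux \<mu>. (\<lambda>X. a t * v t X))"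
    using specht_expansion polytabloid_in_specht standard_tableauD(1) by blast
  then obtain a where a: "\<And>s. s \<in> standard_tableaux \<mu> \<Longrightarrow> ptab \<mu> s = (\<Sum>t\<in>standard_tableaux \<mu>. (\<lambda>X. a s t * v t X))"
    by metis
  let ?\<gamma> = "\<lambda>t. tabloid_form \<mu> (v t) (v t)"
  have form: "tabloid_form \<mu> (ptab \<mu> s) (ptab \<mu> t) = (\<Sum>u\<in>standard_tableaux \<mu>. a s u * (?\<gamma> u * a t u))"
    if st: "s \<in> standard_tableaux \<mu>" "t \<in> standard_tableaux \<mu>" for s t
  proof -
    have "tabloid_form \<mu> (ptab \<mu> s) (ptab \<mu> t)
        = (\<Sum>u\<in>standard_tableaux \<mu>. a s u * tabloid_form \<mu> (v u) (ptab \<mu> t))"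
      by (subst a[OF st(1)]) (simp only: tabloid_form_sum_left tabloid_form_scale_left)
    also have "\<dots> = (\<Sum>u\<in>standard_tableaux \<mu>. a s u * (?\<gamma> u * a t u))"
      by (intro sum.cong refl) (simp only: a[OF st(2)] seminormal_form_sum mult.commute)
    finally show ?thesis .
  qed
  have list: "(\<Sum>u\<in>standard_tableaux \<mu>. f u) = (\<Sum>l\<in>{0..<N}. f (ts ! l))" for f :: "tableau \<Rightarrow> rat"
    using sum.distinct_set_conv_list[OF ts(1), of f] ts(2)
    by (simp add: sum_list_sum_nth N_def)
  define A where "A = mat N N (\<lambda>(i, j). a (ts ! i) (ts ! j))"
  define D where "D = mat N N (\<lambda>(i, j). if i = j then ?\<gamma> (ts ! j) else 0)"
  have carr: "A \<in> carrier_mat N N" "D \<in> carrier_mat N N" "transpose_mat A \<in> carrier_mat N N"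
    by (simp_all add: A_def D_def)
  have DA: "(D * transpose_mat A) $$ (l, j) = ?\<gamma> (ts ! l) * a (ts ! j) (ts ! l)" if "l < N" "j < N" for l j
  proof -
    have "(D * transpose_mat A) $$ (l, j) = (\<Sum>m\<in>{0..<N}. (if l = m then ?\<gamma> (ts ! m) else 0) * a (ts ! j) (ts ! m))"
      using that by (simp add: A_def D_def scalar_prod_def)
    also have "\<dots> = (\<Sum>m\<in>{0..<N}. if l = m then ?\<gamma> (ts ! m) * a (ts ! j) (ts ! m) else 0)"
      by (intro sum.cong refl) simp
    also have "\<dots> = ?\<gamma> (ts ! l) * a (ts ! j) (ts ! l)"
      using that by (subst sum.delta') auto
    finally show ?thesis .
  qed
  have "map_mat of_int (gram_matrix \<mu> ts) = A * (D * transpose_mat A)"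
  proof (rule eq_matI)
    fix i j assume "i < dim_row (A * (D * transpose_mat A))" "j < dim_col (A * (D * transpose_mat A))"
    then have ij: "i < N" "j < N"
      by (simp_all add: A_def D_def)
    have "(A * (D * transpose_mat A)) $$ (i, j) = (\<Sum>l\<in>{0..<N}. a (ts ! i) (ts ! l) * (D * transpose_mat A) $$ (l, j))"
      using ij carr by (simp add: scalar_prod_def A_def del: index_mult_mat(1)) (simp add: scalar_prod_def)
    also have "\<dots> = (\<Sum>l\<in>{0..<N}. a (ts ! i) (ts ! l) * (?\<gamma> (ts ! l) * a (ts ! j) (ts ! l)))"
      using ij(2) DA by (intro sum.cong refl) simp
    also have "\<dots> = tabloid_form \<mu> (ptab \<mu> (ts ! i)) (ptab \<mu> (ts ! j))"
      unfolding form[OF tsN[OF ij(1)] tsN[OF ij(2)]] list ..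
    also have "\<dots> = map_mat of_int (gram_matrix \<mu> ts) $$ (i, j)"
      using ij by (simp add: gram_matrix_def N_def of_int_tabloid_form)
    finally show "map_mat of_int (gram_matrix \<mu> ts) $$ (i, j) = (A * (D * transpose_mat A)) $$ (i, j)"
      by simp
  qed (simp_all add: gram_matrix_def N_def A_def D_def)
  then have "of_int (det (gram_matrix \<mu> ts)) = det (A * (D * transpose_mat A))"
    by (simp flip: of_int_hom.hom_det)
  also have "\<dots> = det A * (det D * det A)"
    using carr by (simp add: det_mult[of _ N] det_transpose[of _ N])
  also have "det D = prod_list (diag_mat D)"
    by (rule det_upper_triangular[OF _ carr(2)]) (auto simp: D_def)
  also have "diag_mat D = map (\<lambda>l. ?\<gamma> (ts ! l)) [0..<N]"
    by (simp add: diag_mat_def D_def)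
  also have "\<dots> = map ?\<gamma> ts"
    by (rule nth_equalityI) (simp_all add: N_def)
  also have "prod_list (map ?\<gamma> ts) = (\<Prod>t\<in>standard_tableaux \<mu>. ?\<gamma> t)"
    using prod.distinct_set_conv_list[OF ts(1), of ?\<gamma>] ts(2) by simp
  finally have "of_int (gram_det \<mu>) = (det A)\<^sup>2 * (\<Prod>t\<in>standard_tableaux \<mu>. ?\<gamma> t)"
    unfolding gram_det_eq[OF ts] by (simp add: power2_eq_square)
  then show ?thesis
    by blast
qed

text \<open>The common factor \<open>g\<close> occurs once for each standard tableau, and their
  number is even, so its total power is a square.\<close>

lemma gram_det_square_class:
  assumes "even (card (standard_tableaux \<mu>))"
  shows "\<exists>r. of_int (gram_det \<mu>) = r\<^sup>2 * (of_int (\<Prod>t\<in>standard_tableaux \<mu>. inversion_product \<mu> t) :: rat)"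
proof -
  obtain r where r: "of_int (gram_det \<mu>) = r\<^sup>2 * (\<Prod>t\<in>standard_tableaux \<mu>. tabloid_form \<mu> (v t) (v t))"
    using gram_det_factorization by blast
  obtain y where y: "\<And>t. t \<in> standard_tableaux \<mu> \<Longrightarrow> tabloid_form \<mu> (v t) (v t) = g * of_int (inversion_product \<mu> t) * (y t)\<^sup>2"
    using v unfolding seminormal_vector_def by metis
  obtain h where h: "card (standard_tableaux \<mu>) = 2 * h"
    using assms by blast
  have "(\<Prod>t\<in>standard_tableaux \<mu>. tabloid_form \<mu> (v t) (v t))
      = g ^ card (standard_tableaux \<mu>) * of_int (\<Prod>t\<in>standard_tableaux \<mu>. inversion_product \<mu> t) * (\<Prod>t\<in>standard_tableaux \<mu>. y t)\<^sup>2"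
    using y by (simp add: prod.distrib prod_power_distrib)
  also have "g ^ card (standard_tableaux \<mu>) = (g ^ h)\<^sup>2"
    unfolding h by (simp add: power_mult mult.commute)
  finally have "of_int (gram_det \<mu>) = (r * g ^ h * (\<Prod>t\<in>standard_tableaux \<mu>. y t))\<^sup>2 * of_int (\<Prod>t\<in>standard_tableaux \<mu>. inversion_product \<mu> t)"
    unfolding r by (simp add: power_mult_distrib)
  then show ?thesis
    by blast
qed

end

section \<open>Comparison of 2-adic valuations\<close>

lemma even_exponent_if_square_class:
  fixes m P a :: int and r :: rat
  assumes eq: "of_int m * 2 powi a = r\<^sup>2 * of_int P" and "odd m" and P: "P \<noteq> 0"
    and even: "even (multiplicity 2 P)"
  shows "even a"
proof -
  have two: "prime_elem (2::int)"
    by (metis of_nat_numeral prime_imp_prime_elem prime_nat_int_transfer two_is_prime_nat)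
  obtain p q where pq: "quotient_of r = (p, q)"
    by (cases "quotient_of r")
  have q: "q > 0" and r: "r = of_int p / of_int q"
    using quotient_of_denom_pos[OF pq] quotient_of_div[OF pq] by auto
  have m0: "m \<noteq> 0" and vm: "multiplicity 2 m = 0"
    using \<open>odd m\<close> by (auto simp: not_dvd_imp_multiplicity_0)
  have "r \<noteq> 0"
    using eq m0 by auto
  then have p: "p \<noteq> 0"
    by (auto simp: r)
  \<comment> \<open>The positive and negative parts of \<open>a\<close> clear the denominator of the
    power of 2; together with the denominator of \<open>r\<close> this yields an equation between
    integers, where valuations can be compared.\<close>
  define b c where "b = nat a" and "c = nat (- a)"
  have a: "a = int b - int c"
    by (auto simp: b_def c_def)
  have "(2 :: rat) powi a = 2 ^ b / 2 ^ c"
    unfolding a by (simp add: power_int_diff)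
  with eq have "of_int m * 2 ^ b * (of_int q)\<^sup>2 = (of_int p)\<^sup>2 * of_int P * (2 ^ c :: rat)"
    using q by (simp add: r field_simps power_divide)
  then have "of_int (m * 2 ^ b * q\<^sup>2) = (of_int (p\<^sup>2 * P * 2 ^ c) :: rat)"
    by simp
  then have "m * 2 ^ b * q\<^sup>2 = p\<^sup>2 * P * 2 ^ c"
    by (simp only: of_int_eq_iff)
  then have "multiplicity 2 (m * 2 ^ b * q\<^sup>2) = multiplicity 2 (p\<^sup>2 * P * 2 ^ c)"
    by simp
  then have "b + 2 * multiplicity 2 q = 2 * multiplicity 2 p + multiplicity 2 P + c"
    using m0 p q P vm
    by (simp add: prime_elem_multiplicity_mult_distrib[OF two] prime_elem_multiplicity_power_distrib[OF two])
  then have "even (b + c)"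
    using even by presburger
  then show ?thesis
    unfolding a by simp
qed

theorem theorem1p1:
  fixes n :: nat and \<mu> :: "nat list" and m a :: int
  assumes "n > 0"
    and "partition_of n \<mu>"
    and "even (specht_dim \<mu>)"
    and "odd m"
    and "(of_int (gram_det \<mu>) :: rat) = of_int m * 2 powi a"
  shows "even a"
proof -
  have sorted: "sorted_wrt (\<ge>) \<mu>"
    using assms(2) by (simp add: partition_of_def)
  obtain g v where gv: "g \<noteq> 0" "\<And>t. t \<in> standard_tableaux \<mu> \<Longrightarrow> seminormal_vector \<mu> g t (v t)"
    by (rule ex_seminormal_vectors[OF sorted]) blast
  have even: "even (card (standard_tableaux \<mu>))"
    using assms(3) specht_dim_eq[OF sorted gv] by simp
  let ?P = "\<Prod>t\<in>standard_tableaux \<mu>. inversion_product \<mu> t"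
  obtain r where "of_int m * 2 powi a = r\<^sup>2 * (of_int ?P :: rat)"
    using gram_det_square_class[OF sorted gv even] assms(5) by auto
  moreover have "?P \<noteq> 0"
    using inversion_product_pos[OF _ sorted] finite_standard_tableaux by (force simp: prod_zero_iff)
  ultimately show "even a"
    using assms(4) even_multiplicity_prod_inversion_product[OF sorted even]
    by (intro even_exponent_if_square_class)
qed

end
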